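(* Let $\{A_i\}$ be an inverse system of abelian groups indexed by $\mathbb{N}$ such that all the maps $A_{i+1} \to A_i$ are epimorphisms. Then: (1) The cokernel of the natural map $H_2(\varprojlim A_i) \to \varprojlim H_2(A_i)$ is a cotorsion group. (2) Suppose, additionally, that for every $i$ the torsion subgroup of $A_i$ is a group of bounded exponent. Then the cokernel of the natural map $H_3(\varprojlim A_i) \to \varprojlim H_3(A_i)$ is a cotorsion group. In particular, this holds if all $A_i$ are finitely generated.
   Context: $H_n(G) = H_n(G,\mathbb{Z})$ denotes the $n$-th group homology with integer coefficients. An abelian group $A$ is called a cotorsion group if $A \cong {\varprojlim}^1 B_i$ for some tower (inverse system indexed by $\mathbb{N}$) of abelian groups $B_i$; equivalently, if $\mathrm{Ext}(C,A)=0$ for every torsion-free abelian group $C$. *)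

theory Defs
  imports "HOL-Algebra.Free_Abelian_Groups"
begin

section \<open>Towers of abelian groups\<close>

definition abelian_tower :: "(nat \<Rightarrow> 'a monoid) \<Rightarrow> (nat \<Rightarrow> 'a \<Rightarrow> 'a) \<Rightarrow> bool" where
  "abelian_tower A p \<longleftrightarrow>
     (\<forall>i. comm_group (A i)) \<and> (\<forall>i. p i \<in> hom (A (Suc i)) (A i))"

definition inv_limit :: "(nat \<Rightarrow> 'a monoid) \<Rightarrow> (nat \<Rightarrow> 'a \<Rightarrow> 'a) \<Rightarrow> (nat \<Rightarrow> 'a) monoid" where
  "inv_limit A p =
     (product_group UNIV A)
       \<lparr>carrier := {x \<in> carrier (product_group UNIV A). \<forall>i. p i (x (Suc i)) = x i}\<rparr>"

definition cokernel :: "'a monoid \<Rightarrow> 'b monoid \<Rightarrow> ('a \<Rightarrow> 'b) \<Rightarrow> 'b set monoid" where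
  "cokernel G H h = H Mod (h ` carrier G)"

definition lim1 :: "(nat \<Rightarrow> 'a monoid) \<Rightarrow> (nat \<Rightarrow> 'a \<Rightarrow> 'a) \<Rightarrow> (nat \<Rightarrow> 'a) set monoid" where
  "lim1 A p =
     cokernel (product_group UNIV A) (product_group UNIV A)
       (\<lambda>x i. x i \<otimes>\<^bsub>A i\<^esub> inv\<^bsub>A i\<^esub> (p i (x (Suc i))))"

text \<open>
  An abelian group is cotorsion if it is isomorphic to the first derived limit of some tower.
  HOL cannot quantify over the type of the groups in the tower inside a definition; the fixed
  type used here is large enough that nothing is lost, as \<open>cotorsion_groupI\<close> below shows:
  towers over an arbitrary type give the same notion.
\<close>

definition cotorsion_group :: "'a monoid \<Rightarrow> bool" where
  "cotorsion_group A \<longleftrightarrow>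
     comm_group A \<and>
     (\<exists>(B :: nat \<Rightarrow> (nat \<Rightarrow> 'a \<Rightarrow>\<^sub>0 int) monoid) q. abelian_tower B q \<and> A \<cong> lim1 B q)"

lemma comm_group_product_group:
  assumes "\<And>i. i \<in> I \<Longrightarrow> comm_group (G i)"
  shows "comm_group (product_group I G)"
proof (rule group.group_comm_groupI)
  show "group (product_group I G)"
    using assms by (simp add: comm_group_def)
  show "x \<otimes>\<^bsub>product_group I G\<^esub> y = y \<otimes>\<^bsub>product_group I G\<^esub> x"
    if "x \<in> carrier (product_group I G)" "y \<in> carrier (product_group I G)" for x y
    using that assms by (auto simp: PiE_iff comm_groupE(4) intro!: restrict_ext)
qed

lemma comm_group_subgroup:
  assumes "comm_group G" "subgroup H G"
  shows "comm_group (G\<lparr>carrier := H\<rparr>)"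
  by (rule group.group_comm_groupI) (use assms in \<open>auto simp: comm_group_def group.subgroup_imp_group comm_groupE(4) subgroup.mem_carrier\<close>)

text \<open>
  If \<open>A\<close> is the first derived limit of the tower \<open>B\<close> and \<open>F\<close> is the free abelian group on \<open>A\<close>,
  then the sum map \<open>F \<oplus> F \<oplus> \<dots> \<rightarrow> A\<close> extends to a map \<open>T\<close> on the countable power \<open>Q\<close> of \<open>F\<close>.
  Every tail of \<open>Q\<close> maps onto \<open>A\<close>, so \<open>A\<close> is the first derived limit of the kernels of \<open>T\<close> on
  the tails of \<open>Q\<close>.
\<close>

lemma cotorsion_groupI:
  fixes A :: "'a monoid" and B :: "nat \<Rightarrow> 'b monoid"
  assumes A: "comm_group A" and B: "abelian_tower B f" and iso: "A \<cong> lim1 B f"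
  shows "cotorsion_group A"
proof -
  define P where "P = product_group UNIV B"
  define D where "D = (\<lambda>x i. x i \<otimes>\<^bsub>B i\<^esub> inv\<^bsub>B i\<^esub> (f i (x (Suc i))))"
  define R where "R = D ` carrier P"
  have cB: "comm_group (B i)" and gB: "group (B i)" and fB: "f i \<in> hom (B (Suc i)) (B i)" for i
    using B by (auto simp: abelian_tower_def comm_group_def)
  have fc: "x \<in> carrier (B (Suc i)) \<Longrightarrow> f i x \<in> carrier (B i)" for i x
    using fB by (meson hom_carrier image_subset_iff)
  have cP: "comm_group P"
    unfolding P_def by (rule comm_group_product_group) (rule cB)
  then have gP: "group P" by (simp add: comm_group_def)
  have memP: "x \<in> carrier P \<longleftrightarrow> (\<forall>i. x i \<in> carrier (B i))" for x
    by (auto simp: P_def)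
  have multP: "x \<otimes>\<^bsub>P\<^esub> y = (\<lambda>i. x i \<otimes>\<^bsub>B i\<^esub> y i)" for x y
    by (simp add: P_def restrict_UNIV)
  have oneP: "\<one>\<^bsub>P\<^esub> = (\<lambda>i. \<one>\<^bsub>B i\<^esub>)"
    by (simp add: P_def restrict_UNIV)
  have invP: "x \<in> carrier P \<Longrightarrow> inv\<^bsub>P\<^esub> x = (\<lambda>i. inv\<^bsub>B i\<^esub> x i)" for x
    using gB by (simp add: P_def restrict_UNIV)
  have Dhom: "D \<in> hom P P"
  proof (rule homI)
    show "D x \<in> carrier P" if "x \<in> carrier P" for x
      using that gB fc by (auto simp: memP D_def group.is_monoid monoid.m_closed)
    show "D (x \<otimes>\<^bsub>P\<^esub> y) = D x \<otimes>\<^bsub>P\<^esub> D y" if xy: "x \<in> carrier P" "y \<in> carrier P" for x y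
    proof
      fix i
      interpret comm_group "B i" by (rule cB)
      have "x i \<in> carrier (B i)" "y i \<in> carrier (B i)"
        "f i (x (Suc i)) \<in> carrier (B i)" "f i (y (Suc i)) \<in> carrier (B i)"
        "f i (x (Suc i) \<otimes>\<^bsub>B (Suc i)\<^esub> y (Suc i)) = f i (x (Suc i)) \<otimes>\<^bsub>B i\<^esub> f i (y (Suc i))"
        using xy fc fB by (auto simp: memP hom_mult)
      then show "D (x \<otimes>\<^bsub>P\<^esub> y) i = (D x \<otimes>\<^bsub>P\<^esub> D y) i"
        by (simp add: D_def multP inv_mult m_ac)
    qed
  qed
  interpret D: group_hom P P D
    using gP Dhom by (simp add: group_hom_def group_hom_axioms_def)
  have sR: "subgroup R P"
    unfolding R_def by (rule D.img_is_subgroup)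
  have nR: "R \<lhd> P"
    using cP sR by (rule comm_group.subgroup_imp_normal)
  define M where "M = P Mod R"
  have gM: "group M"
    unfolding M_def using nR by (rule normal.factorgroup_is_group)
  have lim: "lim1 B f = M"
    by (simp add: lim1_def cokernel_def M_def R_def P_def D_def)
  have qhom: "(\<lambda>x. R #>\<^bsub>P\<^esub> x) \<in> hom P M"
    unfolding M_def using nR by (rule normal.r_coset_hom_Mod)
  have carM: "carrier M = (\<lambda>x. R #>\<^bsub>P\<^esub> x) ` carrier P"
    by (simp add: M_def carrier_FactGroup)
  obtain \<phi> where \<phi>: "\<phi> \<in> iso A M"
    using iso lim by (auto simp: is_iso_def)
  have \<phi>im: "\<phi> ` carrier A = carrier M"
    using \<phi> by (auto simp: iso_def bij_betw_def)
  have "\<exists>\<sigma>. \<forall>a\<in>carrier A. \<sigma> a \<in> carrier P \<and> R #>\<^bsub>P\<^esub> \<sigma> a = \<phi> a"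
    using \<phi>im carM by (intro bchoice ballI) (metis imageE image_eqI)
  then obtain \<sigma> where \<sigma>: "\<And>a. a \<in> carrier A \<Longrightarrow> \<sigma> a \<in> carrier P \<and> R #>\<^bsub>P\<^esub> \<sigma> a = \<phi> a"
    by blast
  define F where "F = free_Abelian_group (carrier A)"
  obtain h where h: "h \<in> hom F P" and h_of: "\<And>a. a \<in> carrier A \<Longrightarrow> h (frag_of a) = \<sigma> a"
    using comm_group.free_Abelian_group_universal [OF cP, of \<sigma> "carrier A"] \<sigma>
    unfolding F_def by (metis image_subsetI)
  define Q where "Q = product_group UNIV (\<lambda>_::nat. F)"
  have cF: "comm_group F" and gF: "group F"
    by (auto simp: F_def abelian_free_Abelian_group)
  have cQ: "comm_group Q"
    unfolding Q_def by (rule comm_group_product_group) (rule cF)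
  then have gQ: "group Q" by (simp add: comm_group_def)
  have memQ: "x \<in> carrier Q \<longleftrightarrow> (\<forall>i. x i \<in> carrier F)" for x
    by (auto simp: Q_def)
  have multQ: "x \<otimes>\<^bsub>Q\<^esub> y = (\<lambda>i. x i + y i)" for x y
    by (simp add: Q_def restrict_UNIV F_def)
  have oneQ: "\<one>\<^bsub>Q\<^esub> = (\<lambda>i. 0)"
    by (simp add: Q_def restrict_UNIV F_def)
  have invQ: "x \<in> carrier Q \<Longrightarrow> inv\<^bsub>Q\<^esub> x = (\<lambda>i. - x i)" for x
    by (auto simp: Q_def F_def restrict_UNIV PiE_iff fun_eq_iff)
  have Fadd: "u \<in> carrier F \<Longrightarrow> v \<in> carrier F \<Longrightarrow> u + v \<in> carrier F" for u v
    using group.is_monoid [OF gF] by (metis F_def monoid.m_closed mult_free_Abelian_group)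
  have Fneg: "u \<in> carrier F \<Longrightarrow> - u \<in> carrier F" for u
    by (simp add: F_def)
  have Fdiff: "u \<in> carrier F \<Longrightarrow> v \<in> carrier F \<Longrightarrow> u - v \<in> carrier F" for u v
    using Fadd Fneg by (metis diff_conv_add_uminus)
  have F0: "0 \<in> carrier F"
    by (simp add: F_def)
  have Fsum: "(\<And>i. i \<in> I \<Longrightarrow> u i \<in> carrier F) \<Longrightarrow> sum u I \<in> carrier F" for u :: "nat \<Rightarrow> 'a \<Rightarrow>\<^sub>0 int" and I
    unfolding F_def by (rule sum_closed_free_Abelian_group)
  have hP: "u \<in> carrier F \<Longrightarrow> h u \<in> carrier P" for u
    using h by (meson hom_carrier image_subset_iff)
  have hB: "u \<in> carrier F \<Longrightarrow> h u i \<in> carrier (B i)" for u i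
    using hP memP by blast
  have h_add: "h (u + v) i = h u i \<otimes>\<^bsub>B i\<^esub> h v i" if "u \<in> carrier F" "v \<in> carrier F" for u v i
    using hom_mult [OF h that] by (simp add: multP F_def)
  have h0: "h 0 i = \<one>\<^bsub>B i\<^esub>" for i
    using hom_one [OF h gF gP] by (simp add: oneP F_def)
  define t where "t = (\<lambda>x k. finprod (B k) (\<lambda>j. h (x j) k) {..k})"
  have tP: "t x \<in> carrier P" if "x \<in> carrier Q" for x
    using that hB cB
    by (auto simp: memP memQ t_def Pi_iff comm_group.axioms(1) intro!: comm_monoid.finprod_closed)
  have thom: "t \<in> hom Q P"
  proof (rule homI)
    show "t (x \<otimes>\<^bsub>Q\<^esub> y) = t x \<otimes>\<^bsub>P\<^esub> t y" if xy: "x \<in> carrier Q" "y \<in> carrier Q" for x y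
    proof
      fix k
      interpret comm_group "B k" by (rule cB)
      have "finprod (B k) (\<lambda>j. h (x j + y j) k) {..k} =
            finprod (B k) (\<lambda>j. h (x j) k \<otimes>\<^bsub>B k\<^esub> h (y j) k) {..k}"
        using xy hB by (intro finprod_cong) (auto simp: h_add memQ)
      also have "\<dots> = t x k \<otimes>\<^bsub>B k\<^esub> t y k"
        unfolding t_def using xy hB by (intro finprod_multf) (auto simp: memQ)
      finally show "t (x \<otimes>\<^bsub>Q\<^esub> y) k = (t x \<otimes>\<^bsub>P\<^esub> t y) k"
        by (simp add: multQ multP t_def)
    qed
  qed (rule tP)
  define s where "s = (\<lambda>(j::nat) u (i::nat). if i = j then u else (0::'a \<Rightarrow>\<^sub>0 int))"
  have sQ: "u \<in> carrier F \<Longrightarrow> s j u \<in> carrier Q" for j u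
    by (auto simp: s_def memQ F0)
  have t_s: "t (s j u) = (\<lambda>k. if j \<le> k then h u k else \<one>\<^bsub>B k\<^esub>)" if u: "u \<in> carrier F" for j u
  proof
    fix k
    interpret comm_group "B k" by (rule cB)
    have "t (s j u) k = finprod (B k) (\<lambda>i. if j = i then h u k else \<one>\<^bsub>B k\<^esub>) {..k}"
      unfolding t_def s_def using u hB by (intro finprod_cong) (auto simp: h0 simp_implies_def)
    also have "\<dots> = (if j \<le> k then h u k else \<one>\<^bsub>B k\<^esub>)"
    proof (cases "j \<le> k")
      case True
      then show ?thesis
        using finprod_singleton [of j "{..k}" "\<lambda>_. h u k"] u hB by simp
    next
      case False
      then have "finprod (B k) (\<lambda>i. if j = i then h u k else \<one>\<^bsub>B k\<^esub>) {..k} = finprod (B k) (\<lambda>i. \<one>\<^bsub>B k\<^esub>) {..k}"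
        by (intro finprod_cong) auto
      then show ?thesis using False by simp
    qed
    finally show "t (s j u) k = (if j \<le> k then h u k else \<one>\<^bsub>B k\<^esub>)" .
  qed
  have shift: "t (s j u) \<otimes>\<^bsub>P\<^esub> inv\<^bsub>P\<^esub> (t (s (Suc j) u)) \<in> R" if u: "u \<in> carrier F" for j u
  proof -
    \<comment> \<open>the element concentrated in coordinate \<open>j\<close> is a coboundary\<close>
    define e where "e = (\<lambda>k. if k = j then h u j else \<one>\<^bsub>B k\<^esub>)"
    have e: "t (s j u) \<otimes>\<^bsub>P\<^esub> inv\<^bsub>P\<^esub> (t (s (Suc j) u)) = e"
    proof
      fix k
      interpret comm_group "B k" by (rule cB)
      show "(t (s j u) \<otimes>\<^bsub>P\<^esub> inv\<^bsub>P\<^esub> (t (s (Suc j) u))) k = e k"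
        unfolding multP
        unfolding invP [OF tP [OF sQ [OF u]]]
        unfolding t_s [OF u] e_def using hB [OF u] by (cases "k = j") (use inv_one r_one in auto)
    qed
    define g where "g = rec_nat (h u j) (\<lambda>n v. f (j - Suc n) v)"
    have g: "n \<le> j \<Longrightarrow> g n \<in> carrier (B (j - n))" for n
    proof (induction n)
      case (Suc n)
      then have "g n \<in> carrier (B (Suc (j - Suc n)))"
        by (metis Suc_diff_le Suc_leD diff_Suc_Suc)
      then show ?case by (simp add: g_def fc)
    qed (simp add: g_def hB u)
    define c where "c = (\<lambda>k. if k \<le> j then g (j - k) else \<one>\<^bsub>B k\<^esub>)"
    have c: "c \<in> carrier P"
      using g gB by (auto simp: memP c_def group.is_monoid) (metis diff_diff_cancel diff_le_self)
    have "D c k = e k" for k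
    proof -
      interpret comm_group "B k" by (rule cB)
      have f1: "f k \<one>\<^bsub>B (Suc k)\<^esub> = \<one>\<^bsub>B k\<^esub>"
        using fB gB by (simp add: hom_one)
      consider "k < j" | "k = j" | "k > j" by linarith
      then show ?thesis
      proof cases
        case 1
        then have "j - k = Suc (j - Suc k)" and "j - Suc (j - Suc k) = k"
          by auto
        then have "g (j - k) = f k (g (j - Suc k))"
          by (simp add: g_def)
        moreover have "g (j - k) \<in> carrier (B k)"
          using c 1 by (metis c_def less_imp_le_nat memP)
        ultimately show ?thesis
          using 1 by (simp add: D_def c_def e_def)
      next
        case 2
        have "D c k = h u j \<otimes>\<^bsub>B k\<^esub> inv\<^bsub>B k\<^esub> (f k \<one>\<^bsub>B (Suc k)\<^esub>)" and "h u j \<in> carrier (B k)"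
          using 2 hB [OF u] by (simp_all add: D_def c_def g_def)
        then have "D c k = h u j" by (simp add: f1)
        then show ?thesis using 2 by (simp add: e_def)
      next
        case 3
        then show ?thesis by (simp add: D_def c_def e_def f1)
      qed
    qed
    then have "e = D c" by auto
    then show ?thesis
      using e c by (auto simp: R_def)
  qed
  define T where "T = (\<lambda>x. R #>\<^bsub>P\<^esub> t x)"
  have Thom: "T \<in> hom Q M"
    using hom_compose [OF thom qhom] by (simp add: T_def o_def)
  interpret T: group_hom Q M T
    using gQ gM Thom by (simp add: group_hom_def group_hom_axioms_def)
  define N where "N = (\<lambda>i::nat. {x \<in> kernel Q M T. \<forall>j<i. x j = 0})"
  have kerQ: "x \<in> kernel Q M T \<Longrightarrow> x \<in> carrier Q" for x
    by (simp add: kernel_def)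
  have ker_add: "x \<in> kernel Q M T \<Longrightarrow> y \<in> kernel Q M T \<Longrightarrow> (\<lambda>i. x i + y i) \<in> kernel Q M T" for x y
    using subgroup.m_closed [OF T.subgroup_kernel, of x y] by (simp only: multQ)
  have ker_neg: "x \<in> kernel Q M T \<Longrightarrow> (\<lambda>i. - x i) \<in> kernel Q M T" for x
    using subgroup.m_inv_closed [OF T.subgroup_kernel, of x] invQ [OF kerQ, of x] by simp
  have ker0: "(\<lambda>i. 0) \<in> kernel Q M T"
    using subgroup.one_closed [OF T.subgroup_kernel] by (simp add: oneQ)
  have ker_diff: "(\<lambda>i. x i - y i) \<in> kernel Q M T"
    if "x \<in> kernel Q M T" "y \<in> kernel Q M T" for x y
    using ker_add [OF that(1) ker_neg [OF that(2)]] by simp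
  have sN: "subgroup (N i) Q" for i
  proof (rule group.subgroupI [OF gQ])
    show "N i \<subseteq> carrier Q" by (auto simp: N_def kerQ)
    show "N i \<noteq> {}" using ker0 by (auto simp: N_def)
    show "inv\<^bsub>Q\<^esub> x \<in> N i" if "x \<in> N i" for x
      using that by (auto simp: N_def invQ kerQ ker_neg)
    show "x \<otimes>\<^bsub>Q\<^esub> y \<in> N i" if "x \<in> N i" "y \<in> N i" for x y
      using that by (auto simp: N_def multQ ker_add)
  qed
  define C where "C = (\<lambda>i. Q\<lparr>carrier := N i\<rparr>)"
  have cC: "comm_group (C i)" and gC: "group (C i)" for i
    using comm_group_subgroup [OF cQ sN] by (auto simp: C_def comm_group_def)
  have multC: "x \<otimes>\<^bsub>C i\<^esub> y = (\<lambda>j. x j + y j)" for x y i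
    by (simp add: C_def multQ)
  have carC: "carrier (C i) = N i" for i
    by (simp add: C_def)
  have invC: "x \<in> N i \<Longrightarrow> inv\<^bsub>C i\<^esub> x = (\<lambda>j. - x j)" for x i
    using group.m_inv_consistent [OF gQ sN] by (auto simp: C_def invQ N_def kerQ)
  have NS: "N (Suc i) \<subseteq> N i" for i
    by (auto simp: N_def)
  have tower: "abelian_tower C (\<lambda>_ x. x)"
    using cC NS by (auto simp: abelian_tower_def hom_def carC multC)
  define PC where "PC = product_group UNIV C"
  have memPC: "y \<in> carrier PC \<longleftrightarrow> (\<forall>i. y i \<in> N i)" for y
    by (auto simp: PC_def carC)
  have multPC: "y \<otimes>\<^bsub>PC\<^esub> z = (\<lambda>i j. y i j + z i j)" for y z
    by (simp add: PC_def restrict_UNIV multC)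
  have gPC: "group PC"
    unfolding PC_def using gC by simp
  define S where "S = (\<lambda>(y :: nat \<Rightarrow> nat \<Rightarrow> 'a \<Rightarrow>\<^sub>0 int) j. \<Sum>i\<le>j. y i j)"
  have NF: "x \<in> N i \<Longrightarrow> x j \<in> carrier F" for x i j
    using kerQ memQ by (auto simp: N_def)
  have SQ: "S y \<in> carrier Q" if "y \<in> carrier PC" for y
    using that NF by (auto simp: memQ S_def memPC intro!: Fsum)
  have "S \<in> hom PC Q"
    using SQ by (auto simp: hom_def multPC multQ S_def sum.distrib)
  then have psi: "(\<lambda>y. T (S y)) \<in> hom PC M"
    using hom_compose [OF _ Thom] by (fastforce simp: o_def)
  interpret psi: group_hom PC M "\<lambda>y. T (S y)"
    using gPC gM psi by (simp add: group_hom_def group_hom_axioms_def)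
  have S_tele: "S (\<lambda>i j. z i j - z (Suc i) j) = z 0" if "\<And>i j. j < i \<Longrightarrow> z i j = 0" for z
  proof
    fix j
    have "(\<Sum>i\<le>j. z i j - z (Suc i) j) = z 0 j - z (Suc j) j"
      using sum_telescope [of "\<lambda>i. z i j"] by simp
    then show "S (\<lambda>i j. z i j - z (Suc i) j) j = z 0 j"
      using that by (simp add: S_def)
  qed
  have surj: "(\<lambda>y. T (S y)) ` carrier PC = carrier M"
  proof
    show "(\<lambda>y. T (S y)) ` carrier PC \<subseteq> carrier M"
      using psi by (rule hom_carrier)
    show "carrier M \<subseteq> (\<lambda>y. T (S y)) ` carrier PC"
    proof
      fix m assume "m \<in> carrier M"
      then obtain a where a: "a \<in> carrier A" "m = \<phi> a"
        using \<phi>im by blast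
      define u where "u = frag_of a"
      have u: "u \<in> carrier F" using a by (simp add: u_def F_def)
      define y where "y = (\<lambda>i j. s i u j - s (Suc i) u j)"
      have "y i \<in> N i" for i
      proof -
        have yi: "y i = s i u \<otimes>\<^bsub>Q\<^esub> inv\<^bsub>Q\<^esub> (s (Suc i) u)"
          by (simp add: y_def multQ invQ sQ u)
        interpret t: group_hom Q P t
          using gQ gP thom by (simp add: group_hom_def group_hom_axioms_def)
        have "t (y i) = t (s i u) \<otimes>\<^bsub>P\<^esub> inv\<^bsub>P\<^esub> (t (s (Suc i) u))"
          by (simp add: yi sQ u)
        then have "t (y i) \<in> R" using shift [OF u] by simp
        then have "T (y i) = R"
          unfolding T_def using group.coset_join2 [OF gP _ sR] tP sR
          by (meson subgroup.mem_carrier)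
        then have "T (y i) = \<one>\<^bsub>M\<^esub>" by (simp add: M_def FactGroup_def)
        moreover have "y i \<in> carrier Q"
          unfolding yi by (simp add: sQ u)
        ultimately show ?thesis
          by (auto simp: N_def kernel_def y_def s_def)
      qed
      then have "y \<in> carrier PC" by (simp add: memPC)
      moreover have "S y = s 0 u"
        unfolding y_def by (rule S_tele) (auto simp: s_def)
      moreover have "T (s 0 u) = m"
        using a \<sigma> h_of by (simp add: T_def t_s u) (simp add: u_def)
      ultimately show "m \<in> (\<lambda>y. T (S y)) ` carrier PC"
        by (auto intro!: image_eqI [of _ _ y])
    qed
  qed
  have ker: "kernel PC M (\<lambda>y. T (S y)) =
     (\<lambda>x i. x i \<otimes>\<^bsub>C i\<^esub> inv\<^bsub>C i\<^esub> (x (Suc i))) ` carrier PC" (is "?K = ?E ` _")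
  proof -
    have E: "?E z = (\<lambda>i j. z i j - z (Suc i) j)" if "z \<in> carrier PC" for z
    proof -
      have "z (Suc i) \<in> N i" for i
        using that NS by (auto simp: memPC)
      then show ?thesis
        by (simp add: multC invC)
    qed
    show ?thesis
    proof (intro equalityI subsetI)
      fix y assume y: "y \<in> ?K"
      then have yN: "\<And>i. y i \<in> N i" and yPC: "y \<in> carrier PC" and Sy: "S y \<in> kernel Q M T"
        using SQ by (auto simp: kernel_def memPC)
      define z where "z = (\<lambda>i j. S y j - (\<Sum>k<i. y k j))"
      have part: "(\<lambda>j. \<Sum>k<i. y k j) \<in> kernel Q M T" for i
      proof (induction i)
        case (Suc i)
        then show ?case
          using ker_add [OF Suc.IH, of "y i"] yN by (auto simp: N_def)
      qed (simp add: ker0)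
      have tail: "z i j = 0" if "j < i" for i j
      proof -
        have "(\<Sum>k<i. y k j) = (\<Sum>k\<le>j. y k j)"
          using that yN by (intro sum.mono_neutral_right) (auto simp: N_def)
        then show ?thesis by (simp add: z_def S_def)
      qed
      have "z i \<in> N i" for i
        using ker_diff [OF Sy part] tail by (auto simp: N_def z_def)
      then have zPC: "z \<in> carrier PC" by (simp add: memPC)
      have "?E z = y"
        unfolding E [OF zPC] by (simp add: z_def fun_eq_iff)
      then show "y \<in> ?E ` carrier PC" using zPC by blast
    next
      fix y assume "y \<in> ?E ` carrier PC"
      then obtain z where z: "z \<in> carrier PC" "y = (\<lambda>i j. z i j - z (Suc i) j)"
        using E by auto
      have zN: "\<And>i. z i \<in> N i" using z by (simp add: memPC)
      have "S y = z 0"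
        unfolding z(2) by (rule S_tele) (use zN in \<open>auto simp: N_def\<close>)
      then have "T (S y) = \<one>\<^bsub>M\<^esub>"
        using zN [of 0] by (simp add: N_def kernel_def)
      moreover have "y i \<in> N i" for i
        using zN [of i] zN [of "Suc i"] ker_diff by (auto simp: N_def z(2))
      ultimately show "y \<in> ?K"
        by (simp add: kernel_def memPC)
    qed
  qed
  have "lim1 C (\<lambda>_ x. x) \<cong> M"
    using psi.FactGroup_iso [OF surj] unfolding ker by (simp add: lim1_def cokernel_def PC_def)
  moreover have "group (lim1 C (\<lambda>_ x. x))"
    using normal.factorgroup_is_group [OF psi.normal_kernel] unfolding ker
    by (simp add: lim1_def cokernel_def PC_def)
  ultimately have "M \<cong> lim1 C (\<lambda>_ x. x)"
    by (simp add: group.iso_sym)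
  then have "A \<cong> lim1 C (\<lambda>_ x. x)"
    using iso lim iso_trans by metis
  then show ?thesis
    using A tower by (auto simp: cotorsion_group_def)
qed


section \<open>Integral group homology\<close>

text \<open>
  The homology of a group with trivial integer coefficients is the homology of the (unnormalised)
  bar complex: in degree \<open>n\<close> the free abelian group on the symbols $[g_1|\dots|g_n]$,
  represented by lists of length \<open>n\<close>, with
  $d[g_1|\dots|g_n] = [g_2|\dots|g_n] + \sum_{0<i<n} (-1)^i [g_1|\dots|g_i g_{i+1}|\dots|g_n]
  + (-1)^n [g_1|\dots|g_{n-1}]$.
\<close>

definition bar_chains :: "nat \<Rightarrow> 'a monoid \<Rightarrow> ('a list \<Rightarrow>\<^sub>0 int) monoid" where
  "bar_chains n G = free_Abelian_group {xs. length xs = n \<and> set xs \<subseteq> carrier G}"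

definition bar_face :: "'a monoid \<Rightarrow> nat \<Rightarrow> 'a list \<Rightarrow> 'a list" where
  "bar_face G i xs =
     (if i = 0 then tl xs
      else if i = length xs then butlast xs
      else take (i - 1) xs @ (xs ! (i - 1) \<otimes>\<^bsub>G\<^esub> xs ! i) # drop (i + 1) xs)"

definition bar_boundary :: "nat \<Rightarrow> 'a monoid \<Rightarrow> ('a list \<Rightarrow>\<^sub>0 int) \<Rightarrow> ('a list \<Rightarrow>\<^sub>0 int)" where
  "bar_boundary n G c =
     (if n = 0 then 0
      else frag_extend (\<lambda>xs. \<Sum>i\<le>n. frag_cmul ((-1) ^ i) (frag_of (bar_face G i xs))) c)"

definition bar_cycles :: "nat \<Rightarrow> 'a monoid \<Rightarrow> ('a list \<Rightarrow>\<^sub>0 int) monoid" where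
  "bar_cycles n G =
     (bar_chains n G)\<lparr>carrier := {c \<in> carrier (bar_chains n G). bar_boundary n G c = 0}\<rparr>"

definition bar_boundaries :: "nat \<Rightarrow> 'a monoid \<Rightarrow> ('a list \<Rightarrow>\<^sub>0 int) set" where
  "bar_boundaries n G = bar_boundary (Suc n) G ` carrier (bar_chains (Suc n) G)"

definition group_homology :: "nat \<Rightarrow> 'a monoid \<Rightarrow> ('a list \<Rightarrow>\<^sub>0 int) set monoid" where
  "group_homology n G = bar_cycles n G Mod bar_boundaries n G"

definition bar_map :: "('a \<Rightarrow> 'b) \<Rightarrow> ('a list \<Rightarrow>\<^sub>0 int) \<Rightarrow> ('b list \<Rightarrow>\<^sub>0 int)" where
  "bar_map h = frag_extend (\<lambda>xs. frag_of (map h xs))"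

text \<open>
  The induced map sends the class of a cycle \<open>c\<close> to the class of \<open>bar_map h c\<close>; for a homomorphism
  \<open>h\<close> all cosets in the union below coincide.
\<close>

definition homology_map ::
  "nat \<Rightarrow> 'b monoid \<Rightarrow> ('a \<Rightarrow> 'b) \<Rightarrow> ('a list \<Rightarrow>\<^sub>0 int) set \<Rightarrow> ('b list \<Rightarrow>\<^sub>0 int) set" where
  "homology_map n H h X = (\<Union>c\<in>X. bar_boundaries n H #>\<^bsub>bar_cycles n H\<^esub> bar_map h c)"

definition homology_limit ::
  "nat \<Rightarrow> (nat \<Rightarrow> 'a monoid) \<Rightarrow> (nat \<Rightarrow> 'a \<Rightarrow> 'a) \<Rightarrow> (nat \<Rightarrow> ('a list \<Rightarrow>\<^sub>0 int) set) monoid" where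
  "homology_limit n A p =
     inv_limit (\<lambda>i. group_homology n (A i)) (\<lambda>i. homology_map n (A i) (p i))"

definition homology_limit_map ::
  "nat \<Rightarrow> (nat \<Rightarrow> 'a monoid) \<Rightarrow> ((nat \<Rightarrow> 'a) list \<Rightarrow>\<^sub>0 int) set \<Rightarrow> nat \<Rightarrow> ('a list \<Rightarrow>\<^sub>0 int) set" where
  "homology_limit_map n A X = (\<lambda>i. homology_map n (A i) (\<lambda>x. x i) X)"


section \<open>Finiteness conditions\<close>

definition torsion_subgroup :: "'a monoid \<Rightarrow> 'a monoid" where
  "torsion_subgroup G =
     G\<lparr>carrier := {x \<in> carrier G. \<exists>k::nat. k > 0 \<and> x [^]\<^bsub>G\<^esub> k = \<one>\<^bsub>G\<^esub>}\<rparr>"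

definition bounded_exponent :: "'a monoid \<Rightarrow> bool" where
  "bounded_exponent G \<longleftrightarrow> (\<exists>m::nat. m > 0 \<and> (\<forall>x\<in>carrier G. x [^]\<^bsub>G\<^esub> m = \<one>\<^bsub>G\<^esub>))"

definition finitely_generated_group :: "'a monoid \<Rightarrow> bool" where
  "finitely_generated_group G \<longleftrightarrow>
     (\<exists>S. finite S \<and> S \<subseteq> carrier G \<and> generate G S = carrier G)"

end

theory Submission
  imports Complex_Main "HOL-Library.Function_Algebras" Defs
begin

text \<open>
  Let \<open>L\<close> be the limit of the tower. If for each \<open>i\<close> some positive multiple of \<open>H\<^sub>n(A\<^sub>i)\<close> lies in
  the image of \<open>H\<^sub>n(L)\<close>, then infinite systems \<open>x\<^sub>k = g\<^sub>k + e\<^sub>k x\<^sub>k\<^sub>+\<^sub>1\<close> with suitable \<open>e\<^sub>k\<close> are solvable in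
  the cokernel \<open>G\<close> of \<open>H\<^sub>n(L) \<rightarrow> lim H\<^sub>n(A\<^sub>i)\<close> by convergent series. This means that \<open>Ext(\<rat>, G) = 0\<close>,
  and such groups are first derived limits.

  For \<open>n = 2\<close> the map \<open>H\<^sub>2(L) \<rightarrow> H\<^sub>2(A\<^sub>i)\<close> is onto because \<open>H\<^sub>2\<close> of an abelian group is generated by the
  commutator cycles \<open>[a|b] - [b|a]\<close>.

  For general \<open>n\<close>, multiplication by \<open>k\<close> on \<open>A\<^sub>i\<close> acts on \<open>H\<^sub>n(A\<^sub>i)\<close> as a polynomial in \<open>k\<close> of degree at
  most \<open>n\<close>. If \<open>m\<close> kills the torsion of \<open>A\<^sub>i\<close>, then \<open>m\<close> times a finitely generated subgroup is free
  and lifts to \<open>L\<close>, so that multiplication by each multiple of \<open>m\<close> maps \<open>H\<^sub>n(A\<^sub>i)\<close> into the image of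
  \<open>H\<^sub>n(L)\<close>; by polynomiality the same holds for some fixed multiple of the identity.
\<close>

section \<open>Additive subgroups and chains\<close>

text \<open>The bound on the degree rests on one acyclicity statement. In the (n+1)-fold power of a
  vertex set, simplices modulo those with a constant coordinate have no homology in degrees up to n,
  so the diagonal is null-homotopic modulo such simplices, by operators natural in the simplex.
  Multiplying together the coordinates in \<open>T\<close> and taking the alternating sum over all
  \<open>T\<close> kills the simplices with a constant coordinate and turns the diagonal into an
  (n+1)-st finite difference of power maps. On cycles this difference is therefore a boundary. To
  reach a fixed multiple of the identity, differences with step m are compared with differences with
  step 1; the term of degree d costs a factor m^d. Torsion is harmless for n = 2 because arbitrary
  lifts of two elements commute in \<open>L\<close>. In higher degrees classes may come from torsion
  elements of \<open>A\<^sub>i\<close>, which need not lift to torsion elements of \<open>L\<close>.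
  Ext(Q, G) = 0 suffices for the criterion because the quotient along which a homomorphism is
  extended embeds in a rational vector space.\<close>

definition add_subgroup :: "'a::ab_group_add set \<Rightarrow> bool" where
  "add_subgroup S \<longleftrightarrow> 0 \<in> S \<and> (\<forall>x\<in>S. \<forall>y\<in>S. x - y \<in> S)"

lemma add_subgroupI:
  assumes "0 \<in> S" "\<And>x y. x \<in> S \<Longrightarrow> y \<in> S \<Longrightarrow> x - y \<in> S"
  shows "add_subgroup S"
  using assms by (simp add: add_subgroup_def)

lemma add_subgroup_zero: "add_subgroup S \<Longrightarrow> 0 \<in> S"
  by (simp add: add_subgroup_def)

lemma add_subgroup_diff: "add_subgroup S \<Longrightarrow> x \<in> S \<Longrightarrow> y \<in> S \<Longrightarrow> x - y \<in> S"
  by (simp add: add_subgroup_def)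

lemma add_subgroup_uminus: "add_subgroup S \<Longrightarrow> x \<in> S \<Longrightarrow> - x \<in> S"
  using add_subgroup_diff [of S 0 x] add_subgroup_zero by auto

lemma add_subgroup_add: "add_subgroup S \<Longrightarrow> x \<in> S \<Longrightarrow> y \<in> S \<Longrightarrow> x + y \<in> S"
  using add_subgroup_diff [of S x "- y"] add_subgroup_uminus by auto

lemma add_subgroup_sum: "add_subgroup S \<Longrightarrow> (\<And>i. i \<in> I \<Longrightarrow> f i \<in> S) \<Longrightarrow> sum f I \<in> S"
  by (induction I rule: infinite_finite_induct) (auto simp: add_subgroup_zero add_subgroup_add)

type_synonym 'a chain = "'a list \<Rightarrow>\<^sub>0 int"

abbreviation supp :: "('a \<Rightarrow>\<^sub>0 int) \<Rightarrow> 'a set" where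
  "supp \<equiv> Poly_Mapping.keys"

lemma frag_induct [case_names zero one diff]:
  assumes "P 0" "\<And>x. x \<in> supp c \<Longrightarrow> P (frag_of x)" "\<And>a b. P a \<Longrightarrow> P b \<Longrightarrow> P (a - b)"
  shows "P c"
  using frag_induction [of c "supp c" P] assms by auto

lemma frag_extend_in_add_subgroup:
  assumes "add_subgroup S" "\<And>x. x \<in> supp c \<Longrightarrow> f x \<in> S"
  shows "frag_extend f c \<in> S"
  by (induction c rule: frag_induct)
    (auto simp: assms add_subgroup_zero add_subgroup_diff frag_extend_diff)

lemma frag_extend_fun_add: "frag_extend (\<lambda>x. f x + g x) c = frag_extend f c + frag_extend g c"
  by (induction c rule: frag_induct) (auto simp: frag_extend_diff)

lemma frag_extend_frag_extend: "frag_extend f (frag_extend g c) = frag_extend (\<lambda>x. frag_extend f (g x)) c"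
  by (induction c rule: frag_induct) (auto simp: frag_extend_diff)

lemma frag_cmul_diff: "frag_cmul k (a - b) = frag_cmul k a - frag_cmul k b"
  using frag_cmul_distrib2 [of k "a - b" b] by simp

lemma add_subgroup_frag_cmul:
  assumes "add_subgroup S" "x \<in> S"
  shows "frag_cmul k x \<in> S"
proof -
  have "frag_cmul (int n) x \<in> S" for n
    by (induction n) (auto simp: assms add_subgroup_zero add_subgroup_add frag_cmul_distrib)
  then show ?thesis
    using add_subgroup_uminus [OF assms(1)]
    by (cases k rule: int_cases2) (auto simp: minus_frag_cmul [symmetric] simp del: minus_frag_cmul)
qed

lemma add_subgroup_keys: "add_subgroup {c :: 'a \<Rightarrow>\<^sub>0 int. supp c \<subseteq> S}"
proof (rule add_subgroupI)
  show "x - y \<in> {c. supp c \<subseteq> S}"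
    if "x \<in> {c. supp c \<subseteq> S}" "y \<in> {c. supp c \<subseteq> S}" for x y :: "'a \<Rightarrow>\<^sub>0 int"
    using that keys_diff [of x y] by auto
qed simp

lemma bar_map_of [simp]: "bar_map f (frag_of xs) = frag_of (map f xs)"
  by (simp add: bar_map_def)

lemma bar_map_0 [simp]: "bar_map f 0 = 0"
  by (simp add: bar_map_def)

lemma bar_map_diff: "bar_map f (a - b) = bar_map f a - bar_map f b"
  by (simp add: bar_map_def frag_extend_diff)

lemma bar_map_add: "bar_map f (a + b) = bar_map f a + bar_map f b"
  by (simp add: bar_map_def frag_extend_add)

lemma bar_map_bar_map: "bar_map f (bar_map g c) = bar_map (\<lambda>x. f (g x)) c"
  by (induction c rule: frag_induct) (auto simp: bar_map_diff comp_def)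

lemma bar_map_cong:
  "(\<And>xs. xs \<in> supp c \<Longrightarrow> map f xs = map g xs) \<Longrightarrow> bar_map f c = bar_map g c"
  unfolding bar_map_def by (rule frag_extend_eq) metis

lemma keys_bar_map: "supp (bar_map f c) \<subseteq> map f ` supp c"
  unfolding bar_map_def using keys_frag_extend [of "\<lambda>xs. frag_of (map f xs)" c] by auto

section \<open>Extending homomorphisms along divisible quotients\<close>

definition qscale :: "rat \<Rightarrow> ('s \<Rightarrow> rat) \<Rightarrow> 's \<Rightarrow> rat" where
  "qscale q f = (\<lambda>s. q * f s)"

locale rat_vector_space = vector_space scale for scale :: "rat \<Rightarrow> 'v::ab_group_add \<Rightarrow> 'v"
begin

lemma add_subgroup_scale:
  assumes S: "add_subgroup S" and x: "x \<in> S"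
  shows "scale (of_int k) x \<in> S"
proof -
  have n: "scale (of_nat n) x \<in> S" for n
    by (induction n) (auto simp: x scale_left_distrib add_subgroup_zero [OF S] add_subgroup_add [OF S])
  show ?thesis
  proof (cases k rule: int_cases2)
    case (nonneg m)
    then show ?thesis using n [of m] by simp
  next
    case (nonpos m)
    then show ?thesis using add_subgroup_uminus [OF S n [of m]] by simp
  qed
qed

end

interpretation qscale: rat_vector_space qscale
  by unfold_locales (auto simp: qscale_def fun_eq_iff algebra_simps)

text \<open>Division with remainder by the least positive element. It is applied to the integers
  that carry a given function into a subgroup modulo finite functions.\<close>

lemma add_subgroup_int_principal:
  fixes J :: "int set"
  assumes J: "add_subgroup J"
  obtains a where "a \<in> J" "\<And>b. b \<in> J \<Longrightarrow> a dvd b"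
proof (cases "J = {0}")
  case True
  then show thesis using that [of 0] by simp
next
  case False
  then obtain b0 where "b0 \<in> J" "b0 \<noteq> 0"
    using add_subgroup_zero [OF J] by auto
  then have "int (nat \<bar>b0\<bar>) \<in> J \<and> 0 < nat \<bar>b0\<bar>"
    using add_subgroup_uminus [OF J \<open>b0 \<in> J\<close>] by (auto simp: abs_if)
  then have ex: "\<exists>n. int n \<in> J \<and> 0 < n" by blast
  define n where "n = (LEAST n. int n \<in> J \<and> 0 < n)"
  have n: "int n \<in> J" "0 < n"
    using LeastI_ex [OF ex] by (auto simp: n_def)
  have mult: "int n * k \<in> J" for k
  proof -
    have nat: "int n * int m \<in> J" for m
      by (induction m) (auto simp: algebra_simps add_subgroup_zero [OF J] add_subgroup_add [OF J] n)
    show ?thesis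
      using nat add_subgroup_uminus [OF J nat] by (cases k rule: int_cases2) auto
  qed
  have "int n dvd b" if b: "b \<in> J" for b
  proof (rule ccontr)
    assume ndvd: "\<not> int n dvd b"
    have "b mod int n \<in> J"
      using add_subgroup_diff [OF J b mult [of "b div int n"]] by (simp add: minus_mult_div_eq_mod)
    moreover have "0 \<le> b mod int n" "b mod int n < int n" "b mod int n \<noteq> 0"
      using n ndvd by (auto simp: dvd_eq_mod_eq_0)
    ultimately have "int (nat (b mod int n)) \<in> J \<and> 0 < nat (b mod int n)" "nat (b mod int n) < n"
      by (auto simp: nat_less_iff)
    then show False
      using not_less_Least [of _ "\<lambda>n. int n \<in> J \<and> 0 < n"] unfolding n_def by blast
  qed
  then show thesis using that n(1) by blast
qed

definition integral_funs :: "('s \<Rightarrow> rat) set" where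
  "integral_funs = {f. \<forall>s. f s \<in> \<int>}"

definition finite_funs :: "('s \<Rightarrow> rat) set" where
  "finite_funs = {f. finite {s. f s \<noteq> 0}}"

lemma add_subgroup_integral_funs: "add_subgroup integral_funs"
  by (rule add_subgroupI) (auto simp: integral_funs_def)

lemma add_subgroup_finite_funs: "add_subgroup finite_funs"
proof (rule add_subgroupI)
  fix f g :: "'s \<Rightarrow> rat" assume "f \<in> finite_funs" "g \<in> finite_funs"
  then have "finite ({s. f s \<noteq> 0} \<union> {s. g s \<noteq> 0})"
    by (simp add: finite_funs_def)
  moreover have "{s. (f - g) s \<noteq> 0} \<subseteq> {s. f s \<noteq> 0} \<union> {s. g s \<noteq> 0}" by auto
  ultimately show "f - g \<in> finite_funs"
    unfolding finite_funs_def using finite_subset by blast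
qed (simp add: finite_funs_def)

lemma qscale_finite_funs: "f \<in> finite_funs \<Longrightarrow> qscale q f \<in> finite_funs"
  unfolding finite_funs_def qscale_def by (auto elim!: rev_finite_subset)

lemma add_subgroup_Union_chain:
  assumes "\<C> \<noteq> {}" "subset.chain \<A> \<C>" "\<And>S. S \<in> \<A> \<Longrightarrow> add_subgroup S"
  shows "add_subgroup (\<Union>\<C>)"
proof (rule add_subgroupI)
  have sub: "S \<in> \<C> \<Longrightarrow> add_subgroup S" for S
    using assms by (auto simp: subset.chain_def)
  show "0 \<in> \<Union>\<C>"
    using assms(1) sub add_subgroup_zero by blast
  fix x y assume "x \<in> \<Union>\<C>" "y \<in> \<Union>\<C>"
  then obtain S T where "S \<in> \<C>" "T \<in> \<C>" "x \<in> S" "y \<in> T" by blast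
  moreover have "S \<subseteq> T \<or> T \<subseteq> S"
    using assms(2) calculation by (auto simp: subset_chain_def)
  ultimately show "x - y \<in> \<Union>\<C>"
    using sub add_subgroup_diff by blast
qed

text \<open>
  The integral functions modulo the finitely supported ones are torsion-free; this enlarges them to a
  group whose quotient by the same subgroup is a rational vector space.
\<close>

lemma integral_funs_divisible_extension:
  obtains Z :: "('s \<Rightarrow> rat) set" where "add_subgroup Z" "integral_funs \<subseteq> Z" "Z \<inter> finite_funs \<subseteq> integral_funs"
    "\<And>z n. z \<in> Z \<Longrightarrow> 0 < n \<Longrightarrow> \<exists>w\<in>Z. z - qscale (of_nat n) w \<in> integral_funs \<inter> finite_funs"
proof -
  \<comment> \<open>Zorn: a maximal subgroup whose finitely supported members stay integral is so
    large that together with \<open>finite_funs\<close> it spans everything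
    (\<open>cover\<close>).\<close>
  define \<A> where "\<A> = {Z :: ('s \<Rightarrow> rat) set. add_subgroup Z \<and> integral_funs \<subseteq> Z \<and> Z \<inter> finite_funs \<subseteq> integral_funs}"
  have "\<exists>M\<in>\<A>. \<forall>X\<in>\<A>. M \<subseteq> X \<longrightarrow> X = M"
  proof (rule subset_Zorn_nonempty)
    show "\<A> \<noteq> {}"
      using add_subgroup_integral_funs by (auto simp: \<A>_def)
    fix \<C> assume C: "\<C> \<noteq> {}" "subset.chain \<A> \<C>"
    then have "add_subgroup (\<Union>\<C>)"
      by (rule add_subgroup_Union_chain) (simp add: \<A>_def)
    moreover have CA: "\<C> \<subseteq> \<A>" using C by (simp add: subset_chain_def)
    moreover have "integral_funs \<subseteq> \<Union>\<C>"
    proof -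
      obtain S where "S \<in> \<C>" using C(1) by auto
      then show ?thesis using CA by (auto simp: \<A>_def)
    qed
    moreover have "\<Union>\<C> \<inter> finite_funs \<subseteq> integral_funs"
      using CA by (auto simp: \<A>_def)
    ultimately show "\<Union>\<C> \<in> \<A>"
      by (simp add: \<A>_def)
  qed
  then obtain M where "M \<in> \<A>" and max: "\<And>X. X \<in> \<A> \<Longrightarrow> M \<subseteq> X \<Longrightarrow> X = M"
    by auto
  then have M: "add_subgroup M" "integral_funs \<subseteq> M" "M \<inter> finite_funs \<subseteq> integral_funs"
    by (simp_all add: \<A>_def)
  note F = add_subgroup_finite_funs
  have cover: "\<exists>z\<in>M. x - z \<in> finite_funs" for x
  proof -
    define J where "J = {b :: int. \<exists>z\<in>M. qscale (of_int b) x - z \<in> finite_funs}"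
    have "add_subgroup J"
    proof (rule add_subgroupI)
      show "0 \<in> J"
        using add_subgroup_zero [OF M(1)] add_subgroup_zero [OF F] by (auto simp: J_def intro!: bexI [of _ 0])
      fix b c assume "b \<in> J" "c \<in> J"
      then obtain z w where "z \<in> M" "w \<in> M" "qscale (of_int b) x - z \<in> finite_funs" "qscale (of_int c) x - w \<in> finite_funs"
        by (auto simp: J_def)
      then have "z - w \<in> M" "(qscale (of_int b) x - z) - (qscale (of_int c) x - w) \<in> finite_funs"
        using add_subgroup_diff M(1) F by blast+
      then show "b - c \<in> J"
        unfolding J_def by (auto intro!: bexI [of _ "z - w"] simp: qscale.scale_left_diff_distrib algebra_simps)
    qed
    then obtain a where a: "a \<in> J" "\<And>b. b \<in> J \<Longrightarrow> a dvd b"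
      by (rule add_subgroup_int_principal) blast
    then obtain z0 where z0: "z0 \<in> M" "qscale (of_int a) x - z0 \<in> finite_funs"
      by (auto simp: J_def)
    \<comment> \<open>A shift by a finite function brings the generating multiple of
      \<open>x\<close> into \<open>M\<close> itself: \<open>a x' = z0\<close> for nonzero
      \<open>a\<close>. For \<open>a = 0\<close> the division yields 0, so \<open>x' = x\<close> and
      \<open>a x' = 0\<close>.\<close>
    define x' where "x' = x - qscale (1 / of_int a) (qscale (of_int a) x - z0)"
    have xx': "x - x' \<in> finite_funs"
      using qscale_finite_funs [OF z0(2)] by (simp add: x'_def)
    have ax': "qscale (of_int a) x' \<in> M"
      using z0(1) add_subgroup_zero [OF M(1)] by (cases "a = 0") (simp_all add: x'_def qscale.scale_right_diff_distrib)
    define M' where "M' = {z + qscale (of_int b) x' | z b. z \<in> M}"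
    have sub: "M \<subseteq> M'"
      by (auto simp: M'_def intro!: exI [of _ "0::int"])
    have "M' \<in> \<A>"
      unfolding \<A>_def
    proof (intro CollectI conjI)
      show "add_subgroup M'"
      proof (rule add_subgroupI)
        show "0 \<in> M'" using sub add_subgroup_zero [OF M(1)] by blast
        fix u v assume "u \<in> M'" "v \<in> M'"
        then obtain z b w c where "z \<in> M" "w \<in> M" "u = z + qscale (of_int b) x'" "v = w + qscale (of_int c) x'"
          by (auto simp: M'_def)
        then have "u - v = (z - w) + qscale (of_int (b - c)) x'" "z - w \<in> M"
          using add_subgroup_diff [OF M(1)] by (auto simp: qscale.scale_left_diff_distrib)
        then show "u - v \<in> M'" unfolding M'_def by blast
      qed
      show "integral_funs \<subseteq> M'" using M(2) sub by blast
      \<comment> \<open>A finite element \<open>z + b x'\<close> forces \<open>b\<close> into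
        \<open>J\<close>, so \<open>a\<close> divides \<open>b\<close> and \<open>b x'\<close>
        already lies in \<open>M\<close>: no new finite functions arise.\<close>
      show "M' \<inter> finite_funs \<subseteq> integral_funs"
      proof
        fix u assume u: "u \<in> M' \<inter> finite_funs"
        then obtain z b where zb: "z \<in> M" "u = z + qscale (of_int b) x'"
          by (auto simp: M'_def)
        have "qscale (of_int b) x - (- z) = u + qscale (of_int b) (x - x')"
          by (simp add: zb qscale.scale_right_diff_distrib)
        then have "qscale (of_int b) x - (- z) \<in> finite_funs"
          using add_subgroup_add [OF F _ qscale_finite_funs [OF xx']] u by simp
        then have "b \<in> J"
          using add_subgroup_uminus [OF M(1) zb(1)] unfolding J_def by blast
        then obtain c where "b = a * c"
          using a(2) by auto
        then have "qscale (of_int b) x' = qscale (of_int c) (qscale (of_int a) x')"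
          by (simp add: mult.commute)
        then have "u \<in> M"
          unfolding zb(2) using add_subgroup_add [OF M(1) zb(1)] qscale.add_subgroup_scale [OF M(1) ax'] by metis
        then show "u \<in> integral_funs" using u M(3) by blast
      qed
    qed
    then have "M' = M" using max sub by blast
    moreover have "x' \<in> M'"
      using add_subgroup_zero [OF M(1)] unfolding M'_def by (auto intro!: exI [of _ 0] exI [of _ "1::int"])
    ultimately show ?thesis using xx' by blast
  qed
  show thesis
  proof (rule that [OF M])
    fix z :: "'s \<Rightarrow> rat" and n :: nat assume z: "z \<in> M" and n: "0 < n"
    \<comment> \<open>Divide by \<open>n\<close> among all rational functions, then return to
      \<open>M\<close> by \<open>cover\<close>.\<close>
    obtain w where w: "w \<in> M" "qscale (1 / of_nat n) z - w \<in> finite_funs"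
      using cover by blast
    have "qscale (of_nat n) (qscale (1 / of_nat n) z - w) = z - qscale (of_nat n) w"
      using n by (simp add: qscale.scale_right_diff_distrib)
    then have "z - qscale (of_nat n) w \<in> finite_funs"
      using qscale_finite_funs [OF w(2), of "of_nat n"] by simp
    moreover have "z - qscale (of_nat n) w \<in> M"
      using add_subgroup_diff [OF M(1) z] qscale.add_subgroup_scale [OF M(1) w(1), of "int n"] by simp
    ultimately show "\<exists>w\<in>M. z - qscale (of_nat n) w \<in> integral_funs \<inter> finite_funs"
      using w(1) M(3) by blast
  qed
qed

text \<open>
  This says that \<open>Ext(\<rat>, G) = 0\<close>, where \<open>\<rat>\<close> is the colimit of copies of \<open>\<int>\<close> under multiplication
  by \<open>e n\<close>; the divisibility ensures that the colimit is all of \<open>\<rat>\<close>.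
\<close>

definition solvable_towers :: "('a, 'b) monoid_scheme \<Rightarrow> bool" where
  "solvable_towers G \<longleftrightarrow>
     (\<exists>e. (\<forall>n. 0 < e n \<and> Suc n dvd e n) \<and>
        (\<forall>g. (\<forall>n::nat. g n \<in> carrier G) \<longrightarrow>
           (\<exists>x. (\<forall>n. x n \<in> carrier G) \<and> (\<forall>n. x n = g n \<otimes>\<^bsub>G\<^esub> x (Suc n) [^]\<^bsub>G\<^esub> (e n :: nat)))))"

context rat_vector_space
begin

text \<open>By \<open>div\<close> and \<open>tf\<close> the quotient Z/B is a rational vector space,
  so the hypothesis on \<open>G\<close> removes the obstruction. Zorn is applied to graphs of
  partial extensions. Their domains are kept pure in \<open>Z\<close>, so that what has to be added
  to them next is, modulo the old domain, a full copy of the rationals.\<close>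

lemma extend_along_divisible_quotient:
  fixes Z B :: "'v set" and G :: "('g, 'h) monoid_scheme" (structure)
  assumes G: "comm_group G" and sol: "solvable_towers G"
    and Z: "add_subgroup Z" and B: "add_subgroup B" "B \<subseteq> Z"
    and div: "\<And>z n. z \<in> Z \<Longrightarrow> 0 < n \<Longrightarrow> \<exists>w\<in>Z. z - scale (of_nat n) w \<in> B"
    and tf: "\<And>z n. z \<in> Z \<Longrightarrow> 0 < n \<Longrightarrow> scale (of_nat n) z \<in> B \<Longrightarrow> z \<in> B"
    and T0: "\<And>b. b \<in> B \<Longrightarrow> T0 b \<in> carrier G"
      "\<And>b c. b \<in> B \<Longrightarrow> c \<in> B \<Longrightarrow> T0 (b - c) = T0 b \<otimes> inv (T0 c)"
  obtains T where "\<And>z. z \<in> Z \<Longrightarrow> T z \<in> carrier G"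
    "\<And>x y. x \<in> Z \<Longrightarrow> y \<in> Z \<Longrightarrow> T (x - y) = T x \<otimes> inv (T y)"
    "\<And>b. b \<in> B \<Longrightarrow> T b = T0 b"
proof -
  interpret comm_group G by (rule G)
  obtain e where e: "\<And>n. 0 < e n" "\<And>n. Suc n dvd e n"
    and solve: "\<And>g. \<forall>n::nat. g n \<in> carrier G \<Longrightarrow>
      \<exists>x. (\<forall>n. x n \<in> carrier G) \<and> (\<forall>n. x n = g n \<otimes> x (Suc n) [^] e n)"
    using sol unfolding solvable_towers_def by auto
  \<comment> \<open>Sets of pairs make unions of chains immediate. Given closure under differences,
    the fourth condition makes the relation single-valued; the fifth is purity of its
    domain.\<close>
  define good where "good = (\<lambda>R :: ('v \<times> 'g) set.
     R \<subseteq> Z \<times> carrier G \<and> (\<lambda>b. (b, T0 b)) ` B \<subseteq> R \<and>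
     (\<forall>x a y b. (x, a) \<in> R \<longrightarrow> (y, b) \<in> R \<longrightarrow> (x - y, a \<otimes> inv b) \<in> R) \<and>
     (\<forall>a. (0, a) \<in> R \<longrightarrow> a = \<one>) \<and>
     (\<forall>x n. x \<in> Z \<longrightarrow> 0 < n \<longrightarrow> scale (of_nat n) x \<in> fst ` R \<longrightarrow> x \<in> fst ` R))"
  have good_sub: "R \<subseteq> Z \<times> carrier G" if "good R" for R
    using that unfolding good_def by (elim conjE)
  have good_base: "(\<lambda>b. (b, T0 b)) ` B \<subseteq> R" if "good R" for R
    using that unfolding good_def by (elim conjE)
  have good_diff: "(x - y, a \<otimes> inv b) \<in> R" if "good R" "(x, a) \<in> R" "(y, b) \<in> R" for R x a y b
    using that unfolding good_def by (elim conjE) metis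
  have good_one: "a = \<one>" if "good R" "(0, a) \<in> R" for R a
    using that unfolding good_def by (elim conjE) metis
  have good_pure: "x \<in> fst ` R" if "good R" "x \<in> Z" "0 < n" "scale (of_nat n) x \<in> fst ` R" for R x n
    using that unfolding good_def by (elim conjE) metis
  have good0: "good ((\<lambda>b. (b, T0 b)) ` B)"
  proof -
    have "T0 0 = \<one>"
      using T0(2) [of 0 0] T0(1) add_subgroup_zero [OF B(1)] by simp
    then show ?thesis
      unfolding good_def using B T0 tf add_subgroup_diff [OF B(1)] by (auto simp: image_image image_iff)
  qed
  have "\<exists>M\<in>Collect good. \<forall>X\<in>Collect good. M \<subseteq> X \<longrightarrow> X = M"
  proof (rule subset_Zorn_nonempty)
    show "Collect good \<noteq> {}"
      using good0 by auto
    fix \<C> assume C: "\<C> \<noteq> {}" "subset.chain (Collect good) \<C>"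
    have g: "good R" if "R \<in> \<C>" for R
      using that C(2) by (auto simp: subset_chain_def)
    have lin: "R \<subseteq> R' \<or> R' \<subseteq> R" if "R \<in> \<C>" "R' \<in> \<C>" for R R'
      using that C(2) by (auto simp: subset_chain_def)
    have "good (\<Union>\<C>)"
      unfolding good_def
    proof (intro conjI allI impI)
      show "\<Union>\<C> \<subseteq> Z \<times> carrier G"
        using g good_sub by (meson Sup_least)
      obtain R where "R \<in> \<C>" using C(1) by auto
      then show "(\<lambda>b. (b, T0 b)) ` B \<subseteq> \<Union>\<C>"
        using good_base [OF g [of R]] by (meson Union_upper order_trans)
      show "(x - y, a \<otimes> inv b) \<in> \<Union>\<C>" if xy: "(x, a) \<in> \<Union>\<C>" "(y, b) \<in> \<Union>\<C>" for x a y b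
      proof -
        obtain R R' where R: "R \<in> \<C>" "R' \<in> \<C>" "(x, a) \<in> R" "(y, b) \<in> R'"
          using xy by blast
        then obtain Q where "Q \<in> \<C>" "(x, a) \<in> Q" "(y, b) \<in> Q"
          using lin [of R R'] by blast
        then show ?thesis
          using good_diff [OF g [of Q]] by blast
      qed
      show "a = \<one>" if "(0, a) \<in> \<Union>\<C>" for a
        using that g good_one by blast
      show "x \<in> fst ` \<Union>\<C>" if xn: "x \<in> Z" "0 < n" "scale (of_nat n) x \<in> fst ` \<Union>\<C>" for x n
      proof -
        obtain R where R: "R \<in> \<C>" "scale (of_nat n) x \<in> fst ` R"
          using xn(3) by blast
        then have "x \<in> fst ` R"
          using good_pure [OF g [of R]] xn(1,2) by blast
        then show ?thesis using R(1) by blast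
      qed
    qed
    then show "\<Union>\<C> \<in> Collect good" by simp
  qed
  then obtain R where gR: "good R" and max: "\<And>X. good X \<Longrightarrow> R \<subseteq> X \<Longrightarrow> X = R"
    by auto
  have R_sub: "(x, a) \<in> R \<Longrightarrow> x \<in> Z \<and> a \<in> carrier G" for x a
    using good_sub [OF gR] by blast
  have R_B: "b \<in> B \<Longrightarrow> (b, T0 b) \<in> R" for b
    using good_base [OF gR] by blast
  have R_diff: "(x, a) \<in> R \<Longrightarrow> (y, b) \<in> R \<Longrightarrow> (x - y, a \<otimes> inv b) \<in> R" for x a y b
    by (rule good_diff [OF gR])
  have R_one: "(0, a) \<in> R \<Longrightarrow> a = \<one>" for a
    by (rule good_one [OF gR])
  have R_pure: "x \<in> Z \<Longrightarrow> 0 < n \<Longrightarrow> (scale (of_nat n) x, c) \<in> R \<Longrightarrow> \<exists>a. (x, a) \<in> R" for x n c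
  proof -
    assume *: "x \<in> Z" "0 < n" "(scale (of_nat n) x, c) \<in> R"
    then have "scale (of_nat n) x \<in> fst ` R" by force
    then have "x \<in> fst ` R"
      using good_pure [OF gR] * by blast
    then show "\<exists>a. (x, a) \<in> R" by auto
  qed
  have R_0: "(0, \<one>) \<in> R"
    using R_B [OF add_subgroup_zero [OF B(1)]] R_one by metis
  have R_neg: "(- x, inv a) \<in> R" if "(x, a) \<in> R" for x a
    using R_diff [OF R_0 that] R_sub [OF that] by simp
  have R_add: "(x + y, a \<otimes> b) \<in> R" if "(x, a) \<in> R" "(y, b) \<in> R" for x a y b
    using R_diff [OF that(1) R_neg [OF that(2)]] R_sub [OF that(2)] by simp
  have R_scale: "(scale (of_int k) x, a [^] k) \<in> R" if xa: "(x, a) \<in> R" for x a and k :: int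
  proof -
    have nat: "(scale (of_nat n) x, a [^] n) \<in> R" for n
    proof (induction n)
      case (Suc n)
      have "a [^] Suc n = a \<otimes> a [^] n"
        using R_sub [OF xa] by (simp add: m_comm)
      then show ?case
        using R_add [OF xa Suc] by (simp only: of_nat_Suc scale_left_distrib scale_one)
    qed (simp only: of_nat_0 scale_zero_left nat_pow_0 R_0)
    show ?thesis
    proof (cases k rule: int_cases2)
      case (nonneg m)
      then show ?thesis using nat [of m] by (simp add: int_pow_int)
    next
      case (nonpos m)
      then show ?thesis
        using R_neg [OF nat [of m]] R_sub [OF xa] by (simp add: scale_minus_left int_pow_neg int_pow_int)
    qed
  qed
  have total: "\<exists>a. (x, a) \<in> R" if xZ: "x \<in> Z" for x
  proof (rule ccontr)
    assume notin: "\<nexists>a. (x, a) \<in> R"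
    \<comment> \<open>Divide \<open>x\<close> successively by \<open>e 0\<close>,
      \<open>e 1\<close>, ...; each division is exact only modulo \<open>B\<close>.\<close>
    have "\<exists>y. \<forall>n. (y n \<in> Z \<and> (n = 0 \<longrightarrow> y n = x)) \<and> y n - scale (of_nat (e n)) (y (Suc n)) \<in> B"
    proof (rule dependent_nat_choice)
      show "\<exists>z. (z \<in> Z \<and> (Suc n = 0 \<longrightarrow> z = x)) \<and> w - scale (of_nat (e n)) z \<in> B"
        if "w \<in> Z \<and> (n = 0 \<longrightarrow> w = x)" for w n
        using div [of w "e n"] e(1) that by auto
    qed (use xZ in auto)
    then obtain y where y: "\<And>n. y n \<in> Z" "y 0 = x" "\<And>n. y n - scale (of_nat (e n)) (y (Suc n)) \<in> B"
      by blast
    define \<beta> where "\<beta> = (\<lambda>n. y n - scale (of_nat (e n)) (y (Suc n)))"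
    have \<beta>B: "\<beta> n \<in> B" for n
      using y(3) by (simp add: \<beta>_def)
    have "\<forall>n. T0 (\<beta> n) \<in> carrier G"
      using T0(1) \<beta>B by blast
    \<comment> \<open>The values \<open>X n\<close> intended for the \<open>y n\<close> must obey
      the same recursion, with \<open>T0 (\<beta> n)\<close> in place of the errors.\<close>
    then have "\<exists>X. (\<forall>n. X n \<in> carrier G) \<and> (\<forall>n. X n = T0 (\<beta> n) \<otimes> X (Suc n) [^] e n)"
      by (rule solve)
    then obtain X where X: "\<And>n. X n \<in> carrier G" "\<And>n. X n = T0 (\<beta> n) \<otimes> X (Suc n) [^] e n"
      by metis
    \<comment> \<open>The witness \<open>P\<close> is \<open>e n * ... * e (n + d - 1)\<close>.
      Since \<open>n + j\<close> divides \<open>e (n + j - 1)\<close>, it is a multiple of each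
      \<open>n + j\<close>.\<close>
    have lev: "\<exists>P b c. (b, c) \<in> R \<and> y n = b + scale (of_int P) (y (n + d)) \<and> X n = c \<otimes> X (n + d) [^] P \<and>
        (\<forall>j. 1 \<le> j \<and> j \<le> d \<longrightarrow> int (n + j) dvd P)" for n d
    proof (induction d)
      case 0
      show ?case
        using R_0 X(1) by (intro exI [of _ 1] exI [of _ 0] exI [of _ \<one>]) (auto simp: int_pow_1)
    next
      case (Suc d)
      then obtain P b c where IH: "(b, c) \<in> R" "y n = b + scale (of_int P) (y (n + d))" "X n = c \<otimes> X (n + d) [^] P"
        "\<And>j. 1 \<le> j \<Longrightarrow> j \<le> d \<Longrightarrow> int (n + j) dvd P" by blast
      let ?P = "P * int (e (n + d))"
      let ?b = "b + scale (of_int P) (\<beta> (n + d))"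
      let ?c = "c \<otimes> T0 (\<beta> (n + d)) [^] P"
      have Rb: "(?b, ?c) \<in> R"
        by (intro R_add R_scale R_B IH \<beta>B)
      have "y n = ?b + scale (of_int ?P) (y (n + Suc d))"
        by (simp add: IH(2) \<beta>_def scale_right_diff_distrib)
      moreover have "X n = ?c \<otimes> X (n + Suc d) [^] ?P"
      proof -
        have "X (n + d) [^] P = T0 (\<beta> (n + d)) [^] P \<otimes> (X (Suc (n + d)) [^] int (e (n + d))) [^] P"
          using X(2) [of "n + d"] X(1) T0(1) [OF \<beta>B] by (metis int_pow_distrib int_pow_int int_pow_closed)
        also have "(X (Suc (n + d)) [^] int (e (n + d))) [^] P = X (n + Suc d) [^] ?P"
          using X(1) by (simp add: int_pow_pow mult.commute)
        finally show ?thesis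
          using IH(3) X(1) T0(1) [OF \<beta>B] R_sub [OF IH(1)] by (simp add: m_assoc)
      qed
      moreover have "int (n + j) dvd ?P" if "1 \<le> j" "j \<le> Suc d" for j
      proof (cases "j = Suc d")
        case True
        then show ?thesis using e(2) [of "n + d"] by (metis add_Suc_right dvd_mult of_nat_dvd_iff)
      next
        case False
        then show ?thesis using IH(4) [of j] that by simp
      qed
      ultimately show ?case using Rb by blast
    qed
    \<comment> \<open>One term \<open>y n\<close> suffices to describe the generated subgroup,
      because \<open>y n\<close> is an element of \<open>B\<close> plus a multiple of
      \<open>y (Suc n)\<close>; \<open>raise\<close> moves elements to a common level.\<close>
    define R' where "R' = {(m + scale (of_int a) (y n), t \<otimes> X n [^] a) | m t a n. (m, t) \<in> R}"
    have R'I: "(m, t) \<in> R \<Longrightarrow> (m + scale (of_int a) (y n), t \<otimes> X n [^] a) \<in> R'" for m t a n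
      unfolding R'_def by blast
    have raise: "\<exists>m' t' a'. (m', t') \<in> R \<and> m + scale (of_int a) (y n) = m' + scale (of_int a') (y (n + d)) \<and>
        t \<otimes> X n [^] a = t' \<otimes> X (n + d) [^] a' \<and> (\<forall>j. 1 \<le> j \<and> j \<le> d \<longrightarrow> int (n + j) dvd a')"
      if mt: "(m, t) \<in> R" for m t n d and a :: int
    proof -
      obtain P b c where P: "(b, c) \<in> R" "y n = b + scale (of_int P) (y (n + d))" "X n = c \<otimes> X (n + d) [^] P"
        "\<forall>j. 1 \<le> j \<and> j \<le> d \<longrightarrow> int (n + j) dvd P"
        using lev [of n d] by blast
      have "(m + scale (of_int a) b, t \<otimes> c [^] a) \<in> R"
        by (intro R_add R_scale mt P)
      moreover have "m + scale (of_int a) (y n) = (m + scale (of_int a) b) + scale (of_int (a * P)) (y (n + d))"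
        by (simp add: P(2) scale_right_distrib)
      moreover have "t \<otimes> X n [^] a = (t \<otimes> c [^] a) \<otimes> X (n + d) [^] (a * P)"
        using R_sub [OF mt] R_sub [OF P(1)] X(1)
        by (simp add: P(3) int_pow_distrib int_pow_pow m_assoc mult.commute)
      moreover have "\<forall>j. 1 \<le> j \<and> j \<le> d \<longrightarrow> int (n + j) dvd a * P"
        using P(4) by simp
      ultimately show ?thesis by blast
    qed
    have level_notin: "\<nexists>a. (y n, a) \<in> R" for n
    proof
      assume "\<exists>a. (y n, a) \<in> R"
      then obtain a where a: "(y n, a) \<in> R" by blast
      obtain P b c where "(b, c) \<in> R" "y 0 = b + scale (of_int P) (y (0 + n))"
        using lev [of 0 n] by blast
      then have "\<exists>a. (x, a) \<in> R"
        using R_add [OF _ R_scale [OF a, of P]] y(2) by (metis add_0)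
      then show False using notin by blast
    qed
    have "good R'"
      unfolding good_def
    proof (intro conjI allI impI)
      show "R' \<subseteq> Z \<times> carrier G"
        using R_sub X(1) y(1) add_subgroup_add [OF Z] add_subgroup_scale [OF Z] by (auto simp: R'_def)
      show "(\<lambda>b. (b, T0 b)) ` B \<subseteq> R'"
        using R'I [OF R_B, of _ 0 0] T0(1) by (auto simp: int_pow_0)
      show "(u - v, s \<otimes> inv r) \<in> R'" if us: "(u, s) \<in> R'" and vr: "(v, r) \<in> R'" for u s v r
      proof -
        obtain m t a n where 1: "(m, t) \<in> R" "u = m + scale (of_int a) (y n)" "s = t \<otimes> X n [^] a"
          using us unfolding R'_def by blast
        obtain m' t' a' n' where 2: "(m', t') \<in> R" "v = m' + scale (of_int a') (y n')" "r = t' \<otimes> X n' [^] a'"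
          using vr unfolding R'_def by blast
        obtain m1 t1 a1 where 3: "(m1, t1) \<in> R" "u = m1 + scale (of_int a1) (y (n + n'))" "s = t1 \<otimes> X (n + n') [^] a1"
          using raise [OF 1(1), of a n n'] 1 by metis
        obtain m2 t2 a2 where 4: "(m2, t2) \<in> R" "v = m2 + scale (of_int a2) (y (n + n'))" "r = t2 \<otimes> X (n + n') [^] a2"
          using raise [OF 2(1), of a' n' n] 2 by (metis add.commute)
        have "u - v = (m1 - m2) + scale (of_int (a1 - a2)) (y (n + n'))"
          by (simp add: 3 4 scale_left_diff_distrib)
        moreover have "s \<otimes> inv r = (t1 \<otimes> inv t2) \<otimes> X (n + n') [^] (a1 - a2)"
          using R_sub [OF 3(1)] R_sub [OF 4(1)] X(1) by (simp add: 3 4 int_pow_diff inv_mult m_ac)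
        ultimately show ?thesis
          using R'I [OF R_diff [OF 3(1) 4(1)]] by metis
      qed
      show "s = \<one>" if s: "(0, s) \<in> R'" for s
      proof -
        obtain m t a n where 1: "(m, t) \<in> R" "0 = m + scale (of_int a) (y n)" "s = t \<otimes> X n [^] a"
          using s unfolding R'_def by blast
        have ay: "scale (of_int a) (y n) = - m"
          using 1(2) by (simp add: eq_neg_iff_add_eq_0 add.commute)
        \<comment> \<open>By purity, a nonzero multiple of \<open>y n\<close> in the old domain
          would put \<open>y n\<close>, and hence \<open>x\<close>, into it.\<close>
        have "a = 0"
        proof (rule ccontr)
          assume "a \<noteq> 0"
          have "scale (of_nat (nat \<bar>a\<bar>)) (y n) = (if a < 0 then m else - m)"
            using ay scale_minus_left [of "of_int a" "y n"] by (auto simp: abs_if)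
          then have "\<exists>c. (scale (of_nat (nat \<bar>a\<bar>)) (y n), c) \<in> R"
            using 1(1) R_neg by (metis (full_types))
          then show False
            using R_pure [OF y(1), of "nat \<bar>a\<bar>"] level_notin \<open>a \<noteq> 0\<close> by (metis zero_less_abs_iff zero_less_nat_eq)
        qed
        then show ?thesis
          using 1 R_one R_sub by (auto simp: int_pow_0)
      qed
      show "w \<in> fst ` R'" if w: "w \<in> Z" "0 < k" "scale (of_nat k) w \<in> fst ` R'" for w k
      proof -
        obtain m t a n where 1: "(m, t) \<in> R" "scale (of_nat k) w = m + scale (of_int a) (y n)"
          using w(3) unfolding R'_def by auto
        \<comment> \<open>The factor \<open>Suc n\<close> makes \<open>d\<close> exceed
          \<open>n\<close>, so \<open>d\<close> itself is one of the numbers \<open>n + j\<close>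
          dividing \<open>a'\<close>. Then \<open>k\<close> divides \<open>a'\<close> and can be
          cancelled.\<close>
        define d where "d = k * Suc n"
        obtain m' t' a' where 2: "(m', t') \<in> R" "scale (of_nat k) w = m' + scale (of_int a') (y (n + d))"
          "\<And>j. 1 \<le> j \<Longrightarrow> j \<le> d \<Longrightarrow> int (n + j) dvd a'"
          using raise [OF 1(1), of a n d] 1(2) by metis
        have "n < d" using w(2) by (cases k) (auto simp: d_def)
        then have "int d dvd a'" using 2(3) [of "d - n"] by simp
        then have "int k dvd a'" unfolding d_def by (metis dvd_mult_left of_nat_mult)
        then obtain f where f: "a' = int k * f" by blast
        define w' where "w' = w - scale (of_int f) (y (n + d))"
        have "scale (of_nat k) w' = m'"
          by (simp add: w'_def scale_right_diff_distrib 2(2) f)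
        moreover have "w' \<in> Z"
          unfolding w'_def by (intro add_subgroup_diff [OF Z] add_subgroup_scale [OF Z] w y)
        ultimately obtain t'' where "(w', t'') \<in> R"
          using R_pure [OF _ w(2)] 2(1) by metis
        then have "(w' + scale (of_int f) (y (n + d)), t'' \<otimes> X (n + d) [^] f) \<in> R'"
          by (rule R'I)
        then show ?thesis
          by (force simp: w'_def)
      qed
    qed
    moreover have "R \<subseteq> R'"
    proof
      fix u assume "u \<in> R"
      then show "u \<in> R'"
        using R'I [of "fst u" "snd u" 0 0] R_sub [of "fst u" "snd u"] by (simp add: int_pow_0)
    qed
    ultimately have "R' = R" by (rule max)
    moreover have "(x, X 0) \<in> R'"
      using R'I [OF R_0, of 1 0] X(1) y(2) by (simp add: int_pow_1)
    ultimately show False using notin by blast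
  qed
  have unique: "a = b" if ab: "(x, a) \<in> R" "(x, b) \<in> R" for x a b
  proof -
    have "a \<otimes> inv b = \<one>"
      using R_diff [OF ab] R_one by simp
    then show ?thesis
      using R_sub [OF ab(1)] R_sub [OF ab(2)] by (metis inv_equality inv_inv inv_closed)
  qed
  define T where "T = (\<lambda>x. SOME a. (x, a) \<in> R)"
  have T: "(x, T x) \<in> R" if "x \<in> Z" for x
    using total [OF that] unfolding T_def by (rule someI_ex)
  show thesis
  proof
    show "T z \<in> carrier G" if "z \<in> Z" for z
      using T [OF that] R_sub by blast
    show "T (x - y) = T x \<otimes> inv (T y)" if "x \<in> Z" "y \<in> Z" for x y
      using unique [OF T R_diff [OF T T]] that add_subgroup_diff [OF Z] by blast
    show "T b = T0 b" if "b \<in> B" for b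
      using unique [OF T R_B] that B(2) by blast
  qed
qed


end

section \<open>A criterion for cotorsion groups\<close>

definition additive_monoid :: "'a::ab_group_add set \<Rightarrow> 'a monoid" where
  "additive_monoid S = \<lparr>carrier = S, monoid.mult = (+), one = 0\<rparr>"

lemma additive_monoid_simps [simp]:
  "carrier (additive_monoid S) = S" "x \<otimes>\<^bsub>additive_monoid S\<^esub> y = x + y" "\<one>\<^bsub>additive_monoid S\<^esub> = 0"
  by (simp_all add: additive_monoid_def)

lemma comm_group_additive_monoid:
  assumes "add_subgroup S"
  shows "comm_group (additive_monoid S)"
proof (rule comm_groupI)
  show "\<exists>y\<in>carrier (additive_monoid S). y \<otimes>\<^bsub>additive_monoid S\<^esub> x = \<one>\<^bsub>additive_monoid S\<^esub>"
    if "x \<in> carrier (additive_monoid S)" for x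
    using that add_subgroup_uminus [OF assms] by (auto intro!: bexI [of _ "- x"])
qed (auto simp: add_ac add_subgroup_zero [OF assms] add_subgroup_add [OF assms])

lemma inv_additive_monoid:
  assumes "add_subgroup S" "x \<in> S"
  shows "inv\<^bsub>additive_monoid S\<^esub> x = - x"
proof -
  interpret comm_group "additive_monoid S" by (rule comm_group_additive_monoid [OF assms(1)])
  show ?thesis
    by (rule inv_equality) (use assms add_subgroup_uminus in auto)
qed

text \<open>
  For finitely supported integral functions \<open>f\<close> on \<open>\<nat> \<times> G\<close> the product of all \<open>g [^] f (j, g)\<close> is a
  homomorphism to \<open>G\<close>. Extended to all integral functions, it still maps the functions that vanish on
  the first \<open>i\<close> columns onto \<open>G\<close>, so \<open>G\<close> is the first derived limit of its kernels on these.
\<close>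

theorem cotorsion_group_if_solvable_towers:
  fixes G :: "'g monoid" (structure)
  assumes G: "comm_group G" and sol: "solvable_towers G"
  shows "cotorsion_group G"
proof -
  interpret comm_group G by (rule G)
  define D where "D = (integral_funs :: (nat \<times> 'g \<Rightarrow> rat) set)"
  define B where "B = D \<inter> finite_funs"
  have D: "add_subgroup D"
    unfolding D_def by (rule add_subgroup_integral_funs)
  have B: "add_subgroup B"
    using add_subgroup_diff [OF D] add_subgroup_diff [OF add_subgroup_finite_funs]
      add_subgroup_zero [OF D] add_subgroup_zero [OF add_subgroup_finite_funs]
    unfolding B_def by (intro add_subgroupI) blast+
  obtain Z where Z: "add_subgroup Z" "D \<subseteq> Z" "Z \<inter> finite_funs \<subseteq> D"
    and div: "\<And>z n. z \<in> Z \<Longrightarrow> 0 < n \<Longrightarrow> \<exists>w\<in>Z. z - qscale (of_nat n) w \<in> B"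
    unfolding D_def B_def by (rule integral_funs_divisible_extension) blast
  \<comment> \<open>Indices outside the carrier go to the unit, and \<open>gfinprod\<close> is the
    unit when infinitely many factors are nontrivial; so \<open>T0\<close> takes values in
    \<open>G\<close> on all functions, but is a homomorphism only on \<open>B\<close>.\<close>
  define \<gamma> where "\<gamma> = (\<lambda>s :: nat \<times> 'g. if snd s \<in> carrier G then snd s else \<one>)"
  define T0 where "T0 = (\<lambda>f :: nat \<times> 'g \<Rightarrow> rat. gfinprod G (\<lambda>s. \<gamma> s [^] \<lfloor>f s\<rfloor>) UNIV)"
  have \<gamma>: "\<gamma> s \<in> carrier G" for s
    by (simp add: \<gamma>_def)
  have T0_closed: "T0 f \<in> carrier G" for f
    unfolding T0_def using \<gamma> by (intro gfinprod_closed) auto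
  have T0_diff: "T0 (b - c) = T0 b \<otimes> inv (T0 c)" if "b \<in> B" "c \<in> B" for b c
  proof -
    have fin: "finite {s \<in> UNIV. \<gamma> s [^] \<lfloor>f s\<rfloor> \<noteq> \<one>}" if "f \<in> B" for f
      using that unfolding B_def finite_funs_def
      by (auto intro: rev_finite_subset [of "{s. f s \<noteq> 0}"] simp: int_pow_0)
    have "b - c \<in> B" by (rule add_subgroup_diff [OF B that])
    have fl: "\<lfloor>(b - c) s\<rfloor> + \<lfloor>c s\<rfloor> = \<lfloor>b s\<rfloor>" for s
    proof -
      have "b s \<in> \<int>" "c s \<in> \<int>"
        using that unfolding B_def D_def integral_funs_def by blast+
      then show ?thesis by (auto elim!: Ints_cases simp flip: of_int_diff)
    qed
    have "T0 (b - c) \<otimes> T0 c = gfinprod G (\<lambda>s. \<gamma> s [^] \<lfloor>(b - c) s\<rfloor> \<otimes> \<gamma> s [^] \<lfloor>c s\<rfloor>) UNIV"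
      unfolding T0_def by (intro gfinprod_distrib [symmetric] fin that \<open>b - c \<in> B\<close>) (auto simp: \<gamma>)
    also have "\<dots> = T0 b"
      unfolding T0_def by (simp only: int_pow_mult [OF \<gamma>, symmetric] fl)
    finally show ?thesis
      using T0_closed by (metis inv_solve_right)
  qed
  obtain T where T_closed: "\<And>z. z \<in> Z \<Longrightarrow> T z \<in> carrier G"
    and TZ_diff: "\<And>x y. x \<in> Z \<Longrightarrow> y \<in> Z \<Longrightarrow> T (x - y) = T x \<otimes> inv (T y)"
    and T_B: "\<And>b. b \<in> B \<Longrightarrow> T b = T0 b"
  proof (rule qscale.extend_along_divisible_quotient [OF G sol Z(1) B _ div _ T0_closed T0_diff])
    show "B \<subseteq> Z" using Z(2) by (auto simp: B_def)
    \<comment> \<open>Torsion-freeness of Z/B: division keeps the support finite, and finite members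
      of \<open>Z\<close> are integral.\<close>
    show "z \<in> B" if z: "z \<in> Z" "0 < n" "qscale (of_nat n) z \<in> B" for z n
    proof -
      have "qscale (1 / of_nat n) (qscale (of_nat n) z) = z"
        using z(2) by simp
      moreover have "qscale (1 / of_nat n) (qscale (of_nat n) z) \<in> finite_funs"
        by (rule qscale_finite_funs) (use z(3) B_def in blast)
      ultimately show ?thesis
        using z(1) Z(3) unfolding B_def by (metis IntI subsetD)
    qed
  qed blast+
  have TD: "T x \<in> carrier G" if "x \<in> D" for x
    using that Z(2) T_closed by blast
  have T_diff: "T (x - y) = T x \<otimes> inv (T y)" if "x \<in> D" "y \<in> D" for x y
    using that Z(2) TZ_diff by blast
  have T_0: "T 0 = \<one>"
    using T_diff [of 0 0] TD [of 0] add_subgroup_zero [OF D] by simp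
  have T_neg: "T (- x) = inv (T x)" if "x \<in> D" for x
    using T_diff [of 0 x] that TD [OF that] add_subgroup_zero [OF D] T_0 by simp
  have T_add: "T (x + y) = T x \<otimes> T y" if "x \<in> D" "y \<in> D" for x y
    using T_diff [of x "- y"] that TD add_subgroup_uminus [OF D] by (simp add: T_neg)
  define \<delta> where "\<delta> = (\<lambda>(j::nat) (g::'g) s. if s = (j, g) then 1 else 0 :: rat)"
  have \<delta>B: "\<delta> j g \<in> B" for j g
    by (auto simp: \<delta>_def B_def D_def integral_funs_def finite_funs_def)
  have \<delta>D: "\<delta> j g \<in> D" for j g
    using \<delta>B by (auto simp: B_def)
  have T_\<delta>: "T (\<delta> j g) = g" if g: "g \<in> carrier G" for j g
  proof -
    have "T0 (\<delta> j g) = gfinprod G (\<lambda>s. g) {(j, g)}"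
      unfolding T0_def by (rule gfinprod_mono_neutral_cong_right) (use g in \<open>auto simp: \<delta>_def int_pow_0 int_pow_1 \<gamma>_def\<close>)
    also have "\<dots> = g"
      using g by (subst gfinprod_eq_finprod) auto
    finally show ?thesis by (simp add: T_B \<delta>B)
  qed
  define N where "N = (\<lambda>i::nat. {f \<in> D. T f = \<one> \<and> (\<forall>j<i. \<forall>g. f (j, g) = 0)})"
  have N: "add_subgroup (N i)" for i
    using add_subgroup_zero [OF D] add_subgroup_diff [OF D]
    by (intro add_subgroupI) (auto simp: N_def T_0 T_diff)
  have ND: "x \<in> N i \<Longrightarrow> x \<in> D" for x i
    by (simp add: N_def)
  have NS: "N (Suc i) \<subseteq> N i" for i
    by (auto simp: N_def)
  define C where "C = (\<lambda>i. additive_monoid (N i))"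
  have cC: "comm_group (C i)" and gC: "group (C i)" for i
    using comm_group_additive_monoid [OF N] by (auto simp: C_def comm_group_def)
  have tower: "abelian_tower C (\<lambda>_ x. x)"
    using cC NS by (auto simp: abelian_tower_def hom_def C_def)
  define P where "P = product_group UNIV C"
  have memP: "y \<in> carrier P \<longleftrightarrow> (\<forall>i. y i \<in> N i)" for y
    by (auto simp: P_def C_def)
  have multP: "y \<otimes>\<^bsub>P\<^esub> z = (\<lambda>i. y i + z i)" for y z
    by (simp add: P_def C_def restrict_UNIV)
  have gP: "group P"
    unfolding P_def using gC by simp
  \<comment> \<open>The infinite sum of the \<open>y i\<close> makes sense because
    \<open>y i\<close> vanishes in the columns below \<open>i\<close>.\<close>
  define S where "S = (\<lambda>(y :: nat \<Rightarrow> nat \<times> 'g \<Rightarrow> rat) s. \<Sum>i\<le>fst s. y i s)"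
  have SD: "S y \<in> D" if y: "y \<in> carrier P" for y
    unfolding D_def integral_funs_def S_def
  proof (intro CollectI allI Ints_sum)
    show "y i s \<in> \<int>" for i s
      using y ND [of "y i" i] unfolding memP D_def integral_funs_def by blast
  qed
  have S_add: "S (\<lambda>i. y i + z i) = S y + S z" for y z
    by (rule ext) (simp add: S_def sum.distrib)
  have psi: "(\<lambda>y. T (S y)) \<in> hom P G"
    by (rule homI) (auto simp: TD SD multP S_add T_add)
  interpret psi: group_hom P G "\<lambda>y. T (S y)"
    by (intro group_hom.intro group_hom_axioms.intro gP psi group_axioms)
  have S_tele: "S (\<lambda>i. z i - z (Suc i)) = z 0" if "\<And>i j g. j < i \<Longrightarrow> z i (j, g) = 0" for z
  proof
    fix s :: "nat \<times> 'g"
    have "(\<Sum>i\<le>fst s. z i s - z (Suc i) s) = z 0 s - z (Suc (fst s)) s"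
      using sum_telescope [of "\<lambda>i. z i s"] by simp
    moreover have "z (Suc (fst s)) s = 0"
      using that [of "fst s" "Suc (fst s)" "snd s"] by simp
    ultimately show "S (\<lambda>i. z i - z (Suc i)) s = z 0 s"
      by (simp add: S_def)
  qed
  have surj: "(\<lambda>y. T (S y)) ` carrier P = carrier G"
  proof
    show "(\<lambda>y. T (S y)) ` carrier P \<subseteq> carrier G"
      using psi by (rule hom_carrier)
    show "carrier G \<subseteq> (\<lambda>y. T (S y)) ` carrier P"
    proof
      fix g assume g: "g \<in> carrier G"
      \<comment> \<open>Moving \<open>g\<close> from one column to the next does not change the
        value of \<open>T\<close>, so the differences lie in the kernels, while their infinite sum
        telescopes to \<open>\<delta> 0 g\<close>.\<close>
      define y where "y = (\<lambda>i. \<delta> i g - \<delta> (Suc i) g)"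
      have "T (y i) = \<one>" for i
        using T_diff [OF \<delta>D \<delta>D] T_\<delta> [OF g] g by (simp add: y_def)
      moreover have "y i \<in> D" for i
        unfolding y_def by (rule add_subgroup_diff [OF D \<delta>D \<delta>D])
      moreover have "y i (j, h) = 0" if "j < i" for i j h
        using that by (simp add: y_def \<delta>_def)
      ultimately have "y \<in> carrier P"
        by (simp add: memP N_def)
      moreover have "S y = \<delta> 0 g"
        unfolding y_def by (rule S_tele) (simp add: \<delta>_def)
      ultimately show "g \<in> (\<lambda>y. T (S y)) ` carrier P"
        using T_\<delta> [OF g] by (intro image_eqI [of _ _ y]) auto
    qed
  qed
  have ker: "kernel P G (\<lambda>y. T (S y)) =
     (\<lambda>x i. x i \<otimes>\<^bsub>C i\<^esub> inv\<^bsub>C i\<^esub> (x (Suc i))) ` carrier P" (is "?K = ?E ` _")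
  proof -
    have E: "?E z = (\<lambda>i. z i - z (Suc i))" if z: "z \<in> carrier P" for z
    proof -
      have "inv\<^bsub>C i\<^esub> (z (Suc i)) = - z (Suc i)" for i
        unfolding C_def using z NS [of i] by (intro inv_additive_monoid [OF N]) (auto simp: memP)
      then show ?thesis by (simp add: C_def)
    qed
    show ?thesis
    proof (intro equalityI subsetI)
      fix y assume "y \<in> ?K"
      then have yP: "y \<in> carrier P" and TS: "T (S y) = \<one>"
        by (auto simp: kernel_def)
      have yN: "y i \<in> N i" for i
        using yP by (simp add: memP)
      \<comment> \<open>The tail of the sum from \<open>i\<close> on. It vanishes in the columns
        below \<open>i\<close>, where only the removed terms contribute.\<close>
      define z where "z = (\<lambda>i. S y - (\<Sum>k<i. y k))"
      have part: "(\<Sum>k<i. y k) \<in> N 0" for i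
        by (rule add_subgroup_sum [OF N]) (use yN in \<open>auto simp: N_def\<close>)
      have "S y \<in> N 0"
        using SD [OF yP] TS by (simp add: N_def)
      then have z0: "z i \<in> N 0" for i
        unfolding z_def by (rule add_subgroup_diff [OF N _ part])
      have sum_apply: "(\<Sum>k<i. y k) s = (\<Sum>k<i. y k s)" for i s
        by (induction i) auto
      have tail: "z i (j, g) = 0" if "j < i" for i j g
      proof -
        have "(\<Sum>k<i. y k (j, g)) = (\<Sum>k\<le>j. y k (j, g))"
          using that yN by (intro sum.mono_neutral_right) (auto simp: N_def)
        then show ?thesis by (simp add: z_def S_def sum_apply)
      qed
      have "z i \<in> N i" for i
        using z0 [of i] tail [of _ i] by (simp add: N_def)
      then have zP: "z \<in> carrier P" by (simp add: memP)
      have "?E z = y"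
        unfolding E [OF zP] by (rule ext) (simp add: z_def)
      then show "y \<in> ?E ` carrier P" using zP by blast
    next
      fix y assume "y \<in> ?E ` carrier P"
      then obtain z where z: "z \<in> carrier P" "y = (\<lambda>i. z i - z (Suc i))"
        using E by auto
      have zN: "z i \<in> N i" for i using z by (simp add: memP)
      have "S y = z 0"
        unfolding z(2) by (rule S_tele) (use zN in \<open>auto simp: N_def\<close>)
      then have "T (S y) = \<one>"
        using zN [of 0] by (simp add: N_def)
      moreover have "y i \<in> N i" for i
        unfolding z(2) using zN [of "Suc i"] NS by (intro add_subgroup_diff [OF N zN]) auto
      ultimately show "y \<in> ?K"
        by (simp add: kernel_def memP)
    qed
  qed
  have lim: "lim1 C (\<lambda>_ x. x) = P Mod kernel P G (\<lambda>y. T (S y))"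
    unfolding ker by (simp add: lim1_def cokernel_def P_def)
  have "lim1 C (\<lambda>_ x. x) \<cong> G"
    unfolding lim by (rule psi.FactGroup_iso [OF surj])
  moreover have "group (lim1 C (\<lambda>_ x. x))"
    unfolding lim by (rule normal.factorgroup_is_group [OF psi.normal_kernel])
  ultimately have "G \<cong> lim1 C (\<lambda>_ x. x)"
    by (simp add: group.iso_sym)
  then show ?thesis
    by (rule cotorsion_groupI [OF G tower])
qed

section \<open>Cokernels of maps into inverse limits\<close>

lemma mem_inv_limit:
  "x \<in> carrier (inv_limit A p) \<longleftrightarrow> (\<forall>i. x i \<in> carrier (A i)) \<and> (\<forall>i. p i (x (Suc i)) = x i)"
  by (auto simp: inv_limit_def)

lemma mult_inv_limit [simp]: "x \<otimes>\<^bsub>inv_limit A p\<^esub> y = (\<lambda>i. x i \<otimes>\<^bsub>A i\<^esub> y i)"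
  and one_inv_limit [simp]: "\<one>\<^bsub>inv_limit A p\<^esub> = (\<lambda>i. \<one>\<^bsub>A i\<^esub>)"
  by (simp_all add: inv_limit_def restrict_UNIV)

lemma pow_inv_limit: "(x [^]\<^bsub>inv_limit A p\<^esub> (n::nat)) i = x i [^]\<^bsub>A i\<^esub> n"
  by (induction n) auto

lemma abelian_towerD:
  assumes "abelian_tower A p"
  shows "comm_group (A i)" "group (A i)" "p i \<in> hom (A (Suc i)) (A i)" "group_hom (A (Suc i)) (A i) (p i)"
  using assms by (auto simp: abelian_tower_def comm_group_def group_hom_def group_hom_axioms_def)

lemma comm_group_inv_limit:
  assumes "abelian_tower A p"
  shows "comm_group (inv_limit A p)"
  unfolding inv_limit_def
proof (rule comm_group_subgroup)
  note A = abelian_towerD [OF assms]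
  show c: "comm_group (product_group UNIV A)"
    by (rule comm_group_product_group) (rule A)
  then interpret comm_group "product_group UNIV A" .
  show "subgroup {x \<in> carrier (product_group UNIV A). \<forall>i. p i (x (Suc i)) = x i} (product_group UNIV A)"
  proof (rule subgroupI)
    show "{x \<in> carrier (product_group UNIV A). \<forall>i. p i (x (Suc i)) = x i} \<noteq> {}"
      using one_closed A(4) [THEN group_hom.hom_one] by (auto simp: restrict_UNIV intro!: exI [of _ "\<lambda>i. \<one>\<^bsub>A i\<^esub>"] group.is_monoid A(2) monoid.one_closed)
  qed (use A(4) [THEN group_hom.hom_inv] A(4) [THEN group_hom.hom_mult] A(2) in
      \<open>auto simp: restrict_UNIV PiE_iff group.is_monoid monoid.m_closed\<close>)
qed

lemma proj_inv_limit_hom: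
  "abelian_tower A p \<Longrightarrow> group_hom (inv_limit A p) (A i) (\<lambda>x. x i)"
  using comm_group_inv_limit [of A p] abelian_towerD(2) [of A p i]
  by (auto simp: group_hom_def group_hom_axioms_def comm_group_def hom_def mem_inv_limit)

lemma inv_limit_one_below:
  assumes "abelian_tower A p" "x \<in> carrier (inv_limit A p)" "x k = \<one>\<^bsub>A k\<^esub>" "i \<le> k"
  shows "x i = \<one>\<^bsub>A i\<^esub>"
  using assms(4)
proof (induction rule: inc_induct)
  case (step n)
  have "x n = p n (x (Suc n))"
    using assms(2) by (simp add: mem_inv_limit)
  then show ?case
    using step.IH abelian_towerD(4) [OF assms(1), THEN group_hom.hom_one] by simp
qed (rule assms)

text \<open>
  Writing groups additively, choose \<open>e\<^sub>k\<close> such that \<open>e\<^sub>k g\<^sub>k\<^sub>+\<^sub>1\<close> is the sum of an element of the image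
  and of some \<open>l\<^sub>k\<close> that vanishes up to level \<open>k\<close>. Then \<open>x\<^sub>k = g\<^sub>k + l\<^sub>k + e\<^sub>k l\<^sub>k\<^sub>+\<^sub>1 + e\<^sub>k e\<^sub>k\<^sub>+\<^sub>1 l\<^sub>k\<^sub>+\<^sub>2 + \<dots>\<close>
  converges in the limit and solves \<open>x\<^sub>k = g\<^sub>k + e\<^sub>k x\<^sub>k\<^sub>+\<^sub>1\<close> modulo the image.
\<close>

theorem cotorsion_group_cokernel_inv_limit:
  assumes Y: "abelian_tower Y q" and X: "group X" and h: "h \<in> hom X (inv_limit Y q)"
    and bounded: "\<And>i. \<exists>c>0. \<forall>y\<in>carrier (inv_limit Y q). y i [^]\<^bsub>Y i\<^esub> (c::nat) \<in> (\<lambda>x. h x i) ` carrier X"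
  shows "cotorsion_group (cokernel X (inv_limit Y q) h)"
proof -
  define L where "L = inv_limit Y q"
  define I where "I = h ` carrier X"
  interpret L: comm_group L
    unfolding L_def by (rule comm_group_inv_limit [OF Y])
  interpret h: group_hom X L h
    using X h by (simp add: group_hom_def group_hom_axioms_def L_def L.group_axioms [unfolded L_def])
  have sub: "subgroup I L"
    unfolding I_def by (rule h.img_is_subgroup)
  have nI: "I \<lhd> L"
    by (rule L.subgroup_imp_normal [OF sub])
  define M where "M = L Mod I"
  have cM: "comm_group M"
    unfolding M_def by (rule L.abelian_FactGroup [OF sub])
  interpret M: comm_group M by (rule cM)
  define \<pi> where "\<pi> = (\<lambda>x. I #>\<^bsub>L\<^esub> x)"
  interpret \<pi>: group_hom L M \<pi>
    using normal.r_coset_hom_Mod [OF nI] L.group_axioms M.group_axioms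
    by (simp add: group_hom_def group_hom_axioms_def \<pi>_def M_def)
  have \<pi>_surj: "\<exists>y\<in>carrier L. c = \<pi> y" if "c \<in> carrier M" for c
    using that by (auto simp: M_def \<pi>_def carrier_FactGroup)
  have \<pi>_I: "\<pi> y = \<one>\<^bsub>M\<^esub>" if "y \<in> I" for y
    using that L.coset_join2 [OF _ sub] subgroup.mem_carrier [OF sub] by (simp add: \<pi>_def M_def FactGroup_def)
  obtain c where c: "\<And>i. (c i :: nat) > 0" "\<And>i y. y \<in> carrier L \<Longrightarrow> y i [^]\<^bsub>Y i\<^esub> c i \<in> (\<lambda>x. h x i) ` carrier X"
    using bounded unfolding L_def by metis
  \<comment> \<open>\<open>c i\<close> brings multiples into the image at level \<open>i\<close>;
    the factor \<open>Suc i\<close> supplies the divisibility demanded by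
    \<open>solvable_towers\<close>.\<close>
  define e where "e = (\<lambda>i. c i * Suc i)"
  have "solvable_towers M"
    unfolding solvable_towers_def
  proof (intro exI [of _ e] conjI allI impI)
    show "0 < e n" "Suc n dvd e n" for n
      using c(1) by (auto simp: e_def simp del: mult_Suc_right)
    fix G :: "nat \<Rightarrow> _" assume "\<forall>n. G n \<in> carrier M"
    then have "\<forall>n. \<exists>y. y \<in> carrier L \<and> G n = \<pi> y"
      using \<pi>_surj by blast
    then obtain g where g: "\<And>n. g n \<in> carrier L" "\<And>n. G n = \<pi> (g n)"
      by metis
    have "\<exists>\<xi> l. \<xi> \<in> I \<and> l \<in> carrier L \<and> l k = \<one>\<^bsub>Y k\<^esub> \<and> g (Suc k) [^]\<^bsub>L\<^esub> e k = \<xi> \<otimes>\<^bsub>L\<^esub> l" for k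
    proof -
      define y where "y = g (Suc k) [^]\<^bsub>L\<^esub> e k"
      have yL: "y \<in> carrier L"
        using g by (simp add: y_def)
      interpret pk: group_hom L "Y k" "\<lambda>x. x k"
        unfolding L_def by (rule proj_inv_limit_hom [OF Y])
      have "y = (g (Suc k) [^]\<^bsub>L\<^esub> Suc k) [^]\<^bsub>L\<^esub> c k"
        unfolding y_def e_def mult.commute [of "c k"] by (rule L.nat_pow_pow [OF g(1), symmetric])
      then have "y k = (g (Suc k) [^]\<^bsub>L\<^esub> Suc k) k [^]\<^bsub>Y k\<^esub> c k"
        by (simp add: L_def pow_inv_limit del: nat_pow_Suc)
      then obtain x where x: "x \<in> carrier X" "y k = h x k"
        using c(2) [of "g (Suc k) [^]\<^bsub>L\<^esub> Suc k" k] g(1) by auto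
      define l where "l = inv\<^bsub>L\<^esub> (h x) \<otimes>\<^bsub>L\<^esub> y"
      have "l \<in> carrier L" "y = h x \<otimes>\<^bsub>L\<^esub> l"
        using x yL by (simp_all add: l_def L.m_assoc [symmetric])
      moreover have "l k = \<one>\<^bsub>Y k\<^esub>"
      proof -
        have "l k = inv\<^bsub>Y k\<^esub> (h x k) \<otimes>\<^bsub>Y k\<^esub> y k"
          unfolding l_def using x yL by (simp only: pk.hom_mult L.inv_closed h.hom_closed pk.hom_inv)
        then show ?thesis
          unfolding x(2) [symmetric] using pk.H.l_inv [OF pk.hom_closed [OF yL]] by simp
      qed
      ultimately show ?thesis
        using x(1) unfolding y_def I_def by blast
    qed
    then obtain \<xi> l where \<xi>: "\<And>k. \<xi> k \<in> I" and l: "\<And>k. l k \<in> carrier L" "\<And>k. l k k = \<one>\<^bsub>Y k\<^esub>"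
      and split: "\<And>k. g (Suc k) [^]\<^bsub>L\<^esub> e k = \<xi> k \<otimes>\<^bsub>L\<^esub> l k"
      by metis
    have l_one: "l k i = \<one>\<^bsub>Y i\<^esub>" if "i \<le> k" for k i
      using inv_limit_one_below [OF Y l(1) [unfolded L_def] l(2) that] .
    \<comment> \<open>\<open>r d k\<close> consists of the first \<open>d\<close> terms of the
      series that starts with \<open>l k\<close>.\<close>
    define r where "r = rec_nat (\<lambda>k. \<one>\<^bsub>L\<^esub>) (\<lambda>_ f k. l k \<otimes>\<^bsub>L\<^esub> f (Suc k) [^]\<^bsub>L\<^esub> e k)"
    have r_simps: "r 0 k = \<one>\<^bsub>L\<^esub>" "r (Suc d) k = l k \<otimes>\<^bsub>L\<^esub> r d (Suc k) [^]\<^bsub>L\<^esub> e k" for d k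
      by (simp_all add: r_def)
    have rL: "r d k \<in> carrier L" for d k
      by (induction d arbitrary: k) (auto simp only: r_simps L.one_closed L.m_closed L.nat_pow_closed l)
    have r_coord: "r (Suc d) k i = l k i \<otimes>\<^bsub>Y i\<^esub> r d (Suc k) i [^]\<^bsub>Y i\<^esub> e k" for d k i
      by (simp add: r_simps L_def pow_inv_limit)
    \<comment> \<open>The additional term is a multiple of \<open>l (k + d)\<close>, which is
      trivial in the coordinates up to \<open>k + d\<close>.\<close>
    have stable: "r (Suc d) k i = r d k i" if "i \<le> k + d" for d k i
      using that
    proof (induction d arbitrary: k)
      case 0
      interpret Yi: group "Y i" by (rule abelian_towerD [OF Y])
      show ?case
        using 0 l_one [of i k] by (simp add: r_simps) (simp add: L_def pow_inv_limit)
    next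
      case (Suc d)
      then show ?case
        by (subst r_coord, subst (2) r_coord) simp
    qed
    \<comment> \<open>Coordinate \<open>i\<close> is final after \<open>i\<close> terms, whatever
      \<open>k\<close> is, since \<open>i \<le> k + i\<close>.\<close>
    define s where "s = (\<lambda>k i. r i k i)"
    have sL: "s k \<in> carrier L" for k
    proof -
      have "r i k i \<in> carrier (Y i)" for i
        using rL [of i k] by (simp add: L_def mem_inv_limit)
      moreover have "q i (r (Suc i) k (Suc i)) = r i k i" for i
        using rL [of "Suc i" k] stable [of i k i] by (simp add: L_def mem_inv_limit)
      ultimately show ?thesis
        by (simp add: L_def mem_inv_limit s_def)
    qed
    have s_rec: "s k = l k \<otimes>\<^bsub>L\<^esub> s (Suc k) [^]\<^bsub>L\<^esub> e k" for k
    proof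
      fix i
      have "s k i = r (Suc i) k i"
        using stable [of i k i] by (simp add: s_def)
      also have "\<dots> = (l k \<otimes>\<^bsub>L\<^esub> s (Suc k) [^]\<^bsub>L\<^esub> e k) i"
        unfolding r_coord by (simp add: L_def pow_inv_limit s_def)
      finally show "s k i = (l k \<otimes>\<^bsub>L\<^esub> s (Suc k) [^]\<^bsub>L\<^esub> e k) i" .
    qed
    define x where "x = (\<lambda>k. g k \<otimes>\<^bsub>L\<^esub> s k)"
    have xL: "x k \<in> carrier L" for k
      unfolding x_def using g(1) sL by blast
    have "\<pi> (x k) = G k \<otimes>\<^bsub>M\<^esub> \<pi> (x (Suc k)) [^]\<^bsub>M\<^esub> e k" for k
    proof -
      have "x (Suc k) [^]\<^bsub>L\<^esub> e k = g (Suc k) [^]\<^bsub>L\<^esub> e k \<otimes>\<^bsub>L\<^esub> s (Suc k) [^]\<^bsub>L\<^esub> e k"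
        unfolding x_def by (rule L.nat_pow_distrib [OF g(1) sL])
      also have "\<dots> = \<xi> k \<otimes>\<^bsub>L\<^esub> s k"
        unfolding split using \<xi> l sL subgroup.mem_carrier [OF sub] s_rec [of k]
        by (metis L.m_assoc L.nat_pow_closed)
      finally have eq: "x (Suc k) [^]\<^bsub>L\<^esub> e k = \<xi> k \<otimes>\<^bsub>L\<^esub> s k" .
      have "\<pi> (x (Suc k)) [^]\<^bsub>M\<^esub> e k = \<pi> (x (Suc k) [^]\<^bsub>L\<^esub> e k)"
        by (rule \<pi>.hom_nat_pow [OF xL, symmetric])
      also have "\<dots> = \<pi> (s k)"
        unfolding eq using \<pi>.hom_mult [OF subgroup.mem_carrier [OF sub \<xi>] sL] \<pi>_I [OF \<xi>] \<pi>.hom_closed [OF sL]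
        by simp
      finally show ?thesis
        unfolding x_def g(2) using \<pi>.hom_mult [OF g(1) sL] by simp
    qed
    then show "\<exists>x. (\<forall>n. x n \<in> carrier M) \<and> (\<forall>n. x n = G n \<otimes>\<^bsub>M\<^esub> x (Suc n) [^]\<^bsub>M\<^esub> e n)"
      using \<pi>.hom_closed [OF xL] by (intro exI [of _ "\<lambda>n. \<pi> (x n)"]) blast
  qed
  then have "cotorsion_group M"
    by (rule cotorsion_group_if_solvable_towers [OF cM])
  then show ?thesis
    by (simp add: M_def cokernel_def I_def L_def)
qed

section \<open>Simplices with a constant coordinate\<close>

definition cone :: "'v \<Rightarrow> 'v chain \<Rightarrow> 'v chain" where
  "cone v = frag_extend (\<lambda>vs. frag_of (v # vs))"

lemma cone_of [simp]: "cone v (frag_of vs) = frag_of (v # vs)"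
  and cone_0 [simp]: "cone v 0 = 0"
  and cone_diff: "cone v (a - b) = cone v a - cone v b"
  by (simp_all add: cone_def frag_extend_diff)

lemma cone_add: "cone v (a + b) = cone v a + cone v b"
  by (simp add: cone_def frag_extend_add)

lemma keys_cone: "supp (cone v c) \<subseteq> (#) v ` supp c"
  unfolding cone_def using keys_frag_extend [of "\<lambda>vs. frag_of (v # vs)" c] by auto

text \<open>The boundary of the augmented complex: the face of a vertex is the empty simplex. This
  is what makes \<open>bdy_cone\<close> hold in every degree.\<close>

fun face_sum :: "'v list \<Rightarrow> 'v chain" where
  "face_sum [] = 0"
| "face_sum (v # vs) = frag_of vs - cone v (face_sum vs)"

definition simplicial_boundary :: "'v chain \<Rightarrow> 'v chain" where
  "simplicial_boundary = frag_extend face_sum"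

abbreviation bdy where "bdy \<equiv> simplicial_boundary"

lemma bdy_of [simp]: "bdy (frag_of vs) = face_sum vs"
  and bdy_0 [simp]: "bdy 0 = 0"
  and bdy_diff: "bdy (a - b) = bdy a - bdy b"
  and bdy_uminus: "bdy (- a) = - bdy a"
  and bdy_add: "bdy (a + b) = bdy a + bdy b"
  by (simp_all add: simplicial_boundary_def frag_extend_diff frag_extend_minus frag_extend_add)

lemma bdy_sum: "bdy (sum f I) = (\<Sum>i\<in>I. bdy (f i))"
  by (induction I rule: infinite_finite_induct) (auto simp: bdy_add)

lemma bdy_cone: "bdy (cone v c) = c - cone v (bdy c)"
  by (induction c rule: frag_induct) (auto simp: bdy_diff cone_diff)

lemma bdy_face_sum: "bdy (face_sum vs) = 0"
  by (induction vs) (auto simp: bdy_diff bdy_cone)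

lemma bdy_bdy: "bdy (bdy c) = 0"
  by (induction c rule: frag_induct) (auto simp: bdy_diff bdy_face_sum)

lemma bar_map_cone: "bar_map f (cone v c) = cone (f v) (bar_map f c)"
  by (induction c rule: frag_induct) (auto simp: bar_map_diff cone_diff)

lemma bar_map_face_sum: "bar_map f (face_sum vs) = face_sum (map f vs)"
  by (induction vs) (auto simp: bar_map_diff bar_map_cone)

lemma bdy_bar_map: "bdy (bar_map f c) = bar_map f (bdy c)"
  by (induction c rule: frag_induct) (auto simp: bar_map_diff bdy_diff bar_map_face_sum)

lemma keys_face_sum:
  "ws \<in> supp (face_sum vs) \<Longrightarrow> length vs = Suc (length ws) \<and> set ws \<subseteq> set vs"
proof (induction vs arbitrary: ws)
  case (Cons v vs)
  have "ws \<in> supp (frag_of vs) \<union> supp (cone v (face_sum vs))"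
    using Cons.prems keys_diff by fastforce
  then consider "ws = vs" | us where "us \<in> supp (face_sum vs)" "ws = v # us"
    using keys_cone [of v "face_sum vs"] by auto
  then show ?case
    using Cons.IH by cases auto
qed simp

lemma keys_bdy:
  assumes "ws \<in> supp (bdy c)"
  obtains vs where "vs \<in> supp c" "length vs = Suc (length ws)" "set ws \<subseteq> set vs"
proof -
  obtain vs where "vs \<in> supp c" "ws \<in> supp (face_sum vs)"
    using assms keys_frag_extend [of face_sum c] by (auto simp: simplicial_boundary_def)
  then show thesis
    using keys_face_sum that by blast
qed

text \<open>The standard prism, the alternating sum of the simplices v_0 ... v_i f(v_i) ... f(v_n),
  which is a homotopy between the identity and \<open>f\<close>.\<close>

fun prism_simplex :: "('v \<Rightarrow> 'v) \<Rightarrow> 'v list \<Rightarrow> 'v chain" where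
  "prism_simplex f [] = 0"
| "prism_simplex f (v # vs) = frag_of (v # f v # map f vs) - cone v (prism_simplex f vs)"

definition prism :: "('v \<Rightarrow> 'v) \<Rightarrow> 'v chain \<Rightarrow> 'v chain" where
  "prism f = frag_extend (prism_simplex f)"

lemma prism_of [simp]: "prism f (frag_of vs) = prism_simplex f vs"
  and prism_0 [simp]: "prism f 0 = 0"
  and prism_diff: "prism f (a - b) = prism f a - prism f b"
  by (simp_all add: prism_def frag_extend_diff)

lemma prism_cone: "prism f (cone v c) = cone v (cone (f v) (bar_map f c)) - cone v (prism f c)"
  by (induction c rule: frag_induct) (auto simp: prism_diff cone_diff bar_map_diff)

lemma prism_homotopy_simplex:
  "bdy (prism_simplex f vs) + prism f (face_sum vs) = frag_of (map f vs) - frag_of vs"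
proof (induction vs)
  case (Cons v vs)
  have "bdy (prism_simplex f vs) = frag_of (map f vs) - frag_of vs - prism f (face_sum vs)"
    using Cons.IH by (simp add: algebra_simps)
  then show ?case
    by (simp add: bdy_diff bdy_cone prism_diff prism_cone cone_diff bar_map_face_sum)
qed simp

lemma prism_homotopy: "bdy (prism f c) + prism f (bdy c) = bar_map f c - c"
proof (induction c rule: frag_induct)
  case (diff a b)
  have "bdy (prism f (a - b)) + prism f (bdy (a - b)) =
      (bdy (prism f a) + prism f (bdy a)) - (bdy (prism f b) + prism f (bdy b))"
    by (simp add: prism_diff bdy_diff)
  then show ?case
    unfolding diff by (simp add: bar_map_diff)
qed (auto simp: prism_homotopy_simplex)

lemma keys_prism_simplex:
  "ws \<in> supp (prism_simplex f vs) \<Longrightarrow>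
     length ws = Suc (length vs) \<and> set ws \<subseteq> set vs \<union> f ` set vs"
proof (induction vs arbitrary: ws)
  case (Cons v vs)
  have "ws \<in> supp (frag_of (v # f v # map f vs)) \<union> supp (cone v (prism_simplex f vs))"
    using Cons.prems keys_diff by fastforce
  then consider "ws = v # f v # map f vs" | us where "us \<in> supp (prism_simplex f vs)" "ws = v # us"
    using keys_cone [of v "prism_simplex f vs"] by auto
  then show ?case
    using Cons.IH by cases fastforce+
qed simp

lemma keys_prism:
  assumes "ws \<in> supp (prism f c)"
  obtains vs where "vs \<in> supp c" "length ws = Suc (length vs)" "set ws \<subseteq> set vs \<union> f ` set vs"
proof -
  obtain vs where "vs \<in> supp c" "ws \<in> supp (prism_simplex f vs)"
    using assms keys_frag_extend [of "prism_simplex f" c] by (auto simp: prism_def)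
  then show thesis
    using keys_prism_simplex that by blast
qed

text \<open>The empty simplex is constant in every coordinate, so for positive \<open>k\<close> the
  augmentation disappears modulo \<open>degenerate k\<close>.\<close>

definition constant_coord :: "nat \<Rightarrow> (nat \<Rightarrow> 'v) list \<Rightarrow> bool" where
  "constant_coord j vs \<longleftrightarrow> (\<exists>a. \<forall>v\<in>set vs. v j = a)"

definition degenerate :: "nat \<Rightarrow> (nat \<Rightarrow> 'v) chain set" where
  "degenerate k = {c. supp c \<subseteq> {vs. \<exists>j<k. constant_coord j vs}}"

lemma add_subgroup_degenerate: "add_subgroup (degenerate k)"
  unfolding degenerate_def by (rule add_subgroup_keys)

lemma degenerateI:
  "(\<And>vs. vs \<in> supp c \<Longrightarrow> \<exists>j<k. constant_coord j vs) \<Longrightarrow> c \<in> degenerate k"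
  by (auto simp: degenerate_def)

lemma degenerateE:
  assumes "c \<in> degenerate k" "vs \<in> supp c"
  obtains j where "j < k" "constant_coord j vs"
  using assms by (auto simp: degenerate_def)

lemma constant_coord_subset: "constant_coord j vs \<Longrightarrow> set ws \<subseteq> set vs \<Longrightarrow> constant_coord j ws"
  by (auto simp: constant_coord_def)

lemma bdy_degenerate: "c \<in> degenerate k \<Longrightarrow> bdy c \<in> degenerate k"
  by (rule degenerateI) (metis keys_bdy degenerateE constant_coord_subset)

lemma bar_map_degenerate:
  assumes "c \<in> degenerate k" "\<And>j v w. j < k \<Longrightarrow> v j = w j \<Longrightarrow> f v j = f w j"
  shows "bar_map f c \<in> degenerate k"
proof -
  have "constant_coord j (map f vs)" if "constant_coord j vs" "j < k" for j vs
  proof (cases vs)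
    case (Cons w ws)
    have "f v j = f w j" if "v \<in> set vs" for v
    proof (rule assms(2) [OF \<open>j < k\<close>])
      show "v j = w j"
        using \<open>constant_coord j vs\<close> that Cons unfolding constant_coord_def by (metis list.set_intros(1))
    qed
    then show ?thesis by (auto simp: constant_coord_def)
  qed (simp add: constant_coord_def)
  note const = this
  show ?thesis
  proof (rule degenerateI)
    fix vs assume "vs \<in> supp (bar_map f c)"
    then obtain ws where "ws \<in> supp c" "vs = map f ws"
      using keys_bar_map [of f c] by auto
    then show "\<exists>j<k. constant_coord j vs"
      using const degenerateE [OF assms(1)] by metis
  qed
qed

lemma prism_degenerate:
  assumes "c \<in> degenerate k" "\<And>j v. j < k \<Longrightarrow> f v j = v j"
  shows "prism f c \<in> degenerate k"
proof -
  have "constant_coord j ws" if "constant_coord j vs" "j < k" "set ws \<subseteq> set vs \<union> f ` set vs" for j vs ws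
  proof -
    obtain a where a: "\<forall>v\<in>set vs. v j = a"
      using \<open>constant_coord j vs\<close> unfolding constant_coord_def by blast
    have "v j = a" if "v \<in> set ws" for v
      using that \<open>set ws \<subseteq> set vs \<union> f ` set vs\<close> a assms(2) [OF \<open>j < k\<close>] by auto
    then show ?thesis unfolding constant_coord_def by blast
  qed
  then show ?thesis
    using assms(1) by (intro degenerateI) (metis keys_prism degenerateE)
qed

lemma degenerate_mono: "c \<in> degenerate k \<Longrightarrow> k \<le> l \<Longrightarrow> c \<in> degenerate l"
  by (rule degenerateI) (metis degenerateE less_le_trans)

text \<open>
  The tuples of vertices of \<open>V\<^sup>k\<close> modulo those with a constant coordinate form the \<open>k\<close>-fold
  levelwise tensor power of a complex that starts in degree 1, hence are acyclic below degree \<open>k\<close>.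
\<close>

lemma degenerate_acyclic:
  fixes z :: "(nat \<Rightarrow> 'v) chain"
  assumes "\<And>vs. vs \<in> supp z \<Longrightarrow> length vs = Suc n" "bdy z \<in> degenerate k" "n < k"
  shows "\<exists>w. (\<forall>vs\<in>supp w. length vs = Suc (Suc n)) \<and> z - bdy w \<in> degenerate k"
  using assms
proof (induction k arbitrary: z n)
  case (Suc k)
  let ?R = "degenerate :: nat \<Rightarrow> (nat \<Rightarrow> 'v) chain set"
  note R = add_subgroup_degenerate
  show ?case
  proof (cases n)
    case 0
    have "\<exists>j<Suc k. constant_coord j vs" if "length vs = Suc 0" for vs :: "(nat \<Rightarrow> 'v) list"
      using that by (cases vs) (auto simp: constant_coord_def)
    then have "z \<in> ?R (Suc k)"
      using Suc.prems(1) 0 by (auto simp: degenerate_def)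
    then show ?thesis
      by (intro exI [of _ 0]) auto
  next
    case (Suc m)
    then have km: "m < k" using Suc.prems(3) by simp
    define sel where "sel = (\<lambda>P. frag_extend (\<lambda>vs :: (nat \<Rightarrow> 'v) list. if P vs then frag_of vs else 0))"
    have keys_sel: "supp (sel P c) \<subseteq> {vs \<in> supp c. P vs}" for P c
      unfolding sel_def by (rule order_trans [OF keys_frag_extend]) (auto split: if_splits)
    have sel_compl: "sel P c + sel (\<lambda>vs. \<not> P vs) c = c" for P c
      unfolding sel_def frag_extend_fun_add [symmetric] by (subst (3) frag_expansion) (rule frag_extend_eq, simp)
    \<comment> \<open>The part of the boundary that is degenerate on account of coordinate
      \<open>k\<close> alone. Once it is filled, the first \<open>k\<close> coordinates suffice to
      describe the boundary.\<close>
    define r where "r = sel (\<lambda>vs. \<not> (\<exists>j<k. constant_coord j vs)) (bdy z)"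
    define r' where "r' = sel (\<lambda>vs. \<exists>j<k. constant_coord j vs) (bdy z)"
    have r': "r' \<in> ?R k"
      unfolding r'_def using keys_sel by (intro degenerateI) blast
    have rr': "bdy z = r' + r"
      unfolding r_def r'_def using sel_compl by metis
    have keys_r: "constant_coord k vs \<and> length vs = Suc m" if "vs \<in> supp r" for vs
    proof
      have vs: "vs \<in> supp (bdy z)" "\<not> (\<exists>j<k. constant_coord j vs)"
        using that keys_sel unfolding r_def by blast+
      then show "constant_coord k vs"
        using Suc.prems(2) by (metis degenerateE less_SucE)
      show "length vs = Suc m"
        using vs(1) Suc.prems(1) \<open>n = Suc m\<close> by (metis Suc_inject keys_bdy)
    qed
    have bdy_r: "bdy r \<in> ?R k"
    proof -
      have "bdy r = - bdy r'"
        using bdy_bdy [of z] unfolding rr' bdy_add by (simp add: eq_neg_iff_add_eq_0 add.commute)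
      then show ?thesis
        using r' bdy_degenerate add_subgroup_uminus [OF R] by metis
    qed
    \<comment> \<open>Being constant in coordinate \<open>k\<close>, the simplices of
      \<open>r\<close> are sorted by the value there; \<open>I\<close> is the finite set of values
      that occur.\<close>
    define fib where "fib = (\<lambda>a (vs :: (nat \<Rightarrow> 'v) list). \<forall>v\<in>set vs. v k = a)"
    define I where "I = (\<lambda>vs. hd vs k) ` supp r"
    have r_sum: "r = (\<Sum>a\<in>I. sel (fib a) r)"
    proof -
      have one: "(\<Sum>a\<in>I. if fib a vs then frag_of vs else 0) = frag_of vs" if "vs \<in> supp r" for vs
      proof -
        have "fib a vs \<longleftrightarrow> a = hd vs k" for a
          using keys_r [OF that] by (cases vs) (auto simp: fib_def constant_coord_def)
        then have "(\<Sum>a\<in>I. if fib a vs then frag_of vs else 0) = (\<Sum>a\<in>I. if hd vs k = a then frag_of vs else 0)"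
          by (intro sum.cong) auto
        also have "\<dots> = frag_of vs"
          using that by (subst sum.delta') (auto simp: I_def)
        finally show ?thesis .
      qed
      have "(\<Sum>a\<in>I. sel (fib a) c) = frag_extend (\<lambda>vs. \<Sum>a\<in>I. if fib a vs then frag_of vs else 0) c" for c
        by (induction c rule: frag_induct) (auto simp: sel_def frag_extend_diff sum_subtractf)
      also have "\<dots> r = frag_extend frag_of r"
        by (rule frag_extend_eq) (rule one)
      finally show ?thesis
        by (metis frag_expansion)
    qed
    \<comment> \<open>Each fibre is a cycle modulo \<open>degenerate k\<close> one dimension lower,
      so the induction hypothesis fills it.\<close>
    have fibre: "\<exists>s. (\<forall>vs\<in>supp s. length vs = Suc (Suc m)) \<and> s \<in> ?R (Suc k) \<and>
        sel (fib a) r - bdy s \<in> ?R k" for a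
    proof -
      have len: "length vs = Suc m" if "vs \<in> supp (sel (fib a) r)" for vs
        using that keys_sel keys_r by blast
      \<comment> \<open>Selecting a fibre commutes with the boundary as long as the faces are
        nonempty. The empty simplex would belong to all fibres, but for \<open>m = 0\<close> the
        boundary is degenerate anyway.\<close>
      have bd: "bdy (sel (fib a) r) \<in> ?R k"
      proof (cases m)
        case 0
        have "vs = []" if "vs \<in> supp (bdy (sel (fib a) r))" for vs
          using that len 0 by (metis Suc_inject keys_bdy length_0_conv)
        moreover have "\<exists>j<k. constant_coord j ([] :: (nat \<Rightarrow> 'v) list)"
          using km by (auto simp: constant_coord_def)
        ultimately show ?thesis
          by (intro degenerateI) metis
      next
        case (Suc m')
        have face: "sel (fib a) (face_sum vs) = (if fib a vs then face_sum vs else 0)"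
          if vs: "vs \<in> supp r" for vs
        proof -
          obtain b where b: "\<forall>v\<in>set vs. v k = b" and l: "length vs = Suc (Suc m')"
            using keys_r [OF vs] Suc by (auto simp: constant_coord_def)
          have "fib a ws \<longleftrightarrow> fib a vs" if "ws \<in> supp (face_sum vs)" for ws
          proof -
            have "set ws \<subseteq> set vs" "ws \<noteq> []" "vs \<noteq> []"
              using keys_face_sum [OF that] l by auto
            then have "hd ws \<in> set ws" "hd vs \<in> set vs" "\<forall>v\<in>set ws. v k = b"
              using b by auto
            then show ?thesis
              using b unfolding fib_def by metis
          qed
          then have "sel (fib a) (face_sum vs) = frag_extend (\<lambda>ws. if fib a vs then frag_of ws else 0) (face_sum vs)"
            unfolding sel_def by (intro frag_extend_eq) auto
          then show ?thesis
            by (auto simp: frag_expansion [symmetric] intro: frag_extend_eq_0)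
        qed
        have "bdy (sel (fib a) r) = sel (fib a) (bdy r)"
          unfolding simplicial_boundary_def sel_def frag_extend_frag_extend
        proof (rule frag_extend_eq)
          fix vs assume "vs \<in> supp r"
          from face [OF this]
          show "frag_extend face_sum (if fib a vs then frag_of vs else 0) =
            frag_extend (\<lambda>vs. if fib a vs then frag_of vs else 0) (face_sum vs)"
            by (simp add: sel_def)
        qed
        then show ?thesis
          using bdy_r keys_sel [of "fib a" "bdy r"]
          by (intro degenerateI) (metis (no_types, lifting) degenerateE mem_Collect_eq subsetD)
      qed
      obtain s where s: "\<forall>vs\<in>supp s. length vs = Suc (Suc m)" "sel (fib a) r - bdy s \<in> ?R k"
        using Suc.IH [OF len bd km] by auto
      \<comment> \<open>Resetting coordinate \<open>k\<close> to \<open>a\<close> fixes the fibre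
        and makes its filling constant in coordinate \<open>k\<close>.\<close>
      define f where "f = (\<lambda>v :: nat \<Rightarrow> 'v. v(k := a))"
      have "bar_map f (sel (fib a) r) = bar_map (\<lambda>v. v) (sel (fib a) r)"
      proof (rule bar_map_cong)
        fix vs assume "vs \<in> supp (sel (fib a) r)"
        then have "fib a vs" using keys_sel by blast
        then show "map f vs = map (\<lambda>v. v) vs"
          by (intro map_cong) (auto simp: f_def fib_def)
      qed
      then have fr: "bar_map f (sel (fib a) r) = sel (fib a) r"
        by (simp add: bar_map_def frag_expansion [symmetric])
      have "bar_map f (sel (fib a) r - bdy s) \<in> ?R k"
        by (rule bar_map_degenerate [OF s(2)]) (auto simp: f_def)
      then have "sel (fib a) r - bdy (bar_map f s) \<in> ?R k"
        by (simp add: bar_map_diff fr bdy_bar_map)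
      moreover have "\<forall>vs\<in>supp (bar_map f s). length vs = Suc (Suc m)"
        using s(1) keys_bar_map [of f s] by auto
      moreover have "bar_map f s \<in> ?R (Suc k)"
        using keys_bar_map [of f s]
        by (intro degenerateI exI [of _ k]) (auto simp: constant_coord_def f_def)
      ultimately show ?thesis by blast
    qed
    then obtain s where s: "\<And>a vs. vs \<in> supp (s a) \<Longrightarrow> length vs = Suc (Suc m)"
      "\<And>a. s a \<in> ?R (Suc k)" "\<And>a. sel (fib a) r - bdy (s a) \<in> ?R k"
      by metis
    define s' where "s' = sum s I"
    have s': "s' \<in> ?R (Suc k)"
      unfolding s'_def by (rule add_subgroup_sum [OF R]) (rule s)
    have "bdy (z - s') = r' + (\<Sum>a\<in>I. sel (fib a) r - bdy (s a))"
      unfolding s'_def bdy_diff bdy_sum rr' by (subst r_sum) (simp add: sum_subtractf)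
    then have bz: "bdy (z - s') \<in> ?R k"
      using s(3) r' by (simp add: add_subgroup_add [OF R] add_subgroup_sum [OF R])
    \<comment> \<open>Coordinate \<open>k\<close> is collapsed to an arbitrary point. The prism for
      this map does not touch the first \<open>k\<close> coordinates, so it keeps the boundary term
      degenerate.\<close>
    define f where "f = (\<lambda>v :: nat \<Rightarrow> 'v. v(k := undefined))"
    have 1: "prism f (bdy (z - s')) \<in> ?R (Suc k)"
      by (rule degenerate_mono [OF prism_degenerate [OF bz]]) (auto simp: f_def)
    have 2: "bar_map f (z - s') \<in> ?R (Suc k)"
      using keys_bar_map [of f "z - s'"]
      by (intro degenerateI exI [of _ k]) (auto simp: constant_coord_def f_def)
    have "z - bdy (- prism f (z - s')) = s' + bar_map f (z - s') - prism f (bdy (z - s'))"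
      using prism_homotopy [of f "z - s'"] by (simp add: bdy_uminus algebra_simps)
    then have "z - bdy (- prism f (z - s')) \<in> ?R (Suc k)"
      using 1 2 s' add_subgroup_add [OF R] add_subgroup_diff [OF R] by metis
    moreover have "length vs = Suc (Suc n)" if vs: "vs \<in> supp (- prism f (z - s'))" for vs
    proof -
      obtain ws where ws: "ws \<in> supp (z - s')" "length vs = Suc (length ws)"
        using vs by (auto elim: keys_prism)
      have "supp s' \<subseteq> (\<Union>a\<in>I. supp (s a))"
        unfolding s'_def by (rule keys_sum)
      then have "length ws = Suc n"
        using ws(1) keys_diff [of z s'] s(1) Suc.prems(1) \<open>n = Suc m\<close> by blast
      then show ?thesis using ws by simp
    qed
    ultimately show ?thesis by blast
  qed
qed simp

section \<open>Natural operators given by chains on standard simplices\<close>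

definition vertex :: "'v list \<Rightarrow> nat \<Rightarrow> 'v" where
  "vertex u i = u ! min i (length u - 1)"

lemma vertex_index: "u \<noteq> [] \<Longrightarrow> min i (length u - 1) < length u"
  by (cases u) auto

lemma vertex_map: "u \<noteq> [] \<Longrightarrow> vertex (map f u) i = f (vertex u i)"
  using nth_map [OF vertex_index] by (simp add: vertex_def)

lemma vertex_in_set: "u \<noteq> [] \<Longrightarrow> vertex u i \<in> set u"
  using nth_mem [OF vertex_index] by (simp add: vertex_def)

lemma map_vertex_upt: "map (vertex u) [0..<length u] = u"
  by (rule nth_equalityI) (auto simp: vertex_def min_def intro!: arg_cong [of _ _ "(!) u"])

text \<open>
  A sequence of chains on \<open>\<nat>\<^sup>k\<close> induces an operator that is natural in the simplex \<open>u\<close>. Indices beyond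
  the end of \<open>u\<close> refer to its last vertex, so that no bound on the entries is needed.
\<close>

definition transport :: "(nat \<Rightarrow> (nat \<Rightarrow> nat) chain) \<Rightarrow> 'v list \<Rightarrow> (nat \<Rightarrow> 'v) chain" where
  "transport H u = (if u = [] then 0 else bar_map (\<lambda>v j. vertex u (v j)) (H (length u - 1)))"

definition diagonal :: "'v list \<Rightarrow> (nat \<Rightarrow> 'v) list" where
  "diagonal u = map (\<lambda>x j. x) u"

text \<open>The failure of \<open>transport H\<close> to be a null-homotopy of the diagonal.\<close>

definition contraction_defect :: "(nat \<Rightarrow> (nat \<Rightarrow> nat) chain) \<Rightarrow> 'v list \<Rightarrow> (nat \<Rightarrow> 'v) chain" where
  "contraction_defect H u =
     bdy (transport H u) + frag_extend (transport H) (face_sum u) - frag_of (diagonal u)"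

lemma transport_map: "transport H (map f u) = bar_map (\<lambda>v j. f (v j)) (transport H u)"
  by (simp add: transport_def bar_map_bar_map vertex_map)

lemma frag_extend_transport_map:
  "frag_extend (transport H) (bar_map f c) = bar_map (\<lambda>v j. f (v j)) (frag_extend (transport H) c)"
  by (induction c rule: frag_induct) (auto simp: transport_map frag_extend_diff bar_map_diff)

lemma contraction_defect_map:
  "contraction_defect H (map f u) = bar_map (\<lambda>v j. f (v j)) (contraction_defect H u)"
proof -
  have "frag_extend (transport H) (face_sum (map f u)) =
      bar_map (\<lambda>v j. f (v j)) (frag_extend (transport H) (face_sum u))"
    by (metis bar_map_face_sum frag_extend_transport_map)
  then show ?thesis
    by (simp add: contraction_defect_def transport_map bdy_bar_map bar_map_add bar_map_diff diagonal_def comp_def)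
qed

text \<open>Every simplex is the image of a standard simplex under its vertex map, and this map acts
  on each coordinate separately, so it preserves degenerate chains.\<close>

lemma contraction_defect_transfer:
  assumes "contraction_defect H [0..<Suc m] \<in> degenerate k" "length u = Suc m"
  shows "contraction_defect H u \<in> degenerate k"
proof -
  have "contraction_defect H u = bar_map (\<lambda>v j. vertex u (v j)) (contraction_defect H [0..<Suc m])"
    using contraction_defect_map [of H "vertex u" "[0..<Suc m]"] map_vertex_upt [of u] assms(2) by simp
  then show ?thesis
    using bar_map_degenerate [OF assms(1), of "\<lambda>v j. vertex u (v j)"] by simp
qed

text \<open>Acyclic models: the values on standard simplices are chosen in increasing dimension. The
  obstruction in dimension \<open>M\<close> is a cycle modulo \<open>degenerate k\<close> and can be
  filled as long as \<open>M < k\<close>.\<close>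

lemma universal_contraction_aux:
  assumes "M \<le> k"
  shows "\<exists>H. \<forall>m<M. (\<forall>vs\<in>supp (H m). length vs = Suc (Suc m)) \<and>
           contraction_defect H [0..<Suc m] \<in> degenerate k"
  using assms
proof (induction M)
  case (Suc M)
  note R = add_subgroup_degenerate
  obtain H where H: "\<And>m vs. m < M \<Longrightarrow> vs \<in> supp (H m) \<Longrightarrow> length vs = Suc (Suc m)"
    "\<And>m. m < M \<Longrightarrow> contraction_defect H [0..<Suc m] \<in> degenerate k"
    using Suc by auto
  define e where "e = [0..<Suc M]"
  define q where "q = frag_extend (transport H) (face_sum e)"
  define z where "z = frag_of (diagonal e) - q"
  have len_e: "length e = Suc M" by (simp add: e_def)
  have keys_q: "length vs = Suc M" if "vs \<in> supp q" for vs
  proof -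
    obtain u where u: "u \<in> supp (face_sum e)" "vs \<in> supp (transport H u)"
      using \<open>vs \<in> supp q\<close> keys_frag_extend [of "transport H" "face_sum e"] by (auto simp: q_def)
    have "length u = M" "u \<noteq> []"
      using keys_face_sum [OF u(1)] u(2) len_e by (auto simp: transport_def)
    then show ?thesis
      using u(2) keys_bar_map [of _ "H (M - 1)"] H(1) [of "M - 1"]
      by (fastforce simp: transport_def)
  qed
  have keys_z: "length vs = Suc M" if "vs \<in> supp z" for vs
    using that keys_diff [of "frag_of (diagonal e)" q] keys_q by (auto simp: z_def diagonal_def len_e)
  have "bdy z \<in> degenerate k"
  proof (cases M)
    case 0
    then have "vs = []" if "vs \<in> supp (bdy z)" for vs
      using that keys_z by (metis Suc_inject keys_bdy length_0_conv)
    moreover have "\<exists>j<k. constant_coord j ([] :: (nat \<Rightarrow> nat) list)"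
      using Suc.prems by (intro exI [of _ 0]) (auto simp: constant_coord_def)
    ultimately show ?thesis
      by (intro degenerateI) metis
  next
    case (Suc m)
    have defect: "contraction_defect H u \<in> degenerate k" if "u \<in> supp (face_sum e)" for u
    proof (rule contraction_defect_transfer)
      show "contraction_defect H [0..<Suc m] \<in> degenerate k"
        using H(2) [of m] Suc by simp
      show "length u = Suc m"
        using keys_face_sum [OF that] len_e Suc by simp
    qed
    \<comment> \<open>The defects of the faces of \<open>e\<close> are summed; the terms with a
      double boundary of \<open>e\<close> drop out, which leaves a statement about
      \<open>bdy q\<close>.\<close>
    have "frag_extend (contraction_defect H) (face_sum e) \<in> degenerate k"
      by (rule frag_extend_in_add_subgroup [OF R defect])
    moreover have "frag_extend (contraction_defect H) c =
        bdy (frag_extend (transport H) c) + frag_extend (transport H) (bdy c) - bar_map (\<lambda>x j. x) c" for c :: "nat chain"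
      by (induction c rule: frag_induct)
        (auto simp: contraction_defect_def frag_extend_diff bdy_diff bar_map_diff diagonal_def)
    ultimately have "bdy q - bar_map (\<lambda>x j. x) (face_sum e) \<in> degenerate k"
      by (simp add: q_def bdy_face_sum)
    then show ?thesis
      using add_subgroup_uminus [OF R] unfolding z_def bdy_diff
      by (fastforce simp: diagonal_def bar_map_face_sum)
  qed
  then obtain w where w: "\<forall>vs\<in>supp w. length vs = Suc (Suc M)" "z - bdy w \<in> degenerate k"
    using degenerate_acyclic [of z M k] keys_z Suc.prems by auto
  define H' where "H' = H(M := w)"
  have old: "transport H' u = transport H u" if "length u \<le> M" for u :: "nat list"
    using that by (cases u) (auto simp: transport_def H'_def)
  have old_ext: "frag_extend (transport H') (face_sum u) = frag_extend (transport H) (face_sum u)"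
    if "length u \<le> Suc M" for u :: "nat list"
    by (rule frag_extend_eq) (use that keys_face_sum old in fastforce)
  have old_defect: "contraction_defect H' [0..<Suc m] = contraction_defect H [0..<Suc m]" if "m < M" for m
    using that old [of "[0..<Suc m]"] old_ext [of "[0..<Suc m]"] by (simp add: contraction_defect_def)
  have "contraction_defect H' e \<in> degenerate k"
  proof -
    \<comment> \<open>Entries of \<open>w\<close> may exceed \<open>M\<close>, and
      \<open>transport\<close> clamps them. The clamping map fixes \<open>e\<close>, hence
      \<open>z\<close>, so it may be applied to the relation between \<open>z\<close> and
      \<open>w\<close>.\<close>
    have self: "map (vertex e) e = e"
      using map_vertex_upt [of e] by (simp add: e_def)
    have "bar_map (\<lambda>v j. vertex e (v j)) q = q"
      unfolding q_def by (simp add: frag_extend_transport_map [symmetric] bar_map_face_sum self)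
    moreover have "map (\<lambda>v j. vertex e (v j)) (diagonal e) = diagonal e"
      by (subst (3) self [symmetric]) (simp add: diagonal_def comp_def)
    ultimately have z: "bar_map (\<lambda>v j. vertex e (v j)) z = z"
      by (simp add: z_def bar_map_diff)
    have "transport H' e = bar_map (\<lambda>v j. vertex e (v j)) w"
      using len_e by (auto simp: transport_def H'_def)
    then have "contraction_defect H' e = - bar_map (\<lambda>v j. vertex e (v j)) (z - bdy w)"
      unfolding contraction_defect_def bar_map_diff z
      by (simp add: z_def q_def old_ext len_e bdy_bar_map)
    then show ?thesis
      using bar_map_degenerate [OF w(2), of "\<lambda>v j. vertex e (v j)"] add_subgroup_uminus [OF R] by simp
  qed
  moreover have "\<forall>m<Suc M. \<forall>vs\<in>supp (H' m). length vs = Suc (Suc m)"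
    using w(1) H(1) by (auto simp: H'_def less_Suc_eq)
  ultimately show ?case
    using H(2) old_defect unfolding e_def by (metis less_Suc_eq)
qed simp

lemma universal_contraction:
  fixes k :: nat
  obtains H where "\<And>m vs. m < k \<Longrightarrow> vs \<in> supp (H m) \<Longrightarrow> length vs = Suc (Suc m)"
    and "\<And>u :: 'v list. u \<noteq> [] \<Longrightarrow> length u \<le> k \<Longrightarrow> contraction_defect H u \<in> degenerate k"
proof -
  obtain H where H: "\<forall>m<k. (\<forall>vs\<in>supp (H m). length vs = Suc (Suc m)) \<and>
      contraction_defect H [0..<Suc m] \<in> degenerate k"
    using universal_contraction_aux [of k k] by auto
  show thesis
  proof
    show "length vs = Suc (Suc m)" if "m < k" "vs \<in> supp (H m)" for m vs
      using H that by blast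
    show "contraction_defect H u \<in> degenerate k" if "u \<noteq> []" "length u \<le> k" for u :: "'v list"
    proof -
      obtain m where "length u = Suc m"
        using \<open>u \<noteq> []\<close> by (cases u) auto
      moreover from this have "contraction_defect H [0..<Suc m] \<in> degenerate k"
        using H that(2) Suc_le_lessD by metis
      ultimately show ?thesis
        by (metis contraction_defect_transfer)
    qed
  qed
qed

section \<open>Homology of abelian groups as a polynomial functor\<close>

lemma bar_boundary_0 [simp]: "bar_boundary n G 0 = 0"
  and bar_boundary_diff: "bar_boundary n G (a - b) = bar_boundary n G a - bar_boundary n G b"
  and bar_boundary_add: "bar_boundary n G (a + b) = bar_boundary n G a + bar_boundary n G b"
  and bar_boundary_cmul: "bar_boundary n G (frag_cmul k a) = frag_cmul k (bar_boundary n G a)"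
  by (auto simp: bar_boundary_def frag_extend_diff frag_extend_add frag_extend_cmul)

lemma bar_boundary_sum: "bar_boundary n G (sum f I) = (\<Sum>i\<in>I. bar_boundary n G (f i))"
  by (induction I rule: infinite_finite_induct) (auto simp: bar_boundary_add)

lemma add_subgroup_bar_chains: "add_subgroup (carrier (bar_chains n G))"
  using add_subgroup_keys unfolding bar_chains_def free_Abelian_group_def by auto

text \<open>Passage from homogeneous to inhomogeneous bar symbols: a simplex of group elements
  modulo left translation is recorded by its successive quotients. \<open>vertices\<close> is the
  section whose simplices start at the unit.\<close>

fun edges :: "'a monoid \<Rightarrow> 'a list \<Rightarrow> 'a list" where
  "edges G (x # y # xs) = (inv\<^bsub>G\<^esub> x \<otimes>\<^bsub>G\<^esub> y) # edges G (y # xs)"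
| "edges G xs = []"

fun vertices :: "'a monoid \<Rightarrow> 'a list \<Rightarrow> 'a list" where
  "vertices G [] = [\<one>\<^bsub>G\<^esub>]"
| "vertices G (g # gs) = \<one>\<^bsub>G\<^esub> # map (\<lambda>x. g \<otimes>\<^bsub>G\<^esub> x) (vertices G gs)"

lemma length_edges [simp]: "length (edges G xs) = length xs - 1"
  by (induction G xs rule: edges.induct) auto

lemma length_vertices [simp]: "length (vertices G gs) = Suc (length gs)"
  by (induction gs) auto

lemma vertices_not_Nil [simp]: "vertices G gs \<noteq> []"
  by (cases gs) auto

text \<open>The bar complex is only defined for monoid records without further fields.\<close>

locale bar_group = group G for G :: "'a monoid" (structure)

locale bar_comm_group = comm_group G for G :: "'a monoid" (structure)

sublocale bar_comm_group \<subseteq> bar_group ..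

context bar_group
begin

lemma set_edges: "set xs \<subseteq> carrier G \<Longrightarrow> set (edges G xs) \<subseteq> carrier G"
  by (induction xs rule: induct_list012) auto

lemma set_vertices: "set gs \<subseteq> carrier G \<Longrightarrow> set (vertices G gs) \<subseteq> carrier G"
  by (induction gs) auto

lemma edges_translate:
  "a \<in> carrier G \<Longrightarrow> set xs \<subseteq> carrier G \<Longrightarrow> edges G (map (\<lambda>x. a \<otimes> x) xs) = edges G xs"
  by (induction xs rule: induct_list012) (auto simp: inv_mult_group m_assoc, simp add: m_assoc [symmetric])

lemma edges_vertices: "set gs \<subseteq> carrier G \<Longrightarrow> edges G (vertices G gs) = gs"
proof (induction gs)
  case (Cons g gs)
  obtain ys where ys: "vertices G gs = \<one> # ys" by (cases gs) auto
  then have "set ys \<subseteq> carrier G" using set_vertices [of gs] Cons.prems by auto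
  moreover have "edges G (vertices G (g # gs)) = g # edges G (map (\<lambda>x. g \<otimes> x) (vertices G gs))"
    using Cons.prems by (simp add: ys)
  ultimately show ?case
    using Cons edges_translate [of g "vertices G gs"] ys by auto
qed simp

lemma vertices_edges:
  "xs \<noteq> [] \<Longrightarrow> set xs \<subseteq> carrier G \<Longrightarrow> map (\<lambda>x. hd xs \<otimes> x) (vertices G (edges G xs)) = xs"
proof (induction xs rule: induct_list012)
  case (3 x y zs)
  have "map (\<lambda>v. x \<otimes> (inv x \<otimes> y \<otimes> v)) (vertices G (edges G (y # zs))) =
      map (\<lambda>v. y \<otimes> v) (vertices G (edges G (y # zs)))"
    using 3 set_vertices set_edges [of "y # zs"]
    by (intro map_cong) (auto simp: m_assoc [symmetric] subset_iff)
  also have "\<dots> = y # zs"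
    using 3 by simp
  finally show ?case using 3 by (simp add: comp_def)
qed auto

end

lemma face_sum_eq:
  "face_sum xs = (\<Sum>i<length xs. frag_cmul ((-1) ^ i) (frag_of (take i xs @ drop (Suc i) xs)))"
proof (induction xs)
  case (Cons x xs)
  have "cone x (sum f I) = (\<Sum>i\<in>I. cone x (f i))" for f and I :: "nat set"
    by (induction I rule: infinite_finite_induct) (auto simp: cone_add)
  moreover have "cone x (frag_cmul k c) = frag_cmul k (cone x c)" for k c
    by (simp add: cone_def frag_extend_cmul)
  ultimately show ?case
    by (simp add: Cons sum.lessThan_Suc_shift sum_negf [symmetric] del: sum.lessThan_Suc)
qed simp

lemma bar_face_Cons:
  "0 < j \<Longrightarrow> j \<le> length es \<Longrightarrow> bar_face G (Suc j) (e # es) = e # bar_face G j es"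
  by (cases j) (auto simp: bar_face_def)

text \<open>Omitting an inner vertex multiplies the two edges meeting there; omitting an end vertex
  drops the edge at that end.\<close>

lemma (in bar_group) bar_face_edges:
  "set xs \<subseteq> carrier G \<Longrightarrow> i < length xs \<Longrightarrow> 2 \<le> length xs \<Longrightarrow>
   bar_face G i (edges G xs) = edges G (take i xs @ drop (Suc i) xs)"
proof (induction xs arbitrary: i rule: induct_list012)
  case (3 x y zs)
  consider "i = 0" | "i = 1" "zs = []" | z zs' where "i = 1" "zs = z # zs'" | j where "i = Suc (Suc j)"
    by (metis One_nat_def neq_Nil_conv not0_implies_Suc)
  then show ?case
  proof cases
    case 3
    then show ?thesis
      using \<open>set (x # y # zs) \<subseteq> carrier G\<close>
      by (auto simp: bar_face_def m_assoc inv_solve_left' [symmetric]) (metis inv_closed l_one m_assoc m_closed r_inv)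
  next
    case 4
    with 3 have "zs \<noteq> []" by auto
    with 3 4 have "bar_face G (Suc j) (edges G (y # zs)) = edges G (take (Suc j) (y # zs) @ drop (Suc (Suc j)) (y # zs))"
      by (cases zs) auto
    with 3 4 show ?thesis
      by (simp add: bar_face_Cons)
  qed (auto simp: bar_face_def)
qed auto

text \<open>Degree 0 is a genuine exception: the simplicial boundary is augmented, while
  \<open>bar_boundary 0\<close> is zero.\<close>

lemma (in bar_group) bar_boundary_edges:
  assumes "set xs \<subseteq> carrier G" "length xs = Suc n" "n \<noteq> 0"
  shows "bar_boundary n G (frag_of (edges G xs)) = frag_extend (\<lambda>xs. frag_of (edges G xs)) (face_sum xs)"
proof -
  have "bar_boundary n G (frag_of (edges G xs)) =
      (\<Sum>i<length xs. frag_cmul ((-1) ^ i) (frag_of (edges G (take i xs @ drop (Suc i) xs))))"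
    using assms by (simp add: bar_boundary_def bar_face_edges lessThan_Suc_atMost)
  then show ?thesis
    by (simp add: face_sum_eq frag_extend_sum frag_extend_cmul comp_def)
qed

section \<open>Alternating sums over subsets and cross effects\<close>

lemma sum_Pow_insert:
  assumes "finite A" "a \<notin> A"
  shows "sum F (Pow (insert a A)) = (\<Sum>T\<in>Pow A. F T + F (insert a T))"
proof -
  have "inj_on (insert a) (Pow A)"
    using assms(2) by (auto simp: inj_on_def)
  moreover have "Pow A \<inter> insert a ` Pow A = {}"
    using assms(2) by auto
  ultimately show ?thesis
    using assms(1) by (simp add: Pow_insert sum.union_disjoint sum.reindex sum.distrib)
qed

abbreviation alternating :: "(nat set \<Rightarrow> 'b \<Rightarrow>\<^sub>0 int) \<Rightarrow> nat set \<Rightarrow> 'b \<Rightarrow>\<^sub>0 int" where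
  "alternating F A \<equiv> \<Sum>T\<in>Pow A. frag_cmul ((-1) ^ card T) (F T)"

lemma alternating_insert:
  assumes "finite A" "a \<notin> A"
  shows "alternating F (insert a A) = alternating (\<lambda>T. F T - F (insert a T)) A"
proof -
  have "card (insert a T) = Suc (card T)" if "T \<in> Pow A" for T
    using that assms finite_subset by (metis PowD card_insert_disjoint subsetD)
  then show ?thesis
    unfolding sum_Pow_insert [OF assms]
    by (intro sum.cong) (auto simp: frag_cmul_diff simp flip: minus_frag_cmul)
qed

text \<open>Subsets with and without \<open>a\<close> cancel in pairs.\<close>

lemma alternating_eq_0:
  assumes "finite A" "a \<in> A" "\<And>T. F (insert a T) = F T"
  shows "alternating F A = 0"
proof -
  have "alternating F (insert a (A - {a})) = 0"
    by (subst alternating_insert) (use assms in auto)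
  then show ?thesis
    using assms(2) by (simp add: insert_absorb)
qed

text \<open>
  The alternating sum over \<open>T\<close> below cancels all simplices with a constant coordinate \<open>j < k\<close>, because
  inserting \<open>j\<close> into \<open>T\<close> translates their image. The coordinate \<open>k\<close> is not crossed; it moves the base
  point of the resulting finite difference to \<open>x\<close>.
\<close>

definition weighted :: "'a monoid \<Rightarrow> nat \<Rightarrow> nat \<Rightarrow> nat set \<Rightarrow> (nat \<Rightarrow> 'a) \<Rightarrow> 'a" where
  "weighted G k x T v = finprod G v T \<otimes>\<^bsub>G\<^esub> v k [^]\<^bsub>G\<^esub> x"

definition cross_effect :: "'a monoid \<Rightarrow> nat \<Rightarrow> nat \<Rightarrow> (nat \<Rightarrow> 'a) chain \<Rightarrow> 'a chain" where
  "cross_effect G k x =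
     frag_extend (\<lambda>vs. alternating (\<lambda>T. frag_of (edges G (map (weighted G k x T) vs))) {..<k})"

definition carrier_simplices :: "'a monoid \<Rightarrow> (nat \<Rightarrow> 'a) list set" where
  "carrier_simplices G = {vs. \<forall>v\<in>set vs. \<forall>j. v j \<in> carrier G}"

lemma cross_effect_0 [simp]: "cross_effect G k x 0 = 0"
  and cross_effect_diff: "cross_effect G k x (a - b) = cross_effect G k x a - cross_effect G k x b"
  and cross_effect_add: "cross_effect G k x (a + b) = cross_effect G k x a + cross_effect G k x b"
  by (simp_all add: cross_effect_def frag_extend_diff frag_extend_add)

context bar_comm_group
begin

lemma weighted_closed: "(\<And>j. v j \<in> carrier G) \<Longrightarrow> weighted G k x T v \<in> carrier G"
  by (simp add: weighted_def)

lemma cross_effect_degenerate: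
  assumes "c \<in> degenerate k" "supp c \<subseteq> carrier_simplices G"
  shows "cross_effect G k x c = 0"
  unfolding cross_effect_def
proof (rule frag_extend_eq_0)
  fix vs assume key: "vs \<in> supp c"
  then have vs: "vs \<in> carrier_simplices G"
    using assms(2) by blast
  obtain j where j: "j < k" "constant_coord j vs"
    using degenerateE [OF assms(1) key] .
  from j(2) obtain a where a: "\<forall>v\<in>set vs. v j = a"
    unfolding constant_coord_def by (rule exE)
  have "edges G (map (weighted G k x (insert j T)) vs) = edges G (map (weighted G k x T) vs)" for T
  \<comment> \<open>\<open>alternating_eq_0\<close> asks for all sets \<open>T\<close>. For infinite
    \<open>T\<close> both products have the default value, so inserting \<open>j\<close> changes
    nothing.\<close>
  proof (cases "finite T \<and> j \<notin> T \<and> vs \<noteq> []")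
    case True
    then have "hd vs \<in> set vs" by simp
    then have "hd vs j = a" "hd vs j \<in> carrier G"
      using a vs by (auto simp: carrier_simplices_def)
    then have aG: "a \<in> carrier G" by simp
    have "map (weighted G k x (insert j T)) vs = map (\<lambda>v. a \<otimes> v) (map (weighted G k x T) vs)"
      using True vs a aG unfolding map_map
      by (intro map_cong) (auto simp: weighted_def carrier_simplices_def m_assoc)
    moreover have "set (map (weighted G k x T) vs) \<subseteq> carrier G"
      using vs by (auto simp: carrier_simplices_def intro: weighted_closed)
    ultimately show ?thesis
      using edges_translate [OF aG] by metis
  next
    case False
    then show ?thesis
      by (auto simp: weighted_def [abs_def] insert_absorb finprod_infinite)
  qed
  then show "alternating (\<lambda>T. frag_of (edges G (map (weighted G k x T) vs))) {..<k} = 0"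
    using j by (intro alternating_eq_0 [of _ j]) auto
qed

text \<open>The maps \<open>weighted\<close> are applied vertex by vertex and so commute with faces;
  \<open>edges\<close> turns the simplicial boundary into that of the bar complex.\<close>

lemma bar_boundary_cross_effect:
  assumes "\<And>vs. vs \<in> supp c \<Longrightarrow> length vs = Suc n"
    and "supp c \<subseteq> carrier_simplices G" "n \<noteq> 0"
  shows "bar_boundary n G (cross_effect G k x c) = cross_effect G k x (bdy c)"
proof -
  have one: "bar_boundary n G (cross_effect G k x (frag_of vs)) = cross_effect G k x (bdy (frag_of vs))"
    if vs: "vs \<in> supp c" for vs
  proof -
    define E where "E = (\<lambda>T vs. frag_of (edges G (map (weighted G k x T) vs)))"
    have "bar_boundary n G (E T vs) = frag_extend (E T) (face_sum vs)" for T
    proof -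
      have "bar_boundary n G (E T vs) =
          frag_extend (\<lambda>xs. frag_of (edges G xs)) (face_sum (map (weighted G k x T) vs))"
        unfolding E_def using vs assms
        by (intro bar_boundary_edges) (auto simp: carrier_simplices_def intro!: weighted_closed)
      then show ?thesis
        by (simp add: bar_map_face_sum [symmetric] bar_map_def frag_extend_frag_extend E_def)
    qed
    moreover have "alternating (\<lambda>T. frag_extend (E T) d) A = frag_extend (\<lambda>vs. alternating (\<lambda>T. E T vs) A) d" for A d
      by (induction d rule: frag_induct)
        (auto simp: frag_extend_diff frag_cmul_diff sum_subtractf)
    ultimately show ?thesis
      by (simp add: cross_effect_def bar_boundary_sum bar_boundary_cmul E_def)
  qed
  show ?thesis
    by (induction c rule: frag_induct)
      (auto simp: one [simplified] cross_effect_diff bdy_diff bar_boundary_diff)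
qed

lemma edges_pow:
  "set xs \<subseteq> carrier G \<Longrightarrow> edges G (map (\<lambda>a. a [^] (r::nat)) xs) = map (\<lambda>a. a [^] r) (edges G xs)"
  by (induction xs rule: induct_list012) (auto simp: nat_pow_inv nat_pow_distrib)

text \<open>On the diagonal all coordinates agree, so the product over \<open>T\<close> and the
  extra coordinate combine into one power.\<close>

lemma cross_effect_diagonal:
  assumes "set u \<subseteq> carrier G"
  shows "cross_effect G k x (frag_of (diagonal u)) =
    alternating (\<lambda>T. frag_of (map (\<lambda>a. a [^] (card T + x)) (edges G u))) {..<k}"
proof -
  have "map (weighted G k x T) (diagonal u) = map (\<lambda>a. a [^] (card T + x)) u" for T
    using assms by (auto simp: diagonal_def weighted_def finprod_const nat_pow_mult)
  then show ?thesis
    by (simp add: cross_effect_def edges_pow assms)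
qed

lemma transport_carrier:
  assumes "set u \<subseteq> carrier G"
  shows "supp (transport H u) \<subseteq> carrier_simplices G"
proof (cases "u = []")
  case False
  then have "vertex u i \<in> carrier G" for i
    using vertex_in_set assms by blast
  then have "map (\<lambda>v j. vertex u (v j)) vs \<in> carrier_simplices G" for vs
    by (auto simp: carrier_simplices_def)
  then show ?thesis
    using False keys_bar_map [of "\<lambda>v j. vertex u (v j)" "H (length u - 1)"]
    by (auto simp: transport_def)
qed (simp add: transport_def)

text \<open>Needed because a face of \<open>vertices G gs\<close> need not start at the unit. Since
  \<open>weighted\<close> is multiplicative, a translation of all coordinates becomes a translation
  in \<open>G\<close>, which \<open>edges\<close> forgets.\<close>

lemma cross_effect_translate:
  assumes "a \<in> carrier G" "supp c \<subseteq> carrier_simplices G"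
  shows "cross_effect G k x (bar_map (\<lambda>v j. a \<otimes> v j) c) = cross_effect G k x c"
proof -
  have "edges G (map (weighted G k x T) (map (\<lambda>v j. a \<otimes> v j) vs)) = edges G (map (weighted G k x T) vs)"
    if vs: "vs \<in> carrier_simplices G" for T vs
  proof -
    define b where "b = weighted G k x T (\<lambda>j. a)"
    have "b \<in> carrier G"
      using assms(1) by (simp add: b_def weighted_closed)
    moreover have "weighted G k x T (\<lambda>j. a \<otimes> v j) = b \<otimes> weighted G k x T v" if "v \<in> set vs" for v
      using that vs assms(1)
      by (simp add: b_def weighted_def carrier_simplices_def finprod_multf nat_pow_distrib m_ac)
    then have "map (weighted G k x T) (map (\<lambda>v j. a \<otimes> v j) vs) = map (\<lambda>y. b \<otimes> y) (map (weighted G k x T) vs)"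
      by simp
    moreover have "set (map (weighted G k x T) vs) \<subseteq> carrier G"
      using vs by (auto simp: carrier_simplices_def intro: weighted_closed)
    ultimately show ?thesis
      using edges_translate by metis
  qed
  then show ?thesis
    using assms(2) unfolding cross_effect_def bar_map_def frag_extend_frag_extend
    by (intro frag_extend_eq) (auto simp del: map_map)
qed

text \<open>The map \<open>h\<close>, \<open>transport\<close> followed by the cross effect, is a
  null-homotopy of the alternating sum of power maps, because the cross effect annihilates the
  contraction defect. On a cycle only its boundary term survives. With \<open>Suc n\<close>
  coordinates the contraction reaches dimension \<open>n\<close>.\<close>

theorem cross_effect_boundary:
  assumes c: "c \<in> carrier (bar_cycles n G)" and n: "n \<noteq> 0"
  shows "alternating (\<lambda>T. bar_map (\<lambda>a. a [^] (card T + x)) c) {..<Suc n} \<in> bar_boundaries n G"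
proof -
  obtain H where H: "\<And>m vs. m < Suc n \<Longrightarrow> vs \<in> supp (H m) \<Longrightarrow> length vs = Suc (Suc m)"
    and defect: "\<And>u :: 'a list. u \<noteq> [] \<Longrightarrow> length u \<le> Suc n \<Longrightarrow> contraction_defect H u \<in> degenerate (Suc n)"
    using universal_contraction by blast
  define X where "X = cross_effect G (Suc n) x"
  define h where "h = (\<lambda>gs. X (transport H (vertices G gs)))"
  have h_edges: "h (edges G u) = X (transport H u)" if u: "u \<noteq> []" "set u \<subseteq> carrier G" for u
  proof -
    have hd: "hd u \<in> carrier G" using u by auto
    have "transport H u = transport H (map (\<lambda>y. hd u \<otimes> y) (vertices G (edges G u)))"
      using vertices_edges [OF u] by simp
    also have "X \<dots> = h (edges G u)"
      unfolding transport_map X_def h_def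
      by (rule cross_effect_translate [OF hd transport_carrier]) (intro set_vertices set_edges u)
    finally show ?thesis by simp
  qed
  have simplex: "bar_boundary (Suc n) G (h gs) + frag_extend h (bar_boundary n G (frag_of gs)) =
      alternating (\<lambda>T. frag_of (map (\<lambda>a. a [^] (card T + x)) gs)) {..<Suc n} \<and>
      h gs \<in> carrier (bar_chains (Suc n) G)"
    if gs: "set gs \<subseteq> carrier G" "length gs = n" for gs
  proof -
    define u where "u = vertices G gs"
    have u: "set u \<subseteq> carrier G" "length u = Suc n" "u \<noteq> []" "edges G u = gs"
      using gs by (auto simp: u_def set_vertices edges_vertices dest!: subsetD [OF set_vertices])
    have len: "length vs = Suc (Suc n)" if "vs \<in> supp (transport H u)" for vs
      using that keys_bar_map [of "\<lambda>v j. vertex u (v j)" "H n"] H [of n] u(2,3)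
      by (auto simp: transport_def)
    have b1: "bar_boundary (Suc n) G (h gs) = X (bdy (transport H u))"
      unfolding h_def X_def u_def [symmetric]
      by (rule bar_boundary_cross_effect [OF len transport_carrier [OF u(1)]]) auto
    have b2: "frag_extend h (bar_boundary n G (frag_of gs)) = X (frag_extend (transport H) (face_sum u))"
    proof -
      have "bar_boundary n G (frag_of gs) = frag_extend (\<lambda>xs. frag_of (edges G xs)) (face_sum u)"
        using bar_boundary_edges [OF u(1,2) n] by (simp add: u)
      then have "frag_extend h (bar_boundary n G (frag_of gs)) = frag_extend (\<lambda>xs. h (edges G xs)) (face_sum u)"
        by (simp add: frag_extend_frag_extend)
      also have "\<dots> = frag_extend (\<lambda>xs. X (transport H xs)) (face_sum u)"
      proof (rule frag_extend_eq)
        fix xs assume "xs \<in> supp (face_sum u)"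
        then have "set xs \<subseteq> carrier G" "xs \<noteq> []"
          using keys_face_sum [of xs u] u n by auto
        then show "h (edges G xs) = X (transport H xs)" by (intro h_edges)
      qed
      also have "\<dots> = X (frag_extend (transport H) (face_sum u))"
        by (simp add: X_def cross_effect_def frag_extend_frag_extend)
      finally show ?thesis .
    qed
    have "X (contraction_defect H u) = 0"
      unfolding X_def
    proof (rule cross_effect_degenerate)
      show "contraction_defect H u \<in> degenerate (Suc n)"
        using defect u by simp
      let ?S = "{c :: _ \<Rightarrow>\<^sub>0 int. supp c \<subseteq> carrier_simplices G}"
      have S: "add_subgroup ?S" by (rule add_subgroup_keys)
      have "bdy (transport H u) \<in> ?S"
        using transport_carrier [OF u(1), of H]
        by (auto simp: carrier_simplices_def subset_iff elim!: keys_bdy)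
      moreover have "frag_extend (transport H) (face_sum u) \<in> ?S"
        by (rule frag_extend_in_add_subgroup [OF S])
          (use keys_face_sum u(1) in \<open>blast intro: subsetD [OF transport_carrier]\<close>)
      moreover have "frag_of (diagonal u) \<in> ?S"
        using u(1) by (auto simp: diagonal_def carrier_simplices_def)
      ultimately show "supp (contraction_defect H u) \<subseteq> carrier_simplices G"
        using add_subgroup_diff [OF S add_subgroup_add [OF S]] by (simp add: contraction_defect_def)
    qed
    then have "X (bdy (transport H u)) + X (frag_extend (transport H) (face_sum u)) = X (frag_of (diagonal u))"
      by (simp add: contraction_defect_def X_def cross_effect_diff cross_effect_add)
    then have "bar_boundary (Suc n) G (h gs) + frag_extend h (bar_boundary n G (frag_of gs)) =
        alternating (\<lambda>T. frag_of (map (\<lambda>a. a [^] (card T + x)) gs)) {..<Suc n}"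
      unfolding b1 b2 by (simp add: X_def cross_effect_diagonal u)
    moreover have "h gs \<in> carrier (bar_chains (Suc n) G)"
    proof -
      let ?S = "{c :: _ \<Rightarrow>\<^sub>0 int. supp c \<subseteq> {xs. length xs = Suc n \<and> set xs \<subseteq> carrier G}}"
      have S: "add_subgroup ?S" by (rule add_subgroup_keys)
      have "h gs \<in> ?S"
        unfolding h_def X_def cross_effect_def u_def [symmetric]
      proof (intro frag_extend_in_add_subgroup [OF S] add_subgroup_sum [OF S] add_subgroup_frag_cmul [OF S])
        fix vs T assume vs: "vs \<in> supp (transport H u)"
        then have "vs \<in> carrier_simplices G" using transport_carrier [OF u(1)] by blast
        then have "set (map (weighted G (Suc n) x T) vs) \<subseteq> carrier G"
          by (auto simp: carrier_simplices_def intro: weighted_closed)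
        then show "frag_of (edges G (map (weighted G (Suc n) x T) vs)) \<in> ?S"
          using set_edges len [OF vs] by auto
      qed
      then show ?thesis by (simp add: bar_chains_def)
    qed
    ultimately show ?thesis ..
  qed
  have keys_c: "set gs \<subseteq> carrier G" "length gs = n" if "gs \<in> supp c" for gs
    using c that by (auto simp: bar_cycles_def bar_chains_def)
  have cycle: "bar_boundary n G c = 0"
    using c by (simp add: bar_cycles_def)
  have "bar_boundary (Suc n) G (frag_extend h c) + frag_extend h (bar_boundary n G c) =
      alternating (\<lambda>T. bar_map (\<lambda>a. a [^] (card T + x)) c) {..<Suc n}"
  proof (induction c rule: frag_induct)
    case (one gs)
    then show ?case using simplex keys_c by (simp del: sum.lessThan_Suc)
  next
    case (diff a b)
    have "bar_boundary (Suc n) G (frag_extend h (a - b)) + frag_extend h (bar_boundary n G (a - b)) =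
      (bar_boundary (Suc n) G (frag_extend h a) + frag_extend h (bar_boundary n G a)) -
      (bar_boundary (Suc n) G (frag_extend h b) + frag_extend h (bar_boundary n G b))"
      by (simp add: frag_extend_diff bar_boundary_diff)
    then show ?case
      unfolding diff bar_map_diff
      by (simp only: sum_subtractf frag_cmul_diff)
  qed simp
  moreover have "frag_extend h c \<in> carrier (bar_chains (Suc n) G)"
    using simplex keys_c by (intro frag_extend_in_add_subgroup [OF add_subgroup_bar_chains]) blast
  ultimately show ?thesis
    by (simp add: bar_boundaries_def cycle image_iff) metis
qed

end

section \<open>Finite differences modulo a subgroup\<close>

definition step_diff :: "nat \<Rightarrow> (nat \<Rightarrow> 'b::ab_group_add) \<Rightarrow> nat \<Rightarrow> 'b" where
  "step_diff m f x = f (x + m) - f x"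

lemma step_diff_commute: "step_diff m (step_diff l f) = step_diff l (step_diff m f)"
  by (rule ext) (simp add: step_diff_def add_ac)

lemma step_diff_funpow_commute: "step_diff m ((step_diff l ^^ k) f) = (step_diff l ^^ k) (step_diff m f)"
  by (induction k) (auto simp: step_diff_commute [of m l])

text \<open>Subsets of equal size contribute equally; the resulting binomial coefficients are those
  of an iterated difference.\<close>

lemma alternating_step_diff:
  fixes f :: "nat \<Rightarrow> 'b \<Rightarrow>\<^sub>0 int"
  shows "alternating (\<lambda>T. f (card T + x)) {..<k} = frag_cmul ((-1) ^ k) ((step_diff 1 ^^ k) f x)"
proof (induction k arbitrary: f)
  case (Suc k)
  have card: "card (insert k T) = Suc (card T)" if "T \<in> Pow {..<k}" for T
    using that by (subst card_insert_disjoint) (auto intro: finite_subset)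
  have "alternating (\<lambda>T. f (card T + x)) {..<Suc k} =
      alternating (\<lambda>T. f (card T + x) - f (card (insert k T) + x)) {..<k}"
    unfolding lessThan_Suc by (subst alternating_insert) auto
  also have "\<dots> = alternating (\<lambda>T. - step_diff 1 f (card T + x)) {..<k}"
    by (intro sum.cong) (auto simp: card step_diff_def)
  also have "\<dots> = - alternating (\<lambda>T. step_diff 1 f (card T + x)) {..<k}"
  proof -
    have neg: "frag_cmul i (- b) = - frag_cmul i b" for i and b :: "'b \<Rightarrow>\<^sub>0 int"
      using frag_cmul_diff [of i 0 b] by simp
    show ?thesis by (simp only: neg sum_negf)
  qed
  also have "\<dots> = frag_cmul ((-1) ^ Suc k) ((step_diff 1 ^^ Suc k) f x)"
    by (subst Suc.IH) (simp add: funpow_swap1)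
  finally show ?case .
qed simp

context
  fixes S :: "('b \<Rightarrow>\<^sub>0 int) set"
  assumes S: "add_subgroup S"
begin

lemma step_diff_sum_mem: "(\<And>x. step_diff 1 g x \<in> S) \<Longrightarrow> step_diff m g x \<in> S"
proof (induction m)
  case (Suc m)
  have "step_diff (Suc m) g x = step_diff m g x + step_diff 1 g (x + m)"
    by (simp add: step_diff_def)
  then show ?case
    using Suc add_subgroup_add [OF S] by simp
qed (simp add: step_diff_def add_subgroup_zero [OF S])

text \<open>Vanishing second differences make \<open>g\<close> affine modulo
  \<open>S\<close>.\<close>

lemma step_diff_linear:
  assumes "\<And>x. (step_diff 1 ^^ 2) g x \<in> S"
  shows "step_diff m g x - frag_cmul (int m) (step_diff 1 g x) \<in> S"
proof (induction m)
  case (Suc m)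
  have "step_diff m (step_diff 1 g) x \<in> S"
    by (rule step_diff_sum_mem) (use assms in \<open>simp add: numeral_2_eq_2\<close>)
  moreover have "step_diff (Suc m) g x - frag_cmul (int (Suc m)) (step_diff 1 g x) =
      (step_diff m g x - frag_cmul (int m) (step_diff 1 g x)) + step_diff m (step_diff 1 g) x"
  proof -
    have "step_diff (Suc m) g x = step_diff m g x + step_diff 1 g x + step_diff m (step_diff 1 g) x"
      by (simp add: step_diff_def)
    moreover have "frag_cmul (int (Suc m)) d = frag_cmul (int m) d + d" for d :: "'b \<Rightarrow>\<^sub>0 int"
      using frag_cmul_distrib [of "int m" 1 d] by (simp add: add.commute)
    ultimately show ?thesis by simp
  qed
  ultimately show ?case
    using Suc add_subgroup_add [OF S] by simp
qed (simp add: step_diff_def add_subgroup_zero [OF S])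

text \<open>Modulo \<open>S\<close>, \<open>g\<close> behaves like a polynomial of degree at most
  \<open>e\<close>, whose leading term is multiplied by \<open>m ^ e\<close> when the step is scaled
  by \<open>m\<close>.\<close>

lemma step_diff_power:
  assumes "\<And>x. (step_diff 1 ^^ Suc e) g x \<in> S"
  shows "(step_diff m ^^ e) g x - frag_cmul (int m ^ e) ((step_diff 1 ^^ e) g x) \<in> S"
  using assms
proof (induction e arbitrary: g)
  case (Suc e)
  have "(step_diff 1 ^^ Suc e) (step_diff m g) y \<in> S" for y
    unfolding step_diff_funpow_commute [symmetric]
    by (rule step_diff_sum_mem) (use Suc.prems in simp)
  then have 1: "(step_diff m ^^ e) (step_diff m g) x - frag_cmul (int m ^ e) ((step_diff 1 ^^ e) (step_diff m g) x) \<in> S"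
    by (rule Suc.IH)
  have "step_diff m ((step_diff 1 ^^ e) g) x - frag_cmul (int m) (step_diff 1 ((step_diff 1 ^^ e) g) x) \<in> S"
    by (rule step_diff_linear) (use Suc.prems in \<open>simp add: numeral_2_eq_2\<close>)
  then have "frag_cmul (int m ^ e) (step_diff m ((step_diff 1 ^^ e) g) x - frag_cmul (int m) (step_diff 1 ((step_diff 1 ^^ e) g) x)) \<in> S"
    by (rule add_subgroup_frag_cmul [OF S])
  then have 2: "frag_cmul (int m ^ e) ((step_diff 1 ^^ e) (step_diff m g) x)
      - frag_cmul (int m ^ Suc e) ((step_diff 1 ^^ Suc e) g x) \<in> S"
    by (simp add: frag_cmul_diff step_diff_funpow_commute mult.commute)
  show ?case
    using add_subgroup_add [OF S 1 2] by (simp add: funpow_swap1 del: minus_frag_cmul)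
qed (simp add: add_subgroup_zero [OF S])

text \<open>Differences with step \<open>m\<close> at 0 involve only values at multiples of
  \<open>m\<close>, so \<open>m ^ d\<close> times the \<open>d\<close>-th difference at 0 lies in
  \<open>S\<close>. Multiplication of \<open>f\<close> by \<open>m ^ d\<close> thus lowers the
  degree by one, and the exponents add up.\<close>

lemma polynomial_torsion:
  assumes "\<And>x. (step_diff 1 ^^ Suc d) f x \<in> S" "\<And>j. f (j * m) \<in> S"
  shows "frag_cmul (int m ^ (\<Sum>i\<le>d. i)) (f x) \<in> S"
  using assms
proof (induction d arbitrary: f x)
  case 0
  have "f x = step_diff x f 0 + f (0 * m)"
    by (simp add: step_diff_def)
  then show ?case
    using step_diff_sum_mem [of f x 0] 0 0(2) [of 0] add_subgroup_add [OF S] by simp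
next
  case (Suc d)
  define F where "F = (\<lambda>x. frag_cmul (int m ^ Suc d) (f x))"
  have mult: "(step_diff m ^^ e) f (j * m) \<in> S" for e j
  proof (induction e arbitrary: j)
    case (Suc e)
    then show ?case
      using Suc [of "Suc j"] Suc [of j] add_subgroup_diff [OF S]
      by (simp add: step_diff_def add.commute)
  qed (simp add: Suc.prems)
  have zero: "frag_cmul (int m ^ Suc d) ((step_diff 1 ^^ Suc d) f 0) \<in> S"
    using add_subgroup_diff [OF S mult [of "Suc d" 0] step_diff_power [of "Suc d" f m "0 * m"]] Suc.prems(1)
    by simp
  have F: "(step_diff 1 ^^ e) F y = frag_cmul (int m ^ Suc d) ((step_diff 1 ^^ e) f y)" for e y
    by (induction e arbitrary: y) (auto simp: F_def step_diff_def frag_cmul_diff)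
  \<comment> \<open>The top difference of \<open>f\<close> is constant modulo \<open>S\<close>, so
    the result at 0 carries over to every \<open>y\<close>.\<close>
  have "(step_diff 1 ^^ Suc d) F y \<in> S" for y
  proof -
    have "step_diff y ((step_diff 1 ^^ Suc d) f) 0 \<in> S"
      by (rule step_diff_sum_mem) (use Suc.prems(1) in simp)
    then have "frag_cmul (int m ^ Suc d) (step_diff y ((step_diff 1 ^^ Suc d) f) 0) \<in> S"
      by (rule add_subgroup_frag_cmul [OF S])
    from add_subgroup_add [OF S this zero] show ?thesis
      unfolding F by (simp add: step_diff_def [of y] frag_cmul_diff del: funpow.simps)
  qed
  moreover have "F (j * m) \<in> S" for j
    unfolding F_def by (rule add_subgroup_frag_cmul [OF S]) (rule Suc.prems)
  ultimately have "frag_cmul (int m ^ (\<Sum>i\<le>d. i)) (F x) \<in> S"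
    by (rule Suc.IH)
  then show ?case
    by (simp add: F_def power_add mult_ac)
qed

end

section \<open>Functoriality of the bar complex\<close>

lemma bar_chains_carrier: "c \<in> carrier (bar_chains n G) \<longleftrightarrow> (\<forall>xs\<in>supp c. length xs = n \<and> set xs \<subseteq> carrier G)"
  by (auto simp: bar_chains_def)

lemma bar_cycles_carrier: "c \<in> carrier (bar_cycles n G) \<longleftrightarrow> c \<in> carrier (bar_chains n G) \<and> bar_boundary n G c = 0"
  by (auto simp: bar_cycles_def)

lemma bar_cycles_additive: "bar_cycles n G = additive_monoid (carrier (bar_cycles n G))"
  by (simp add: bar_cycles_def bar_chains_def free_Abelian_group_def additive_monoid_def)

lemma mult_bar_cycles [simp]: "x \<otimes>\<^bsub>bar_cycles n G\<^esub> y = x + y"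
  and one_bar_cycles [simp]: "\<one>\<^bsub>bar_cycles n G\<^esub> = 0"
  by (simp_all add: bar_cycles_def bar_chains_def)

lemma add_subgroup_bar_cycles: "add_subgroup (carrier (bar_cycles n G))"
  using add_subgroup_zero [OF add_subgroup_bar_chains] add_subgroup_diff [OF add_subgroup_bar_chains]
  by (intro add_subgroupI) (auto simp: bar_cycles_carrier bar_boundary_diff)

lemma add_subgroup_bar_boundaries: "add_subgroup (bar_boundaries n G)"
proof (rule add_subgroupI)
  show "0 \<in> bar_boundaries n G"
    using add_subgroup_zero [OF add_subgroup_bar_chains] by (force simp: bar_boundaries_def)
  fix x y assume "x \<in> bar_boundaries n G" "y \<in> bar_boundaries n G"
  then obtain c d where "c \<in> carrier (bar_chains (Suc n) G)" "d \<in> carrier (bar_chains (Suc n) G)"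
    "x = bar_boundary (Suc n) G c" "y = bar_boundary (Suc n) G d"
    by (auto simp: bar_boundaries_def)
  moreover from this have "c - d \<in> carrier (bar_chains (Suc n) G)"
    by (intro add_subgroup_diff [OF add_subgroup_bar_chains])
  ultimately show "x - y \<in> bar_boundaries n G"
    unfolding bar_boundaries_def by (metis bar_boundary_diff imageI)
qed

lemma subgroup_additive_monoid:
  assumes "add_subgroup S" "add_subgroup T" "S \<subseteq> T"
  shows "subgroup S (additive_monoid T)"
proof -
  interpret comm_group "additive_monoid T" by (rule comm_group_additive_monoid [OF assms(2)])
  show ?thesis
    by (rule subgroupI)
      (use assms add_subgroup_zero add_subgroup_uminus add_subgroup_add in \<open>auto simp: inv_additive_monoid subset_iff\<close>)
qed

lemma (in bar_group) bar_boundary_simplex: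
  assumes "set gs \<subseteq> carrier G" "length gs = n" "n \<noteq> 0"
  shows "bar_boundary n G (frag_of gs) = frag_extend (\<lambda>xs. frag_of (edges G xs)) (face_sum (vertices G gs))"
  using bar_boundary_edges [OF set_vertices, of gs n] assms by (simp add: edges_vertices)

lemma (in bar_group) bar_boundary_in_chains:
  assumes "c \<in> carrier (bar_chains (Suc n) G)"
  shows "bar_boundary (Suc n) G c \<in> carrier (bar_chains n G)"
proof -
  have one: "bar_boundary (Suc n) G (frag_of gs) \<in> carrier (bar_chains n G)" if "gs \<in> supp c" for gs
  proof -
    have gs: "set gs \<subseteq> carrier G" "length gs = Suc n"
      using that assms by (auto simp: bar_chains_carrier)
    show ?thesis
      unfolding bar_boundary_simplex [OF gs nat.simps(3)]
    proof (rule frag_extend_in_add_subgroup [OF add_subgroup_bar_chains])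
      fix xs assume "xs \<in> supp (face_sum (vertices G gs))"
      then have "length xs = Suc n" "set xs \<subseteq> carrier G"
        using keys_face_sum [of xs "vertices G gs"] set_vertices [OF gs(1)] gs(2) by auto
      then show "frag_of (edges G xs) \<in> carrier (bar_chains n G)"
        using set_edges by (auto simp: bar_chains_carrier)
    qed
  qed
  show ?thesis
    by (induction c rule: frag_induct)
      (auto simp: one bar_boundary_diff add_subgroup_zero [OF add_subgroup_bar_chains] add_subgroup_diff [OF add_subgroup_bar_chains])
qed

text \<open>A bar symbol is the image under \<open>edges\<close> of a simplex, so the claim is
  inherited from \<open>bdy_face_sum\<close>.\<close>

lemma (in bar_group) bar_boundary_bar_boundary:
  assumes "c \<in> carrier (bar_chains (Suc n) G)"
  shows "bar_boundary n G (bar_boundary (Suc n) G c) = 0"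
proof (cases "n = 0")
  case False
  have one: "bar_boundary n G (bar_boundary (Suc n) G (frag_of gs)) = 0" if "gs \<in> supp c" for gs
  proof -
    define u where "u = vertices G gs"
    have gs: "set gs \<subseteq> carrier G" "length gs = Suc n"
      using that assms by (auto simp: bar_chains_carrier)
    have push: "bar_boundary n G (frag_extend (\<lambda>xs. frag_of (edges G xs)) d) = frag_extend (\<lambda>xs. frag_of (edges G xs)) (bdy d)"
      if "\<And>xs. xs \<in> supp d \<Longrightarrow> length xs = Suc n \<and> set xs \<subseteq> carrier G" for d
      by (induction d rule: frag_induct) (use that bar_boundary_edges False in \<open>auto simp: frag_extend_diff bar_boundary_diff bdy_diff\<close>)
    have "bar_boundary n G (bar_boundary (Suc n) G (frag_of gs)) =
        frag_extend (\<lambda>xs. frag_of (edges G xs)) (bdy (face_sum u))"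
      unfolding bar_boundary_simplex [OF gs nat.simps(3)] u_def
    proof (rule push)
      fix xs assume "xs \<in> supp (face_sum (vertices G gs))"
      then show "length xs = Suc n \<and> set xs \<subseteq> carrier G"
        using keys_face_sum [of xs "vertices G gs"] set_vertices [OF gs(1)] gs(2) by auto
    qed
    then show ?thesis by (simp add: bdy_face_sum)
  qed
  show ?thesis
    by (induction c rule: frag_induct) (auto simp: one bar_boundary_diff)
qed (simp add: bar_boundary_def)

lemma (in bar_group) bar_boundaries_subset: "bar_boundaries n G \<subseteq> carrier (bar_cycles n G)"
  using bar_boundary_in_chains bar_boundary_bar_boundary by (auto simp: bar_boundaries_def bar_cycles_carrier)

lemma bar_map_in_chains:
  assumes "h \<in> hom G H" "c \<in> carrier (bar_chains n G)"
  shows "bar_map h c \<in> carrier (bar_chains n H)"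
proof -
  have "set (map h xs) \<subseteq> carrier H \<and> length (map h xs) = n" if "xs \<in> supp c" for xs
    using that assms(2) hom_in_carrier [OF assms(1)] unfolding bar_chains_carrier by auto
  then have "map h ` supp c \<subseteq> {ys. length ys = n \<and> set ys \<subseteq> carrier H}"
    by (intro image_subsetI) simp
  then show ?thesis
    using order_trans [OF keys_bar_map [of h c]] by (simp add: bar_chains_def)
qed

lemma bar_face_map:
  assumes "h \<in> hom G H" "set xs \<subseteq> carrier G" "i \<le> length xs"
  shows "bar_face H i (map h xs) = map h (bar_face G i xs)"
proof -
  have "h (xs ! (i - 1) \<otimes>\<^bsub>G\<^esub> xs ! i) = h (xs ! (i - 1)) \<otimes>\<^bsub>H\<^esub> h (xs ! i)" if "i \<noteq> 0" "i \<noteq> length xs"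
    using that assms by (intro hom_mult) (auto simp: subset_iff)
  then show ?thesis
    using assms(3) by (auto simp: bar_face_def map_tl map_butlast take_map drop_map)
qed

lemma bar_boundary_bar_map:
  assumes h: "h \<in> hom G H" and "c \<in> carrier (bar_chains n G)"
  shows "bar_boundary n H (bar_map h c) = bar_map h (bar_boundary n G c)"
proof (cases "n = 0")
  case False
  have sum: "bar_map h (sum f I) = (\<Sum>i\<in>I. bar_map h (f i))" for f and I :: "nat set"
    unfolding bar_map_def by (induction I rule: infinite_finite_induct) (auto simp: frag_extend_add)
  have one: "bar_boundary n H (bar_map h (frag_of xs)) = bar_map h (bar_boundary n G (frag_of xs))"
    if "xs \<in> supp c" for xs
    using that assms False bar_face_map [OF h]
    by (simp add: bar_boundary_def sum bar_chains_carrier) (simp add: bar_map_def frag_extend_cmul)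
  show ?thesis
    by (induction c rule: frag_induct) (auto simp: one [simplified] bar_boundary_diff bar_map_diff)
qed (simp add: bar_boundary_def)

lemma bar_map_in_cycles:
  "h \<in> hom G H \<Longrightarrow> c \<in> carrier (bar_cycles n G) \<Longrightarrow> bar_map h c \<in> carrier (bar_cycles n H)"
  by (simp add: bar_cycles_carrier bar_map_in_chains bar_boundary_bar_map)

lemma bar_map_in_boundaries:
  assumes "h \<in> hom G H" "c \<in> bar_boundaries n G"
  shows "bar_map h c \<in> bar_boundaries n H"
proof -
  obtain d where d: "d \<in> carrier (bar_chains (Suc n) G)" "c = bar_boundary (Suc n) G d"
    using assms(2) by (auto simp: bar_boundaries_def)
  have "bar_map h c = bar_boundary (Suc n) H (bar_map h d)"
    unfolding d(2) by (rule bar_boundary_bar_map [OF assms(1) d(1), symmetric])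
  then show ?thesis
    using bar_map_in_chains [OF assms(1) d(1)] by (auto simp: bar_boundaries_def)
qed

section \<open>Homology classes and induced maps\<close>

definition homology_class :: "nat \<Rightarrow> 'a monoid \<Rightarrow> 'a chain \<Rightarrow> 'a chain set" where
  "homology_class n G c = bar_boundaries n G #>\<^bsub>bar_cycles n G\<^esub> c"

lemma homology_class_eq: "homology_class n G c = {b + c | b. b \<in> bar_boundaries n G}"
  unfolding homology_class_def r_coset_def by (subst bar_cycles_additive) auto

context bar_group
begin

lemma comm_group_bar_cycles: "comm_group (bar_cycles n G)"
  by (subst bar_cycles_additive) (rule comm_group_additive_monoid [OF add_subgroup_bar_cycles])

lemma subgroup_bar_boundaries: "subgroup (bar_boundaries n G) (bar_cycles n G)"
  by (subst bar_cycles_additive)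
    (rule subgroup_additive_monoid [OF add_subgroup_bar_boundaries add_subgroup_bar_cycles bar_boundaries_subset])

lemma comm_group_homology: "comm_group (group_homology n G)"
  unfolding group_homology_def by (rule comm_group.abelian_FactGroup [OF comm_group_bar_cycles subgroup_bar_boundaries])

lemma homology_class_hom: "group_hom (bar_cycles n G) (group_homology n G) (homology_class n G)"
proof -
  have "bar_boundaries n G \<lhd> bar_cycles n G"
    by (rule comm_group.subgroup_imp_normal [OF comm_group_bar_cycles subgroup_bar_boundaries])
  then show ?thesis
    using normal.r_coset_hom_Mod [of "bar_boundaries n G" "bar_cycles n G"] comm_group_bar_cycles [of n] comm_group_homology [of n]
    by (simp add: group_hom_def group_hom_axioms_def comm_group_def group_homology_def homology_class_def [abs_def])
qed

lemma carrier_homology: "carrier (group_homology n G) = homology_class n G ` carrier (bar_cycles n G)"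
  by (auto simp: group_homology_def carrier_FactGroup homology_class_def)

lemma homology_class_add:
  "c \<in> carrier (bar_cycles n G) \<Longrightarrow> d \<in> carrier (bar_cycles n G) \<Longrightarrow>
   homology_class n G (c + d) = homology_class n G c \<otimes>\<^bsub>group_homology n G\<^esub> homology_class n G d"
  using group_hom.hom_mult [OF homology_class_hom, of c n d] by simp

lemma homology_class_pow:
  assumes "c \<in> carrier (bar_cycles n G)"
  shows "homology_class n G c [^]\<^bsub>group_homology n G\<^esub> (k::nat) = homology_class n G (frag_cmul (int k) c)"
proof (induction k)
  case 0
  show ?case
    using group_hom.hom_one [OF homology_class_hom, of n] by simp
next
  case (Suc k)
  have "frag_cmul (int (Suc k)) c = frag_cmul (int k) c + c"
    using frag_cmul_distrib [of "int k" 1 c] by (simp add: add.commute)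
  then show ?case
    using Suc homology_class_add [OF add_subgroup_frag_cmul [OF add_subgroup_bar_cycles assms] assms] by simp
qed

lemma homology_class_boundary:
  assumes "b \<in> bar_boundaries n G"
  shows "homology_class n G (b + c) = homology_class n G c"
proof -
  note B = add_subgroup_bar_boundaries
  have "{x + (b + c) | x. x \<in> bar_boundaries n G} = {x + c | x. x \<in> bar_boundaries n G}"
  proof (intro equalityI subsetI)
    fix y assume "y \<in> {x + (b + c) | x. x \<in> bar_boundaries n G}"
    then obtain x where "x \<in> bar_boundaries n G" "y = (x + b) + c" by (auto simp: add.assoc)
    then show "y \<in> {x + c | x. x \<in> bar_boundaries n G}"
      using add_subgroup_add [OF B _ assms] by blast
  next
    fix y assume "y \<in> {x + c | x. x \<in> bar_boundaries n G}"
    then obtain x where "x \<in> bar_boundaries n G" "y = (x - b) + (b + c)" by auto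
    then show "y \<in> {x + (b + c) | x. x \<in> bar_boundaries n G}"
      using add_subgroup_diff [OF B _ assms] by blast
  qed
  then show ?thesis by (simp add: homology_class_eq)
qed

lemma homology_map_class:
  assumes "bar_group H" "h \<in> hom G H"
  shows "homology_map n H h (homology_class n G c) = homology_class n H (bar_map h c)"
proof -
  have const: "homology_class n H (bar_map h d) = homology_class n H (bar_map h c)"
    if d: "d \<in> homology_class n G c" for d
  proof -
    obtain b where "b \<in> bar_boundaries n G" "d = b + c"
      using d by (auto simp: homology_class_eq)
    then show ?thesis
      using bar_group.homology_class_boundary [OF assms(1) bar_map_in_boundaries [OF assms(2)]]
      by (simp add: bar_map_add)
  qed
  have c: "c \<in> homology_class n G c"
    using add_subgroup_zero [OF add_subgroup_bar_boundaries, of n G] by (force simp: homology_class_eq)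
  have "homology_map n H h (homology_class n G c) = (\<Union>d\<in>homology_class n G c. homology_class n H (bar_map h d))"
    by (simp only: homology_map_def homology_class_def)
  also have "\<dots> = (\<Union>d\<in>homology_class n G c. homology_class n H (bar_map h c))"
    by (rule SUP_cong [OF refl]) (rule const)
  also have "\<dots> = homology_class n H (bar_map h c)"
    using c by (auto simp: UN_constant)
  finally show ?thesis .
qed

lemma homology_map_hom:
  assumes "bar_group H" "h \<in> hom G H"
  shows "homology_map n H h \<in> hom (group_homology n G) (group_homology n H)"
proof (rule homI)
  interpret H: bar_group H by (rule assms)
  show "homology_map n H h x \<in> carrier (group_homology n H)" if "x \<in> carrier (group_homology n G)" for x
    using that bar_map_in_cycles [OF assms(2)]
    by (auto simp: carrier_homology H.carrier_homology homology_map_class [OF assms])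
  show "homology_map n H h (x \<otimes>\<^bsub>group_homology n G\<^esub> y) =
      homology_map n H h x \<otimes>\<^bsub>group_homology n H\<^esub> homology_map n H h y"
    if "x \<in> carrier (group_homology n G)" "y \<in> carrier (group_homology n G)" for x y
    using that bar_map_in_cycles [OF assms(2)]
    by (auto simp: carrier_homology homology_class_add [symmetric] homology_map_class [OF assms]
        bar_map_add H.homology_class_add)
qed

end

text \<open>For a homomorphism \<open>h\<close>, these represent the classes in the image of the
  homology of \<open>L\<close>. They are kept as chains so that the finite difference arguments
  apply.\<close>

definition liftable_cycles ::
  "nat \<Rightarrow> 'b monoid \<Rightarrow> 'a monoid \<Rightarrow> ('b \<Rightarrow> 'a) \<Rightarrow> 'a chain set" where
  "liftable_cycles n L G h = {b + bar_map h d | b d. b \<in> bar_boundaries n G \<and> d \<in> carrier (bar_cycles n L)}"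

lemma add_subgroup_liftable: "add_subgroup (liftable_cycles n L G h)"
proof (rule add_subgroupI)
  show "0 \<in> liftable_cycles n L G h"
    using add_subgroup_zero [OF add_subgroup_bar_boundaries] add_subgroup_zero [OF add_subgroup_bar_cycles]
    unfolding liftable_cycles_def by (force intro!: exI [of _ 0])
  fix x y assume "x \<in> liftable_cycles n L G h" "y \<in> liftable_cycles n L G h"
  then obtain b d b' d' where bd: "b \<in> bar_boundaries n G" "d \<in> carrier (bar_cycles n L)" "x = b + bar_map h d"
    "b' \<in> bar_boundaries n G" "d' \<in> carrier (bar_cycles n L)" "y = b' + bar_map h d'"
    unfolding liftable_cycles_def by blast
  then have "x - y = (b - b') + bar_map h (d - d')"
    by (simp add: bar_map_diff)
  then show "x - y \<in> liftable_cycles n L G h"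
    using add_subgroup_diff [OF add_subgroup_bar_boundaries] add_subgroup_diff [OF add_subgroup_bar_cycles] bd
    unfolding liftable_cycles_def by blast
qed

text \<open>Restates the criterion for cokernels in terms of cycles: the \<open>k\<close>-th power
  of a homology class is represented by \<open>k\<close> times a cycle.\<close>

theorem cotorsion_group_homology_cokernel:
  assumes A: "abelian_tower A p"
    and bounded: "\<And>i. \<exists>k>0. \<forall>c\<in>carrier (bar_cycles n (A i)).
      frag_cmul (int k) c \<in> liftable_cycles n (inv_limit A p) (A i) (\<lambda>x. x i)"
  shows "cotorsion_group (cokernel (group_homology n (inv_limit A p)) (homology_limit n A p) (homology_limit_map n A))"
  unfolding homology_limit_def
proof (rule cotorsion_group_cokernel_inv_limit)
  let ?H = "inv_limit (\<lambda>i. group_homology n (A i)) (\<lambda>i. homology_map n (A i) (p i))"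
  define L where "L = inv_limit A p"
  interpret L: bar_group L
    using comm_group_inv_limit [OF A] by (simp add: L_def bar_group_def comm_group_def)
  have bg: "bar_group (A i)" for i
    using abelian_towerD(2) [OF A] by (simp add: bar_group_def)
  have proj: "(\<lambda>x. x i) \<in> hom L (A i)" for i
    using proj_inv_limit_hom [OF A, of i] by (simp add: L_def group_hom_def group_hom_axioms_def)
  show tower: "abelian_tower (\<lambda>i. group_homology n (A i)) (\<lambda>i. homology_map n (A i) (p i))"
    using bar_group.comm_group_homology [OF bg] bar_group.homology_map_hom [OF bg bg abelian_towerD(3) [OF A]]
    by (simp add: abelian_tower_def)
  show "group (group_homology n (inv_limit A p))"
    using L.comm_group_homology by (simp add: L_def comm_group_def)
  have map_class: "homology_limit_map n A (homology_class n L c) i = homology_class n (A i) (bar_map (\<lambda>x. x i) c)" for c i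
    unfolding homology_limit_map_def by (rule L.homology_map_class [OF bg proj])
  show "homology_limit_map n A \<in> hom (group_homology n (inv_limit A p))
     ?H"
  proof (rule homI)
    fix X assume "X \<in> carrier (group_homology n (inv_limit A p))"
    then obtain c where c: "c \<in> carrier (bar_cycles n L)" "X = homology_class n L c"
      using L.carrier_homology by (auto simp: L_def)
    have "homology_limit_map n A X i \<in> carrier (group_homology n (A i))" for i
      using bar_map_in_cycles [OF proj c(1)] unfolding c(2) map_class bar_group.carrier_homology [OF bg] by blast
    moreover have "homology_map n (A i) (p i) (homology_limit_map n A X (Suc i)) = homology_limit_map n A X i" for i
    proof -
      have "bar_map (\<lambda>x. p i (x (Suc i))) c = bar_map (\<lambda>x. x i) c"
      proof (rule bar_map_cong)
        fix xs assume "xs \<in> supp c"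
        then have "set xs \<subseteq> carrier L"
          using c(1) by (auto simp: bar_cycles_carrier bar_chains_carrier)
        then show "map (\<lambda>x. p i (x (Suc i))) xs = map (\<lambda>x. x i) xs"
          by (auto simp: L_def mem_inv_limit subset_iff)
      qed
      then show ?thesis
        unfolding c(2) map_class bar_group.homology_map_class [OF bg bg abelian_towerD(3) [OF A]] bar_map_bar_map
        by simp
    qed
    ultimately show "homology_limit_map n A X \<in> carrier ?H"
      by (simp add: mem_inv_limit)
  next
    fix X Y assume "X \<in> carrier (group_homology n (inv_limit A p))" "Y \<in> carrier (group_homology n (inv_limit A p))"
    then have XY: "X \<in> carrier (group_homology n L)" "Y \<in> carrier (group_homology n L)"
      by (simp_all add: L_def)
    show "homology_limit_map n A (X \<otimes>\<^bsub>group_homology n (inv_limit A p)\<^esub> Y) =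
      homology_limit_map n A X \<otimes>\<^bsub>?H\<^esub>
      homology_limit_map n A Y"
      using hom_mult [OF L.homology_map_hom [OF bg proj] XY]
      by (simp add: homology_limit_map_def L_def)
  qed
  fix i
  obtain k where k: "0 < k" "\<And>c. c \<in> carrier (bar_cycles n (A i)) \<Longrightarrow>
      frag_cmul (int k) c \<in> liftable_cycles n L (A i) (\<lambda>x. x i)"
    using bounded unfolding L_def by blast
  have "y i [^]\<^bsub>group_homology n (A i)\<^esub> k \<in> (\<lambda>x. homology_limit_map n A x i) ` carrier (group_homology n L)"
    if y: "y \<in> carrier ?H" for y
  proof -
    have "y i \<in> homology_class n (A i) ` carrier (bar_cycles n (A i))"
      using y unfolding bar_group.carrier_homology [OF bg, symmetric] by (simp add: mem_inv_limit)
    then obtain c where c: "c \<in> carrier (bar_cycles n (A i))" "y i = homology_class n (A i) c"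
      by (rule imageE) metis
    obtain b d where bd: "b \<in> bar_boundaries n (A i)" "d \<in> carrier (bar_cycles n L)"
      "frag_cmul (int k) c = b + bar_map (\<lambda>x. x i) d"
      using k(2) [OF c(1)] unfolding liftable_cycles_def by blast
    have "y i [^]\<^bsub>group_homology n (A i)\<^esub> k = homology_limit_map n A (homology_class n L d) i"
      unfolding c(2) bar_group.homology_class_pow [OF bg c(1)] bd(3) map_class
      by (rule bar_group.homology_class_boundary [OF bg bd(1)])
    then show ?thesis
      using bd(2) unfolding L.carrier_homology by blast
  qed
  then show "\<exists>k>0. \<forall>y\<in>carrier ?H.
      y i [^]\<^bsub>group_homology n (A i)\<^esub> (k::nat) \<in> (\<lambda>x. homology_limit_map n A x i) ` carrier (group_homology n (inv_limit A p))"
    using k(1) unfolding L_def by blast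
qed

section \<open>Finitely generated subgroups and lifting of cycles\<close>

text \<open>Indexed families are used rather than sets, since a change of generators may make two of
  them equal.\<close>

definition lincomb :: "('a, 'b) monoid_scheme \<Rightarrow> 'i set \<Rightarrow> ('i \<Rightarrow> 'a) \<Rightarrow> ('i \<Rightarrow> int) \<Rightarrow> 'a" where
  "lincomb G I a n = finprod G (\<lambda>i. a i [^]\<^bsub>G\<^esub> n i) I"

definition independent_family :: "('a, 'b) monoid_scheme \<Rightarrow> 'i set \<Rightarrow> ('i \<Rightarrow> 'a) \<Rightarrow> bool" where
  "independent_family G I a \<longleftrightarrow> (\<forall>n. lincomb G I a n = \<one>\<^bsub>G\<^esub> \<longrightarrow> (\<forall>i\<in>I. n i = 0))"

context comm_group
begin

lemma lincomb_closed: "a \<in> I \<rightarrow> carrier G \<Longrightarrow> lincomb G I a n \<in> carrier G"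
  unfolding lincomb_def by (rule finprod_closed) auto

lemma lincomb_mult:
  assumes "a \<in> I \<rightarrow> carrier G"
  shows "lincomb G I a n \<otimes> lincomb G I a m = lincomb G I a (\<lambda>i. n i + m i)"
proof -
  have "lincomb G I a (\<lambda>i. n i + m i) = finprod G (\<lambda>i. a i [^] n i \<otimes> a i [^] m i) I"
    unfolding lincomb_def using assms
    by (intro finprod_cong) (auto simp: int_pow_mult Pi_iff simp_implies_def)
  then show ?thesis
    unfolding lincomb_def using assms by (subst (asm) finprod_multf) (auto simp: Pi_iff)
qed

lemma lincomb_zero: "a \<in> I \<rightarrow> carrier G \<Longrightarrow> lincomb G I a (\<lambda>i. 0) = \<one>"
  by (simp add: lincomb_def int_pow_0)

lemma lincomb_uminus:
  assumes "a \<in> I \<rightarrow> carrier G"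
  shows "inv (lincomb G I a n) = lincomb G I a (\<lambda>i. - n i)"
  using lincomb_mult [OF assms, of "\<lambda>i. - n i" n] lincomb_closed [OF assms] lincomb_zero [OF assms]
  by (intro inv_equality) auto

lemma lincomb_diff:
  "a \<in> I \<rightarrow> carrier G \<Longrightarrow> lincomb G I a n \<otimes> inv (lincomb G I a m) = lincomb G I a (\<lambda>i. n i - m i)"
  by (simp add: lincomb_uminus lincomb_mult)

lemma lincomb_nat_pow:
  assumes "a \<in> I \<rightarrow> carrier G"
  shows "lincomb G I a n [^] (k::nat) = lincomb G I a (\<lambda>i. int k * n i)"
proof (induction k)
  case (Suc k)
  then show ?case
    using lincomb_mult [OF assms, of "\<lambda>i. int k * n i" n] by (simp add: algebra_simps)
qed (simp add: lincomb_zero [OF assms])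

lemma lincomb_pow_family:
  assumes "a \<in> I \<rightarrow> carrier G"
  shows "lincomb G I (\<lambda>i. a i [^] (k::nat)) n = lincomb G I a n [^] k"
  unfolding lincomb_nat_pow [OF assms] unfolding lincomb_def
  using assms by (intro finprod_cong) (auto simp: Pi_iff int_pow_int [symmetric] int_pow_pow)

lemma lincomb_single:
  assumes "a \<in> I \<rightarrow> carrier G" "finite I" "i \<in> I"
  shows "lincomb G I a (\<lambda>j. if j = i then 1 else 0) = a i"
proof -
  have "lincomb G I a (\<lambda>j. if j = i then 1 else 0) = finprod G (\<lambda>j. if i = j then a j else \<one>) I"
    unfolding lincomb_def using assms by (intro finprod_cong) (auto simp: int_pow_0 int_pow_1 Pi_iff simp_implies_def)
  also have "\<dots> = a i"
    by (rule finprod_singleton [OF assms(3,2,1)])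
  finally show ?thesis .
qed

lemma subgroup_lincomb:
  assumes "a \<in> I \<rightarrow> carrier G"
  shows "subgroup (range (lincomb G I a)) G"
  by (rule subgroupI) (auto simp: lincomb_closed [OF assms] lincomb_uminus [OF assms] lincomb_mult [OF assms])

lemma lincomb_remove:
  assumes "a \<in> I \<rightarrow> carrier G" "finite I" "i \<in> I"
  shows "lincomb G I a n = a i [^] n i \<otimes> lincomb G (I - {i}) a n"
proof -
  have "lincomb G (insert i (I - {i})) a n = a i [^] n i \<otimes> lincomb G (I - {i}) a n"
    unfolding lincomb_def using assms by (intro finprod_insert) auto
  then show ?thesis using assms(3) by (simp add: insert_absorb)
qed

lemma lincomb_cong:
  "a \<in> I \<rightarrow> carrier G \<Longrightarrow> (\<And>i. i \<in> I \<Longrightarrow> a i = b i) \<Longrightarrow> (\<And>i. i \<in> I \<Longrightarrow> n i = m i) \<Longrightarrow> lincomb G I a n = lincomb G I b m"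
  unfolding lincomb_def by (intro finprod_cong) (auto simp: Pi_iff simp_implies_def)

text \<open>Such changes of generators realise the Euclidean algorithm on the coefficients of a
  relation.\<close>

lemma lincomb_transvection:
  assumes a: "a \<in> I \<rightarrow> carrier G" and I: "finite I" "i \<in> I" "j \<in> I" "i \<noteq> j"
  shows "lincomb G I (a(j := a j \<otimes> a i [^] (e::int))) n = lincomb G I a (n(i := n i + e * n j))"
proof -
  let ?b = "a(j := a j \<otimes> a i [^] e)" and ?m = "n(i := n i + e * n j)"
  have ai: "a i \<in> carrier G" "a j \<in> carrier G" using a I by auto
  have b: "?b \<in> I \<rightarrow> carrier G" using a ai by (auto simp: Pi_iff)
  have split: "lincomb G I f k = f i [^] k i \<otimes> (f j [^] k j \<otimes> lincomb G (I - {i} - {j}) f k)"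
    if f: "f \<in> I \<rightarrow> carrier G" for f k
  proof -
    have "f \<in> I - {i} \<rightarrow> carrier G" using f by auto
    then have "lincomb G (I - {i}) f k = f j [^] k j \<otimes> lincomb G (I - {i} - {j}) f k"
      using I by (intro lincomb_remove) auto
    then show ?thesis
      using lincomb_remove [OF f I(1,2)] by simp
  qed
  have rest: "lincomb G (I - {i} - {j}) ?b n = lincomb G (I - {i} - {j}) a ?m"
    using a by (intro lincomb_cong) auto
  have restc: "lincomb G (I - {i} - {j}) a ?m \<in> carrier G"
    using a by (intro lincomb_closed) auto
  show ?thesis
    unfolding split [OF b] split [OF a] rest
    using ai restc I(4) by (simp add: int_pow_distrib int_pow_pow int_pow_mult m_ac mult.commute)
qed

text \<open>Euclidean algorithm: while two coefficients of the relation are nonzero, a change of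
  generators reduces the larger one. A relation with a single nonzero coefficient exhibits a torsion
  generator.\<close>

lemma relation_elimination:
  assumes a: "a \<in> I \<rightarrow> carrier G" and I: "finite I"
    and rel: "lincomb G I a n = \<one>" "i0 \<in> I" "n i0 \<noteq> 0"
  shows "\<exists>b i k. b \<in> I \<rightarrow> carrier G \<and> range (lincomb G I b) = range (lincomb G I a) \<and>
           i \<in> I \<and> (0::nat) < k \<and> b i [^] k = \<one>"
  using a rel
proof (induction "\<Sum>i\<in>I. nat \<bar>n i\<bar>" arbitrary: a n i0 rule: less_induct)
  case less
  note a = less.prems(1)
  show ?case
  proof (cases "\<exists>i\<in>I. \<exists>j\<in>I. i \<noteq> j \<and> n i \<noteq> 0 \<and> n j \<noteq> 0")
    case True
    then obtain i j where ij: "i \<in> I" "j \<in> I" "i \<noteq> j" "n i \<noteq> 0" "n j \<noteq> 0" "\<bar>n j\<bar> \<le> \<bar>n i\<bar>"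
      by (metis linear)
    \<comment> \<open>This sign makes the absolute value of \<open>n i - e * n j\<close> the
      difference of the absolute values.\<close>
    define e where "e = sgn (n i) * sgn (n j)"
    define b where "b = a(j := a j \<otimes> a i [^] e)"
    define m where "m = n(i := n i - e * n j)"
    have b: "b \<in> I \<rightarrow> carrier G"
      using a ij by (auto simp: b_def Pi_iff)
    have trans: "lincomb G I b k = lincomb G I a (k(i := k i + e * k j))" for k
      unfolding b_def by (rule lincomb_transvection [OF a I ij(1-3)])
    have trans': "lincomb G I a k = lincomb G I b (k(i := k i - e * k j))" for k
      using ij(3) by (simp add: trans)
    have "lincomb G I b k \<in> range (lincomb G I a)" "lincomb G I a k \<in> range (lincomb G I b)" for k
      using trans [of k] trans' [of k] by (metis rangeI)+
    then have range: "range (lincomb G I b) = range (lincomb G I a)"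
      by (intro equalityI image_subsetI)
    have rel: "lincomb G I b m = \<one>"
      using less.prems(2) ij(3) by (simp add: trans m_def)
    have mj: "m j \<noteq> 0"
      using ij by (simp add: m_def)
    have smaller: "\<bar>m i\<bar> < \<bar>n i\<bar>"
      using ij unfolding m_def e_def by (auto simp: sgn_if abs_if split: if_splits)
    have "(\<Sum>k\<in>I. nat \<bar>m k\<bar>) < (\<Sum>k\<in>I. nat \<bar>n k\<bar>)"
    proof (rule sum_strict_mono_ex1 [OF I])
      show "\<forall>k\<in>I. nat \<bar>m k\<bar> \<le> nat \<bar>n k\<bar>"
        using smaller by (auto simp: m_def)
      show "\<exists>k\<in>I. nat \<bar>m k\<bar> < nat \<bar>n k\<bar>"
        using smaller ij by (intro bexI [of _ i]) auto
    qed
    from less.hyps [OF this b rel ij(2) mj] show ?thesis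
      unfolding range .
  next
    case False
    then have zero: "n j = 0" if "j \<in> I" "j \<noteq> i0" for j
      using that less.prems by blast
    have ai: "a i0 \<in> carrier G" using a less.prems by auto
    have "lincomb G (I - {i0}) a n = lincomb G (I - {i0}) a (\<lambda>_. 0)"
      using a zero by (intro lincomb_cong) auto
    then have "lincomb G (I - {i0}) a n = \<one>"
      using a by (simp add: lincomb_zero Pi_iff)
    then have pow: "a i0 [^] n i0 = \<one>"
      using lincomb_remove [OF a I less.prems(3), of n] less.prems(2) ai by simp
    have "a i0 [^] nat \<bar>n i0\<bar> = \<one>"
    proof (cases "n i0 < 0")
      case True
      then have "a i0 [^] (- n i0) = \<one>" using pow ai by (simp add: int_pow_neg)
      then show ?thesis using True by (simp add: int_pow_int [symmetric])
    qed (use pow in \<open>simp add: int_pow_int [symmetric]\<close>)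
    then show ?thesis
      using a less.prems(3,4) by (intro exI [of _ a] exI [of _ i0] exI [of _ "nat \<bar>n i0\<bar>"]) auto
  qed
qed

lemma not_independent_elimination:
  assumes "finite I" "a \<in> I \<rightarrow> carrier G" "\<not> independent_family G I a"
  obtains b i k where "b \<in> I \<rightarrow> carrier G" "range (lincomb G I b) = range (lincomb G I a)"
    "i \<in> I" "0 < k" "b i [^] (k::nat) = \<one>"
proof -
  obtain n i0 where "lincomb G I a n = \<one>" "i0 \<in> I" "n i0 \<noteq> 0"
    using assms(3) by (auto simp: independent_family_def)
  from relation_elimination [OF assms(2,1) this] show thesis
    using that by metis
qed

lemma lincomb_remove_one:
  assumes "a \<in> I \<rightarrow> carrier G" "finite I" "i \<in> I" "a i = \<one>"
  shows "range (lincomb G I a) = range (lincomb G (I - {i}) a)"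
proof -
  have "a \<in> I - {i} \<rightarrow> carrier G" using assms by auto
  from lincomb_closed [OF this] have "lincomb G I a n = lincomb G (I - {i}) a n" for n
    using lincomb_remove [OF assms(1-3)] assms(4) by simp
  then show ?thesis by simp
qed

lemma torsion_free_independent_family:
  fixes I :: "'i set"
  assumes "finite I" "a \<in> I \<rightarrow> carrier G"
    and "\<And>x k. x \<in> range (lincomb G I a) \<Longrightarrow> 0 < k \<Longrightarrow> x [^] (k::nat) = \<one> \<Longrightarrow> x = \<one>"
  shows "\<exists>(J :: 'i set) b. finite J \<and> b \<in> J \<rightarrow> carrier G \<and> independent_family G J b \<and>
           range (lincomb G J b) = range (lincomb G I a)"
  using assms
proof (induction "card I" arbitrary: I a rule: less_induct)
  case less
  show ?case
  proof (cases "independent_family G I a")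
    case False
    then obtain b i k where b: "b \<in> I \<rightarrow> carrier G" "range (lincomb G I b) = range (lincomb G I a)"
      "i \<in> I" "0 < k" "b i [^] (k::nat) = \<one>"
      by (rule not_independent_elimination [OF less.prems(1,2)])
    have "b i \<in> range (lincomb G I a)"
      using lincomb_single [OF b(1) less.prems(1) b(3)] b(2) by (metis rangeI)
    then have "b i = \<one>"
      using less.prems(3) b(4,5) by blast
    then have r: "range (lincomb G (I - {i}) b) = range (lincomb G I a)"
      using lincomb_remove_one [OF b(1) less.prems(1) b(3)] b(2) by simp
    have "card (I - {i}) < card I"
      using less.prems(1) b(3) by (rule card_Diff1_less)
    moreover have "b \<in> I - {i} \<rightarrow> carrier G" using b(1) by auto
    ultimately show ?thesis
      using less.hyps [of "I - {i}" b] less.prems(1,3) unfolding r by blast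
  next
    case True
    show ?thesis
      by (intro exI [of _ I] exI [of _ a] conjI less.prems True refl)
  qed
qed

text \<open>Each torsion generator split off by elimination contributes its exponent
  \<open>k\<close> as a factor; an independent family generates no torsion.\<close>

lemma torsion_bounded:
  assumes "finite I" "a \<in> I \<rightarrow> carrier G"
  shows "\<exists>M>0. \<forall>x\<in>range (lincomb G I a). (\<exists>k>0. x [^] (k::nat) = \<one>) \<longrightarrow> x [^] (M::nat) = \<one>"
  using assms
proof (induction "card I" arbitrary: I a rule: less_induct)
  case less
  show ?case
  proof (cases "independent_family G I a")
    case True
    have "x [^] (1::nat) = \<one>" if x: "x \<in> range (lincomb G I a)" and k: "0 < k" "x [^] (k::nat) = \<one>" for x k
    proof -
      obtain n where n: "x = lincomb G I a n" using x by auto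
      then have "lincomb G I a (\<lambda>i. int k * n i) = \<one>"
        using k lincomb_nat_pow [OF less.prems(2)] by simp
      then have "\<forall>i\<in>I. int k * n i = 0"
        using True unfolding independent_family_def by blast
      then have "lincomb G I a n = lincomb G I a (\<lambda>i. 0)"
        using k less.prems(2) by (intro lincomb_cong) auto
      then show ?thesis
        by (simp add: n lincomb_zero [OF less.prems(2)])
    qed
    then show ?thesis by (intro exI [of _ 1]) blast
  next
    case False
    then obtain b i k where b: "b \<in> I \<rightarrow> carrier G" "range (lincomb G I b) = range (lincomb G I a)"
      "i \<in> I" "0 < k" "b i [^] (k::nat) = \<one>"
      by (rule not_independent_elimination [OF less.prems(1,2)])
    have bi: "b i \<in> carrier G" and b': "b \<in> I - {i} \<rightarrow> carrier G"
      using b by auto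
    have "card (I - {i}) < card I"
      using less.prems(1) b(3) by (rule card_Diff1_less)
    then obtain M where M: "0 < M" "\<And>y l. y \<in> range (lincomb G (I - {i}) b) \<Longrightarrow> 0 < l \<Longrightarrow> y [^] (l::nat) = \<one> \<Longrightarrow> y [^] (M::nat) = \<one>"
      using less.hyps [of "I - {i}" b] less.prems(1) b' by auto
    have "x [^] (k * M) = \<one>" if x: "x \<in> range (lincomb G I a)" and l: "0 < l" "x [^] (l::nat) = \<one>" for x l
    proof -
      obtain n where n: "x = lincomb G I b n"
        using x b(2) by (metis rangeE)
      define y where "y = lincomb G (I - {i}) b n"
      have yc: "y \<in> carrier G" unfolding y_def by (rule lincomb_closed [OF b'])
      have "(b i [^] n i) [^] k = \<one>"
        using b(5) bi by (metis int_pow_int int_pow_pow int_pow_one mult.commute)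
      \<comment> \<open>The component along the torsion generator dies under the \<open>k\<close>-th
        power, which leaves a combination of fewer generators.\<close>
      then have xk: "x [^] k = y [^] k"
        unfolding n lincomb_remove [OF b(1) less.prems(1) b(3)] y_def [symmetric]
        using bi yc by (simp add: nat_pow_distrib)
      have xc: "x \<in> carrier G"
        unfolding n by (rule lincomb_closed [OF b(1)])
      have "(y [^] k) [^] l = (x [^] l) [^] k"
        unfolding xk [symmetric] using xc by (simp add: nat_pow_pow mult.commute)
      then have "(y [^] k) [^] l = \<one>"
        by (simp add: l)
      moreover have "y [^] k \<in> range (lincomb G (I - {i}) b)"
        unfolding y_def lincomb_nat_pow [OF b'] by blast
      ultimately have "(x [^] k) [^] M = \<one>"
        unfolding xk using M(2) l(1) by blast
      then show ?thesis
        using xc by (simp add: nat_pow_pow)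
    qed
    then show ?thesis
      using M(1) b(4) by (intro exI [of _ "k * M"]) auto
  qed
qed

text \<open>The span is free, so it suffices to choose preimages of the basis.\<close>

lemma independent_family_lift:
  assumes J: "finite J" "b \<in> J \<rightarrow> carrier G" "independent_family G J b"
    and L: "comm_group L" and \<pi>: "\<pi> \<in> hom L G" "\<pi> ` carrier L = carrier G"
  shows "\<exists>f. f \<in> hom (G\<lparr>carrier := range (lincomb G J b)\<rparr>) L \<and> (\<forall>x\<in>range (lincomb G J b). \<pi> (f x) = x)"
proof -
  interpret L: comm_group L by (rule L)
  interpret \<pi>: group_hom L G \<pi>
    using \<pi>(1) L.group_axioms group_axioms by (simp add: group_hom_def group_hom_axioms_def)
  have "\<forall>j\<in>J. \<exists>y. y \<in> carrier L \<and> \<pi> y = b j"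
    using J(2) \<pi>(2) by (metis Pi_iff imageE)
  then obtain c where c: "\<And>j. j \<in> J \<Longrightarrow> c j \<in> carrier L \<and> \<pi> (c j) = b j"
    by metis
  have cL: "c \<in> J \<rightarrow> carrier L" using c by auto
  \<comment> \<open>The coefficients are chosen. Independence determines them on \<open>J\<close>,
    and \<open>lincomb\<close> sees nothing else.\<close>
  define \<nu> where "\<nu> = (\<lambda>x. SOME n. x = lincomb G J b n)"
  have \<nu>: "x = lincomb G J b (\<nu> x)" if "x \<in> range (lincomb G J b)" for x
    using someI_ex [of "\<lambda>n. x = lincomb G J b n"] that unfolding \<nu>_def by blast
  have unique: "n j = m j" if eq: "lincomb G J b n = lincomb G J b m" and j: "j \<in> J" for n m j
  proof -
    have "lincomb G J b (\<lambda>i. n i - m i) = \<one>"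
      using eq lincomb_closed [OF J(2)] by (simp add: lincomb_diff [OF J(2), symmetric])
    then have "n j - m j = 0"
      using J(3) j unfolding independent_family_def by blast
    then show ?thesis by simp
  qed
  define f where "f = (\<lambda>x. lincomb L J c (\<nu> x))"
  have "f x \<in> carrier L" for x
    unfolding f_def by (rule L.lincomb_closed [OF cL])
  moreover have "f (x \<otimes> y) = f x \<otimes>\<^bsub>L\<^esub> f y" if x: "x \<in> range (lincomb G J b)" and y: "y \<in> range (lincomb G J b)" for x y
  proof -
    have xy: "x \<otimes> y = lincomb G J b (\<lambda>i. \<nu> x i + \<nu> y i)"
      using \<nu> [OF x] \<nu> [OF y] lincomb_mult [OF J(2)] by metis
    then have "lincomb G J b (\<nu> (x \<otimes> y)) = lincomb G J b (\<lambda>i. \<nu> x i + \<nu> y i)"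
      using \<nu> [of "x \<otimes> y"] by (metis rangeI)
    then have "\<nu> (x \<otimes> y) j = \<nu> x j + \<nu> y j" if "j \<in> J" for j
      using unique that by blast
    then have "f (x \<otimes> y) = lincomb L J c (\<lambda>i. \<nu> x i + \<nu> y i)"
      unfolding f_def by (intro L.lincomb_cong cL) auto
    then show ?thesis
      by (simp add: f_def L.lincomb_mult [OF cL])
  qed
  moreover have "\<pi> (f x) = x" if x: "x \<in> range (lincomb G J b)" for x
  proof -
    have "\<pi> (lincomb L K c n) = lincomb G K b n" if "finite K" "K \<subseteq> J" for K n
      using that
    proof (induction K)
      case (insert k K)
      have cK: "c \<in> insert k K \<rightarrow> carrier L" "b \<in> insert k K \<rightarrow> carrier G" "c \<in> K \<rightarrow> carrier L" "b \<in> K \<rightarrow> carrier G"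
        using cL J(2) insert.prems by auto
      have "\<pi> (c k [^]\<^bsub>L\<^esub> n k) = b k [^] n k"
        using c [of k] insert.prems by (simp add: \<pi>.hom_int_pow)
      then show ?case
        using L.lincomb_remove [OF cK(1), of k n] lincomb_remove [OF cK(2), of k n] insert
          c [of k] L.lincomb_closed [OF cK(3)] by simp
    qed (simp add: lincomb_def)
    then show ?thesis
      unfolding f_def using \<nu> [OF x] J(1) by simp
  qed
  ultimately show ?thesis
    by (intro exI [of _ f]) (auto simp: hom_def)
qed

end

text \<open>The entries of \<open>c\<close> generate a subgroup whose \<open>m\<close>-th powers
  form a finitely generated torsion-free, hence free, group. So the \<open>m\<close>-th power map on
  this subgroup lifts to \<open>L\<close>, and with it all powers by multiples of
  \<open>m\<close>.\<close>

lemma (in bar_comm_group) pow_multiple_liftable: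
  assumes L: "comm_group L" and \<pi>: "\<pi> \<in> hom L G" "\<pi> ` carrier L = carrier G"
    and tors: "\<And>x k. x \<in> carrier G \<Longrightarrow> 0 < k \<Longrightarrow> x [^] (k::nat) = \<one> \<Longrightarrow> x [^] (m::nat) = \<one>"
    and m: "0 < m" and c: "c \<in> carrier (bar_cycles n G)"
  shows "bar_map (\<lambda>a. a [^] (j * m)) c \<in> liftable_cycles n L G \<pi>"
proof -
  interpret L: comm_group L by (rule L)
  define I where "I = (\<Union>xs\<in>supp c. set xs)"
  have I: "finite I" "I \<subseteq> carrier G"
    using c by (auto simp: I_def bar_cycles_carrier bar_chains_carrier)
  have a: "(\<lambda>i. i) \<in> I \<rightarrow> carrier G" and am: "(\<lambda>i. i [^] m) \<in> I \<rightarrow> carrier G"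
    using I by auto
  define H where "H = range (lincomb G I (\<lambda>i. i))"
  have sub: "subgroup H G"
    unfolding H_def by (rule subgroup_lincomb [OF a])
  have HG: "H \<subseteq> carrier G"
    using sub by (rule subgroup.subset)
  have IH: "I \<subseteq> H"
    using lincomb_single [OF a I(1)] unfolding H_def by (metis rangeI subsetI)
  have Hm: "y [^] m \<in> range (lincomb G I (\<lambda>i. i [^] m))" if "y \<in> H" for y
  proof -
    obtain k where "y = lincomb G I (\<lambda>i. i) k" using \<open>y \<in> H\<close> by (auto simp: H_def)
    then have "y [^] m = lincomb G I (\<lambda>i. i [^] m) k" by (simp add: lincomb_pow_family [OF a])
    then show ?thesis by blast
  qed
  \<comment> \<open>If \<open>y [^] m\<close> has finite order, then so has \<open>y\<close>, and
    \<open>y [^] m\<close> is already the unit.\<close>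
  have tf: "x = \<one>" if x: "x \<in> range (lincomb G I (\<lambda>i. i [^] m))" and k: "0 < k" "x [^] (k::nat) = \<one>" for x k
  proof -
    obtain l where "x = lincomb G I (\<lambda>i. i [^] m) l" using x by auto
    then obtain y where y: "y \<in> carrier G" "x = y [^] m"
      using lincomb_pow_family [OF a] lincomb_closed [OF a] by blast
    then have "y [^] (m * k) = \<one>"
      using k by (simp add: nat_pow_pow)
    then show ?thesis
      using tors [OF y(1), of "m * k"] m k(1) y(2) by simp
  qed
  have "\<exists>(J :: 'a set) b. finite J \<and> b \<in> J \<rightarrow> carrier G \<and> independent_family G J b \<and>
      range (lincomb G J b) = range (lincomb G I (\<lambda>i. i [^] m))"
    by (rule torsion_free_independent_family [OF I(1) am]) (rule tf)
  then obtain J :: "'a set" and b where J: "finite J" "b \<in> J \<rightarrow> carrier G" "independent_family G J b"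
    "range (lincomb G J b) = range (lincomb G I (\<lambda>i. i [^] m))"
    by (elim exE conjE)
  obtain f where f: "f \<in> hom (G\<lparr>carrier := range (lincomb G J b)\<rparr>) L" "\<And>x. x \<in> range (lincomb G J b) \<Longrightarrow> \<pi> (f x) = x"
    using independent_family_lift [OF J(1-3) L \<pi>] by auto
  define \<psi> where "\<psi> = (\<lambda>y. f (y [^] m) [^]\<^bsub>L\<^esub> j)"
  define G' where "G' = G\<lparr>carrier := H\<rparr>"
  have f_closed: "f (y [^] m) \<in> carrier L" if "y \<in> H" for y
    using hom_in_carrier [OF f(1)] Hm [OF that] J(4) by simp
  have \<psi>: "\<psi> \<in> hom G' L"
  proof (rule homI)
    show "\<psi> y \<in> carrier L" if "y \<in> carrier G'" for y
      using that f_closed by (simp add: \<psi>_def G'_def)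
    show "\<psi> (y \<otimes>\<^bsub>G'\<^esub> z) = \<psi> y \<otimes>\<^bsub>L\<^esub> \<psi> z" if "y \<in> carrier G'" "z \<in> carrier G'" for y z
    proof -
      have yz: "y \<in> H" "z \<in> H" using that by (simp_all add: G'_def)
      then have "(y \<otimes> z) [^] m = y [^] m \<otimes> z [^] m"
        using HG by (intro nat_pow_distrib) auto
      then have "f ((y \<otimes> z) [^] m) = f (y [^] m) \<otimes>\<^bsub>L\<^esub> f (z [^] m)"
        using hom_mult [OF f(1), of "y [^] m" "z [^] m"] Hm yz J(4) by simp
      then show ?thesis
        using f_closed yz by (simp add: \<psi>_def G'_def L.nat_pow_distrib)
    qed
  qed
  \<comment> \<open>The lift is a homomorphism on \<open>H\<close> only, so \<open>c\<close> has to
    be read as a cycle of \<open>H\<close>.\<close>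
  have "c \<in> carrier (bar_cycles n G')"
  proof -
    have "bar_boundary n G' c = bar_boundary n G c"
    proof -
      have "bar_face G' i xs = bar_face G i xs" for i xs
        by (auto simp: bar_face_def G'_def)
      then show ?thesis by (simp add: bar_boundary_def)
    qed
    moreover have "set xs \<subseteq> H \<and> length xs = n" if "xs \<in> supp c" for xs
      using that IH c by (auto simp: I_def bar_cycles_carrier bar_chains_carrier)
    ultimately show ?thesis
      using c by (auto simp: bar_cycles_carrier bar_chains_carrier G'_def)
  qed
  then have lift: "bar_map \<psi> c \<in> carrier (bar_cycles n L)"
    by (rule bar_map_in_cycles [OF \<psi>])
  interpret \<pi>: group_hom L G \<pi>
    using \<pi>(1) L.group_axioms group_axioms by (simp add: group_hom_def group_hom_axioms_def)
  have "bar_map \<pi> (bar_map \<psi> c) = bar_map (\<lambda>a. a [^] (j * m)) c"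
    unfolding bar_map_bar_map
  proof (rule bar_map_cong)
    fix xs assume xs: "xs \<in> supp c"
    have "\<pi> (\<psi> y) = y [^] (j * m)" if y: "y \<in> set xs" for y
    proof -
      have yH: "y \<in> H" using y xs IH by (auto simp: I_def)
      then have "\<pi> (\<psi> y) = (y [^] m) [^] j"
        using f(2) [of "y [^] m"] Hm J(4) by (simp add: \<psi>_def \<pi>.hom_nat_pow f_closed)
      then show ?thesis
        using yH HG by (simp add: nat_pow_pow subset_iff mult.commute)
    qed
    then show "map (\<lambda>x. \<pi> (\<psi> x)) xs = map (\<lambda>a. a [^] (j * m)) xs"
      by simp
  qed
  then show ?thesis
    using lift add_subgroup_zero [OF add_subgroup_bar_boundaries, of n G]
    unfolding liftable_cycles_def by force
qed

text \<open>\<open>polynomial_torsion\<close> for the images of \<open>c\<close> under the power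
  maps: differences of order \<open>Suc n\<close> are boundaries, the values at multiples of
  \<open>m\<close> are liftable, and the value at 1 is \<open>c\<close>.\<close>

theorem (in bar_comm_group) bounded_torsion_liftable:
  assumes L: "comm_group L" and \<pi>: "\<pi> \<in> hom L G" "\<pi> ` carrier L = carrier G"
    and tors: "\<And>x k. x \<in> carrier G \<Longrightarrow> 0 < k \<Longrightarrow> x [^] (k::nat) = \<one> \<Longrightarrow> x [^] (m::nat) = \<one>"
    and m: "0 < m" and c: "c \<in> carrier (bar_cycles n G)" and n: "n \<noteq> 0"
  shows "frag_cmul (int (m ^ (\<Sum>i\<le>n. i))) c \<in> liftable_cycles n L G \<pi>"
proof -
  define S where "S = liftable_cycles n L G \<pi>"
  define f where "f = (\<lambda>x. bar_map (\<lambda>a. a [^] (x::nat)) c)"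
  have S: "add_subgroup S"
    unfolding S_def by (rule add_subgroup_liftable)
  have BS: "bar_boundaries n G \<subseteq> S"
  proof
    fix b assume "b \<in> bar_boundaries n G"
    then show "b \<in> S"
      using add_subgroup_zero [OF add_subgroup_bar_cycles, of n L]
      unfolding S_def liftable_cycles_def by (intro CollectI exI [of _ b] exI [of _ 0]) simp
  qed
  have "(step_diff 1 ^^ Suc n) f x \<in> S" for x
  proof -
    have "frag_cmul ((-1) ^ Suc n) ((step_diff 1 ^^ Suc n) f x) \<in> S"
      using cross_effect_boundary [OF c n, of x] BS alternating_step_diff [of f x "Suc n"]
      unfolding f_def by (metis subsetD)
    then have "frag_cmul ((-1) ^ Suc n) (frag_cmul ((-1) ^ Suc n) ((step_diff 1 ^^ Suc n) f x)) \<in> S"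
      by (rule add_subgroup_frag_cmul [OF S])
    then show ?thesis
      by (simp flip: power_add del: funpow.simps)
  qed
  moreover have "f (j * m) \<in> S" for j
    unfolding f_def S_def by (rule pow_multiple_liftable [OF L \<pi> tors m c])
  ultimately have "frag_cmul (int m ^ (\<Sum>i\<le>n. i)) (f 1) \<in> S"
    by (rule polynomial_torsion [OF S])
  moreover have "f 1 = c"
  proof -
    have "f 1 = bar_map (\<lambda>a. a) c"
      unfolding f_def
    proof (rule bar_map_cong)
      fix xs assume "xs \<in> supp c"
      then have "set xs \<subseteq> carrier G"
        using c by (auto simp: bar_cycles_carrier bar_chains_carrier)
      then show "map (\<lambda>a. a [^] (1::nat)) xs = map (\<lambda>a. a) xs"
        by (intro map_cong refl) (auto simp: subset_iff)
    qed
    then show ?thesis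
      by (simp add: bar_map_def frag_expansion [symmetric])
  qed
  ultimately show ?thesis
    by (simp add: S_def)
qed

section \<open>The second homology group\<close>

text \<open>The extension of \<open>G\<close> by \<open>Q\<close> with factor set \<open>u\<close>.
  The cocycle is not normalised, which accounts for the first component of the unit.\<close>

definition twisted_product :: "'q monoid \<Rightarrow> 'a monoid \<Rightarrow> ('a \<Rightarrow> 'a \<Rightarrow> 'q) \<Rightarrow> ('q \<times> 'a) monoid" where
  "twisted_product Q G u =
     \<lparr>carrier = carrier Q \<times> carrier G,
      monoid.mult = (\<lambda>x y. (fst x \<otimes>\<^bsub>Q\<^esub> fst y \<otimes>\<^bsub>Q\<^esub> u (snd x) (snd y), snd x \<otimes>\<^bsub>G\<^esub> snd y)),
      one = (inv\<^bsub>Q\<^esub> (u \<one>\<^bsub>G\<^esub> \<one>\<^bsub>G\<^esub>), \<one>\<^bsub>G\<^esub>)\<rparr>"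

locale symmetric_cocycle = Q: comm_group Q + G: comm_group G for Q :: "'q monoid" (structure) and G :: "'a monoid" +
  fixes u
  assumes u_closed: "a \<in> carrier G \<Longrightarrow> b \<in> carrier G \<Longrightarrow> u a b \<in> carrier Q"
    and u_commute: "a \<in> carrier G \<Longrightarrow> b \<in> carrier G \<Longrightarrow> u a b = u b a"
    and u_cocycle: "a \<in> carrier G \<Longrightarrow> b \<in> carrier G \<Longrightarrow> c \<in> carrier G \<Longrightarrow>
      u a b \<otimes> u (a \<otimes>\<^bsub>G\<^esub> b) c = u b c \<otimes> u a (b \<otimes>\<^bsub>G\<^esub> c)"
begin

abbreviation E where "E \<equiv> twisted_product Q G u"

lemma u_one: "a \<in> carrier G \<Longrightarrow> u \<one>\<^bsub>G\<^esub> a = u \<one>\<^bsub>G\<^esub> \<one>\<^bsub>G\<^esub>"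
  using u_cocycle [of "\<one>\<^bsub>G\<^esub>" "\<one>\<^bsub>G\<^esub>" a] u_closed by simp

lemma carrier_E: "x \<in> carrier E \<longleftrightarrow> fst x \<in> carrier Q \<and> snd x \<in> carrier G"
  and mult_E: "x \<otimes>\<^bsub>E\<^esub> y = (fst x \<otimes> fst y \<otimes> u (snd x) (snd y), snd x \<otimes>\<^bsub>G\<^esub> snd y)"
  and one_E: "\<one>\<^bsub>E\<^esub> = (inv (u \<one>\<^bsub>G\<^esub> \<one>\<^bsub>G\<^esub>), \<one>\<^bsub>G\<^esub>)"
  by (simp_all add: twisted_product_def mem_Times_iff)

lemma comm_group_E: "comm_group E"
proof (rule comm_groupI)
  fix x y z assume x: "x \<in> carrier E" and y: "y \<in> carrier E" and z: "z \<in> carrier E"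
  note xyz = x [unfolded carrier_E] y [unfolded carrier_E] z [unfolded carrier_E]
  show "x \<otimes>\<^bsub>E\<^esub> y \<in> carrier E"
    using xyz by (simp add: carrier_E mult_E u_closed)
  show "x \<otimes>\<^bsub>E\<^esub> y = y \<otimes>\<^bsub>E\<^esub> x"
    using xyz u_commute [of "snd x" "snd y"] by (simp add: mult_E Q.m_comm G.m_comm)
  have "fst x \<otimes> fst y \<otimes> u (snd x) (snd y) \<otimes> fst z \<otimes> u (snd x \<otimes>\<^bsub>G\<^esub> snd y) (snd z) =
      fst x \<otimes> fst y \<otimes> fst z \<otimes> (u (snd x) (snd y) \<otimes> u (snd x \<otimes>\<^bsub>G\<^esub> snd y) (snd z))"
    using xyz by (simp add: u_closed Q.m_ac)
  also have "\<dots> = fst x \<otimes> (fst y \<otimes> fst z \<otimes> u (snd y) (snd z)) \<otimes> u (snd x) (snd y \<otimes>\<^bsub>G\<^esub> snd z)"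
    using xyz by (subst u_cocycle) (simp_all add: u_closed Q.m_ac)
  finally show "x \<otimes>\<^bsub>E\<^esub> y \<otimes>\<^bsub>E\<^esub> z = x \<otimes>\<^bsub>E\<^esub> (y \<otimes>\<^bsub>E\<^esub> z)"
    using xyz by (simp add: mult_E G.m_assoc)
next
  show "\<one>\<^bsub>E\<^esub> \<in> carrier E"
    by (simp add: carrier_E one_E u_closed)
  fix x assume x: "x \<in> carrier E"
  note x = x [unfolded carrier_E]
  show "\<one>\<^bsub>E\<^esub> \<otimes>\<^bsub>E\<^esub> x = x"
    using x u_one [of "snd x"] Q.m_comm [of _ "fst x"] by (simp add: mult_E one_E u_closed Q.m_assoc)
  define y where "y = (inv (fst x) \<otimes> inv (u (inv\<^bsub>G\<^esub> (snd x)) (snd x)) \<otimes> inv (u \<one>\<^bsub>G\<^esub> \<one>\<^bsub>G\<^esub>), inv\<^bsub>G\<^esub> (snd x))"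
  define v w where "v = u (inv\<^bsub>G\<^esub> (snd x)) (snd x)" and "w = u \<one>\<^bsub>G\<^esub> \<one>\<^bsub>G\<^esub>"
  have vw: "v \<in> carrier Q" "w \<in> carrier Q" using x by (simp_all add: v_def w_def u_closed)
  have "inv (fst x) \<otimes> inv v \<otimes> inv w \<otimes> fst x \<otimes> v =
      (inv (fst x) \<otimes> fst x) \<otimes> (inv v \<otimes> v) \<otimes> inv w"
    using x vw by (simp only: Q.m_ac Q.inv_closed Q.m_closed)
  then have "y \<otimes>\<^bsub>E\<^esub> x = \<one>\<^bsub>E\<^esub>"
    using x vw by (simp add: y_def mult_E one_E v_def [symmetric] w_def [symmetric])
  moreover have "y \<in> carrier E"
    using x vw by (simp add: y_def carrier_E v_def [symmetric] w_def [symmetric])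
  ultimately show "\<exists>y\<in>carrier E. y \<otimes>\<^bsub>E\<^esub> x = \<one>\<^bsub>E\<^esub>" by blast
qed

text \<open>The correction by \<open>u \<one> \<one>\<close> makes the inclusion of the fibre
  respect the unit of \<open>E\<close>.\<close>

lemma fibre_inclusion_hom: "(\<lambda>q. (q \<otimes> inv (u \<one>\<^bsub>G\<^esub> \<one>\<^bsub>G\<^esub>), \<one>\<^bsub>G\<^esub>)) \<in> hom Q E"
proof (rule homI)
  define w where "w = u \<one>\<^bsub>G\<^esub> \<one>\<^bsub>G\<^esub>"
  have w: "w \<in> carrier Q" by (simp add: w_def u_closed)
  fix x assume x: "x \<in> carrier Q"
  then show "(x \<otimes> inv (u \<one>\<^bsub>G\<^esub> \<one>\<^bsub>G\<^esub>), \<one>\<^bsub>G\<^esub>) \<in> carrier E"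
    by (simp add: carrier_E u_closed)
  fix y assume y: "y \<in> carrier Q"
  have "x \<otimes> inv w \<otimes> (y \<otimes> inv w) \<otimes> w = x \<otimes> y \<otimes> inv w \<otimes> (inv w \<otimes> w)"
    using x y w by (simp only: Q.m_ac Q.inv_closed Q.m_closed)
  then show "(x \<otimes> y \<otimes> inv (u \<one>\<^bsub>G\<^esub> \<one>\<^bsub>G\<^esub>), \<one>\<^bsub>G\<^esub>) =
      (x \<otimes> inv (u \<one>\<^bsub>G\<^esub> \<one>\<^bsub>G\<^esub>), \<one>\<^bsub>G\<^esub>) \<otimes>\<^bsub>E\<^esub> (y \<otimes> inv (u \<one>\<^bsub>G\<^esub> \<one>\<^bsub>G\<^esub>), \<one>\<^bsub>G\<^esub>)"
    using x y w by (simp add: mult_E w_def [symmetric])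
qed

text \<open>The cocycle measures the failure of the section to be multiplicative.\<close>

lemma section_mult:
  assumes "a \<in> carrier G" "b \<in> carrier G"
  shows "(\<one>, a) \<otimes>\<^bsub>E\<^esub> (\<one>, b) =
    (u a b \<otimes> inv (u \<one>\<^bsub>G\<^esub> \<one>\<^bsub>G\<^esub>), \<one>\<^bsub>G\<^esub>) \<otimes>\<^bsub>E\<^esub> (\<one>, a \<otimes>\<^bsub>G\<^esub> b)"
  using assms u_one [of "a \<otimes>\<^bsub>G\<^esub> b"] by (simp add: mult_E u_closed Q.m_assoc)

end

lemma bar_boundary_pair:
  "bar_boundary 2 G (frag_of [a, b]) = (frag_of [a] + frag_of [b]) - frag_of [a \<otimes>\<^bsub>G\<^esub> b]"
  by (simp add: bar_boundary_def bar_face_def numeral_2_eq_2 atMost_Suc)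

text \<open>
  Modulo boundaries and commutators, the symbols \<open>[a|b]\<close> are a symmetric cocycle with values in a
  quotient \<open>Q\<close> of the 2-chains, and thus define an abelian extension \<open>E\<close> of \<open>G\<close> by \<open>Q\<close>. The
  homomorphism from the free group of 1-chains to \<open>E\<close> given by the section extends the inclusion of
  \<open>Q\<close> along the boundary map, so that the boundary map is injective on \<open>Q\<close>.
\<close>

lemma (in bar_comm_group) two_cycles_generated:
  assumes S: "add_subgroup S" "S \<subseteq> carrier (bar_chains 2 G)"
    and bd: "bar_boundaries 2 G \<subseteq> S"
    and comm: "\<And>a b. a \<in> carrier G \<Longrightarrow> b \<in> carrier G \<Longrightarrow> frag_of [a, b] - frag_of [b, a] \<in> S"
    and c: "c \<in> carrier (bar_cycles 2 G)"
  shows "c \<in> S"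
proof -
  define C where "C = carrier (bar_chains 2 G)"
  define F where "F = additive_monoid C"
  have C: "add_subgroup C"
    unfolding C_def by (rule add_subgroup_bar_chains)
  have F: "comm_group F"
    unfolding F_def by (rule comm_group_additive_monoid [OF C])
  interpret F: comm_group F by (rule F)
  have sub: "subgroup S F"
    unfolding F_def using S C by (intro subgroup_additive_monoid) (auto simp: C_def)
  have nS: "S \<lhd> F" by (rule F.subgroup_imp_normal [OF sub])
  define Q where "Q = F Mod S"
  define \<kappa> where "\<kappa> = (\<lambda>x. S #>\<^bsub>F\<^esub> x)"
  have Q: "comm_group Q"
    unfolding Q_def by (rule F.abelian_FactGroup [OF sub])
  interpret Q: comm_group Q by (rule Q)
  have \<kappa>hom: "\<kappa> \<in> hom F Q"
    unfolding \<kappa>_def Q_def by (rule normal.r_coset_hom_Mod [OF nS])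
  interpret \<kappa>: group_hom F Q \<kappa>
    using \<kappa>hom F.group_axioms Q.group_axioms by (simp add: group_hom_def group_hom_axioms_def)
  have \<kappa>_one: "\<kappa> x = \<one>\<^bsub>Q\<^esub> \<longleftrightarrow> x \<in> S" if "x \<in> C" for x
  proof -
    have "\<kappa> x = S \<longleftrightarrow> x \<in> S"
      unfolding \<kappa>_def using that F.coset_join1 [OF _ _ sub] F.coset_join2 [OF _ sub] subgroup.subset [OF sub]
      by (auto simp: F_def)
    then show ?thesis by (simp add: Q_def FactGroup_def)
  qed
  have \<kappa>_add: "\<kappa> (x + y) = \<kappa> x \<otimes>\<^bsub>Q\<^esub> \<kappa> y" if "x \<in> C" "y \<in> C" for x y
    using \<kappa>.hom_mult [of x y] that by (simp add: F_def)
  have \<kappa>_eq: "\<kappa> x = \<kappa> y" if "x \<in> C" "y \<in> C" "x - y \<in> S" for x y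
  proof -
    have "\<kappa> x = \<kappa> (x - y) \<otimes>\<^bsub>Q\<^esub> \<kappa> y"
      using \<kappa>_add [of "x - y" y] that add_subgroup_diff [OF C] by simp
    moreover have "\<kappa> (x - y) = \<one>\<^bsub>Q\<^esub>"
      using \<kappa>_one [of "x - y"] that add_subgroup_diff [OF C] by simp
    moreover have "\<kappa> y \<in> carrier Q"
      using \<kappa>.hom_closed [of y] that by (simp add: F_def)
    ultimately show ?thesis by simp
  qed
  define u where "u = (\<lambda>a b. \<kappa> (frag_of [a, b]))"
  have simplex_C: "frag_of [a, b] \<in> C" if "a \<in> carrier G" "b \<in> carrier G" for a b
    using that by (auto simp: C_def bar_chains_carrier)
  have cocycle: "symmetric_cocycle Q G u"
  proof (intro symmetric_cocycle.intro symmetric_cocycle_axioms.intro Q comm_group_axioms)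
    show "u a b \<in> carrier Q" if "a \<in> carrier G" "b \<in> carrier G" for a b
      unfolding u_def using \<kappa>.hom_closed [of "frag_of [a, b]"] simplex_C [OF that] by (simp add: F_def)
    show "u a b = u b a" if "a \<in> carrier G" "b \<in> carrier G" for a b
      unfolding u_def using that comm simplex_C by (intro \<kappa>_eq) auto
    show "u a b \<otimes>\<^bsub>Q\<^esub> u (a \<otimes> b) c = u b c \<otimes>\<^bsub>Q\<^esub> u a (b \<otimes> c)"
      if abc: "a \<in> carrier G" "b \<in> carrier G" "c \<in> carrier G" for a b c
    proof -
      \<comment> \<open>The cocycle identity is the boundary of the symbol \<open>[a, b, c]\<close>,
        which vanishes modulo \<open>S\<close>.\<close>
      have "frag_of [a, b, c] \<in> carrier (bar_chains (Suc 2) G)"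
        using abc by (auto simp: bar_chains_carrier)
      then have "bar_boundary (Suc 2) G (frag_of [a, b, c]) \<in> S"
        using bd unfolding bar_boundaries_def by blast
      moreover have "bar_boundary (Suc 2) G (frag_of [a, b, c]) =
          frag_of [b, c] - frag_of [a \<otimes> b, c] + frag_of [a, b \<otimes> c] - frag_of [a, b]"
        by (simp add: bar_boundary_def bar_face_def numeral_2_eq_2 numeral_3_eq_3 atMost_Suc)
      ultimately have "frag_of [b, c] - frag_of [a \<otimes> b, c] + frag_of [a, b \<otimes> c] - frag_of [a, b] \<in> S"
        by simp
      from add_subgroup_uminus [OF S(1) this] have "(frag_of [a, b] + frag_of [a \<otimes> b, c]) - (frag_of [b, c] + frag_of [a, b \<otimes> c]) \<in> S"
        by (simp add: algebra_simps)
      then have "\<kappa> (frag_of [a, b] + frag_of [a \<otimes> b, c]) = \<kappa> (frag_of [b, c] + frag_of [a, b \<otimes> c])"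
        using abc by (intro \<kappa>_eq add_subgroup_add [OF C] simplex_C) auto
      then show ?thesis
        unfolding u_def using abc by (simp add: \<kappa>_add simplex_C)
    qed
  qed
  interpret symmetric_cocycle Q G u by (rule cocycle)
  interpret E: comm_group E by (rule comm_group_E)
  define \<iota> where "\<iota> = (\<lambda>q. (q \<otimes>\<^bsub>Q\<^esub> inv\<^bsub>Q\<^esub> (u \<one> \<one>), \<one>))"
  interpret \<iota>: group_hom Q E \<iota>
    using fibre_inclusion_hom Q.group_axioms E.group_axioms
    by (simp add: group_hom_def group_hom_axioms_def \<iota>_def)
  \<comment> \<open>The 1-chains are free on the elements of \<open>G\<close>, so the section
    extends to them although it need not be multiplicative on \<open>G\<close>.\<close>
  obtain \<theta> where \<theta>: "\<theta> \<in> hom (bar_chains 1 G) E"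
    and \<theta>_of: "\<And>a. a \<in> carrier G \<Longrightarrow> \<theta> (frag_of [a]) = (\<one>\<^bsub>Q\<^esub>, a)"
  proof -
    have "(\<lambda>xs. (\<one>\<^bsub>Q\<^esub>, hd xs)) ` {xs. length xs = 1 \<and> set xs \<subseteq> carrier G} \<subseteq> carrier E"
      by (auto simp: carrier_E length_Suc_conv)
    from E.free_Abelian_group_universal [OF this]
    obtain h where "h \<in> hom (free_Abelian_group {xs. length xs = 1 \<and> set xs \<subseteq> carrier G}) E"
      "\<And>x. x \<in> {xs. length xs = 1 \<and> set xs \<subseteq> carrier G} \<Longrightarrow> h (frag_of x) = (\<one>\<^bsub>Q\<^esub>, hd x)"
      by blast
    then show thesis
      by (intro that [of h]) (auto simp: bar_chains_def)
  qed
  define C1 where "C1 = carrier (bar_chains 1 G)"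
  have C1: "add_subgroup C1"
    unfolding C1_def by (rule add_subgroup_bar_chains)
  have \<theta>_closed: "\<theta> x \<in> carrier E" if "x \<in> C1" for x
    using hom_in_carrier [OF \<theta>] that by (simp add: C1_def)
  have \<theta>_add: "\<theta> (x + y) = \<theta> x \<otimes>\<^bsub>E\<^esub> \<theta> y" if "x \<in> C1" "y \<in> C1" for x y
    using hom_mult [OF \<theta>] that by (simp add: C1_def bar_chains_def)
  have \<theta>_diff: "\<theta> (x - y) = \<theta> x \<otimes>\<^bsub>E\<^esub> inv\<^bsub>E\<^esub> (\<theta> y)" if "x \<in> C1" "y \<in> C1" for x y
    using \<theta>_add [of "x - y" y] that \<theta>_closed add_subgroup_diff [OF C1] E.inv_solve_right by simp
  have \<theta>_0: "\<theta> 0 = \<one>\<^bsub>E\<^esub>"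
    using \<theta>_diff [of 0 0] \<theta>_closed [of 0] add_subgroup_zero [OF C1] by simp
  have bd_C1: "bar_boundary 2 G x \<in> C1" if "x \<in> C" for x
    using bar_boundary_in_chains [of x 1] that by (simp add: C_def C1_def numeral_2_eq_2)
  \<comment> \<open>By \<open>section_mult\<close>, the boundary of a symbol is sent to the image of
    the cocycle in the fibre.\<close>
  have simplex: "\<theta> (bar_boundary 2 G (frag_of [a, b])) = \<iota> (u a b)" if ab: "a \<in> carrier G" "b \<in> carrier G" for a b
  proof -
    have in_C1: "frag_of [x] \<in> C1" if "x \<in> carrier G" for x
      using that by (auto simp: C1_def bar_chains_carrier)
    have "\<theta> (bar_boundary 2 G (frag_of [a, b])) = \<theta> (frag_of [a] + frag_of [b]) \<otimes>\<^bsub>E\<^esub> inv\<^bsub>E\<^esub> (\<theta> (frag_of [a \<otimes> b]))"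
      unfolding bar_boundary_pair using ab in_C1 add_subgroup_add [OF C1] by (simp add: \<theta>_diff)
    also have "\<theta> (frag_of [a] + frag_of [b]) = \<iota> (u a b) \<otimes>\<^bsub>E\<^esub> \<theta> (frag_of [a \<otimes> b])"
      using ab in_C1 section_mult [OF ab] by (simp add: \<theta>_add \<theta>_of \<iota>_def)
    also have "\<dots> \<otimes>\<^bsub>E\<^esub> inv\<^bsub>E\<^esub> (\<theta> (frag_of [a \<otimes> b])) = \<iota> (u a b)"
      using \<iota>.hom_closed [OF u_closed [OF ab]] \<theta>_closed [OF in_C1] ab by (simp add: E.m_assoc)
    finally show ?thesis .
  qed
  have "x \<in> C \<and> \<theta> (bar_boundary 2 G x) = \<iota> (\<kappa> x)" if "supp x \<subseteq> {xs. length xs = 2 \<and> set xs \<subseteq> carrier G}" for x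
    using that
  proof (induction x rule: frag_induction)
    case zero
    have "\<kappa> 0 = \<one>\<^bsub>Q\<^esub>"
      using \<kappa>.hom_one by (simp add: F_def)
    then show ?case
      using \<theta>_0 \<iota>.hom_one add_subgroup_zero [OF C] by simp
  next
    case (one xs)
    then obtain a b where "xs = [a, b]" "a \<in> carrier G" "b \<in> carrier G"
      by (auto simp: numeral_2_eq_2 length_Suc_conv)
    then show ?case
      using simplex simplex_C by (simp add: u_def)
  next
    case (diff x y)
    have "\<kappa> (x - y) = \<kappa> x \<otimes>\<^bsub>Q\<^esub> inv\<^bsub>Q\<^esub> (\<kappa> y)"
      using \<kappa>_add [of "x - y" y] diff add_subgroup_diff [OF C] \<kappa>.hom_closed [of x] \<kappa>.hom_closed [of y]
        \<kappa>.hom_closed [of "x - y"] by (simp add: F_def Q.inv_solve_right)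
    then show ?case
      using diff add_subgroup_diff [OF C] bd_C1 \<kappa>.hom_closed [of x] \<kappa>.hom_closed [of y]
      by (simp add: bar_boundary_diff \<theta>_diff F_def)
  qed
  moreover have "supp c \<subseteq> {xs. length xs = 2 \<and> set xs \<subseteq> carrier G}"
    using c by (simp add: bar_cycles_carrier bar_chains_def)
  ultimately have "\<theta> (bar_boundary 2 G c) = \<iota> (\<kappa> c)" and cC: "c \<in> C"
    by blast+
  then have "\<iota> (\<kappa> c) = \<one>\<^bsub>E\<^esub>"
    using c \<theta>_0 by (simp add: bar_cycles_carrier)
  then have "\<kappa> c \<otimes>\<^bsub>Q\<^esub> inv\<^bsub>Q\<^esub> (u \<one> \<one>) = inv\<^bsub>Q\<^esub> (u \<one> \<one>)"
    by (simp add: \<iota>_def one_E)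
  then have "\<kappa> c = \<one>\<^bsub>Q\<^esub>"
    using u_closed \<kappa>.hom_closed [of c] cC by (simp add: F_def)
  then show ?thesis
    using \<kappa>_one [OF cC] by simp
qed

text \<open>Any lifts of two elements commute in \<open>L\<close>, so each commutator cycle lifts to
  a commutator cycle.\<close>

lemma (in bar_comm_group) two_cycles_liftable:
  assumes L: "comm_group L" and \<pi>: "\<pi> \<in> hom L G" "\<pi> ` carrier L = carrier G"
    and c: "c \<in> carrier (bar_cycles 2 G)"
  shows "c \<in> liftable_cycles 2 L G \<pi>"
proof (rule two_cycles_generated [OF add_subgroup_liftable _ _ _ c])
  interpret L: bar_comm_group L using L by (simp add: bar_comm_group_def)
  have cyc: "bar_map \<pi> d \<in> carrier (bar_cycles 2 G)" if "d \<in> carrier (bar_cycles 2 L)" for d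
    by (rule bar_map_in_cycles [OF \<pi>(1) that])
  show "liftable_cycles 2 L G \<pi> \<subseteq> carrier (bar_chains 2 G)"
  proof
    fix x assume "x \<in> liftable_cycles 2 L G \<pi>"
    then obtain b d where bd: "b \<in> bar_boundaries 2 G" "d \<in> carrier (bar_cycles 2 L)" "x = b + bar_map \<pi> d"
      unfolding liftable_cycles_def by blast
    have "x \<in> carrier (bar_cycles 2 G)"
      unfolding bd(3) using bd(1) bar_boundaries_subset
      by (intro add_subgroup_add [OF add_subgroup_bar_cycles] cyc bd(2)) blast
    then show "x \<in> carrier (bar_chains 2 G)"
      by (simp add: bar_cycles_carrier)
  qed
  show "bar_boundaries 2 G \<subseteq> liftable_cycles 2 L G \<pi>"
  proof
    fix b assume "b \<in> bar_boundaries 2 G"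
    then show "b \<in> liftable_cycles 2 L G \<pi>"
      using add_subgroup_zero [OF add_subgroup_bar_cycles, of 2 L]
      unfolding liftable_cycles_def by (intro CollectI exI [of _ b] exI [of _ 0]) simp
  qed
  fix a b assume "a \<in> carrier G" "b \<in> carrier G"
  then have "a \<in> \<pi> ` carrier L" "b \<in> \<pi> ` carrier L"
    unfolding \<pi>(2) .
  then obtain x y where xy: "x \<in> carrier L" "y \<in> carrier L" "\<pi> x = a" "\<pi> y = b"
    by (elim imageE) metis
  define d where "d = frag_of [x, y] - frag_of [y, x]"
  have "d \<in> carrier (bar_chains 2 L)"
    unfolding d_def using xy by (intro add_subgroup_diff [OF add_subgroup_bar_chains]) (auto simp: bar_chains_carrier)
  moreover have "bar_boundary 2 L d = 0"
    using L.m_comm [OF xy(1,2)]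
    by (simp add: d_def bar_boundary_diff bar_boundary_pair)
  moreover have "bar_map \<pi> d = frag_of [a, b] - frag_of [b, a]"
    by (simp add: d_def bar_map_diff xy)
  ultimately show "frag_of [a, b] - frag_of [b, a] \<in> liftable_cycles 2 L G \<pi>"
    using add_subgroup_zero [OF add_subgroup_bar_boundaries, of 2 G]
    unfolding liftable_cycles_def by (intro CollectI exI [of _ 0] exI [of _ d]) (simp add: bar_cycles_carrier)
qed

section \<open>Towers of epimorphisms\<close>

text \<open>Above level \<open>i\<close> preimages are chosen one after the other; below it the
  coordinates are forced.\<close>

lemma proj_inv_limit_surj:
  assumes A: "abelian_tower A p" and epi: "\<And>i. p i \<in> epi (A (Suc i)) (A i)"
  shows "(\<lambda>x. x i) ` carrier (inv_limit A p) = carrier (A i)"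
proof (intro equalityI subsetI)
  show "a \<in> carrier (A i)" if "a \<in> (\<lambda>x. x i) ` carrier (inv_limit A p)" for a
    using that by (auto simp: mem_inv_limit)
  fix a assume a: "a \<in> carrier (A i)"
  have surj: "\<exists>y\<in>carrier (A (Suc k)). p k y = x" if "x \<in> carrier (A k)" for k x
  proof -
    have "x \<in> p k ` carrier (A (Suc k))"
      using epi [of k] that by (simp add: epi_def)
    then show ?thesis by auto
  qed
  have "\<exists>f. \<forall>n. (f n \<in> carrier (A (i + n)) \<and> (n = 0 \<longrightarrow> f n = a)) \<and> p (i + n) (f (Suc n)) = f n"
  proof (rule dependent_nat_choice)
    show "\<exists>y. (y \<in> carrier (A (i + Suc n)) \<and> (Suc n = 0 \<longrightarrow> y = a)) \<and> p (i + n) y = x"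
      if "x \<in> carrier (A (i + n)) \<and> (n = 0 \<longrightarrow> x = a)" for x n
      using surj [of x "i + n"] that by auto
  qed (use a in auto)
  then obtain f where f: "\<And>n. f n \<in> carrier (A (i + n))" "f 0 = a" "\<And>n. p (i + n) (f (Suc n)) = f n"
    by auto
  \<comment> \<open>Counts downwards: \<open>g n\<close> is the coordinate at level
    \<open>i - n\<close>.\<close>
  define g where "g = rec_nat a (\<lambda>n v. p (i - Suc n) v)"
  have g_simps: "g 0 = a" "g (Suc n) = p (i - Suc n) (g n)" for n
    by (simp_all add: g_def)
  have g: "g n \<in> carrier (A (i - n))" if "n \<le> i" for n
    using that
  proof (induction n)
    case (Suc n)
    then have "g n \<in> carrier (A (Suc (i - Suc n)))"
      by (metis Suc_diff_le Suc_leD diff_Suc_Suc)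
    then show ?case
      using hom_in_carrier [OF abelian_towerD(3) [OF A]] by (simp add: g_simps)
  qed (use a in \<open>simp add: g_simps\<close>)
  define x where "x = (\<lambda>k. if k \<le> i then g (i - k) else f (k - i))"
  have "x k \<in> carrier (A k)" for k
    using g [of "i - k"] f(1) [of "k - i"] by (auto simp: x_def)
  moreover have "p k (x (Suc k)) = x k" for k
  proof (cases "k < i")
    case True
    then have "i - k = Suc (i - Suc k)" and "i - Suc (i - Suc k) = k" by auto
    then show ?thesis using True g_simps(2) [of "i - Suc k"] by (simp add: x_def)
  next
    case False
    then have "x k = f (k - i)" "x (Suc k) = f (Suc (k - i))"
      using f(2) g_simps(1) by (auto simp: x_def Suc_diff_le)
    then show ?thesis using f(3) [of "k - i"] False by simp
  qed
  ultimately have "x \<in> carrier (inv_limit A p)"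
    by (simp add: mem_inv_limit)
  moreover have "x i = a"
    by (simp add: x_def g_simps)
  ultimately show "a \<in> (\<lambda>x. x i) ` carrier (inv_limit A p)"
    by (metis imageI)
qed

lemma pow_torsion_subgroup: "x [^]\<^bsub>torsion_subgroup G\<^esub> (n::nat) = x [^]\<^bsub>G\<^esub> n"
  by (induction n) (simp_all add: torsion_subgroup_def)

lemma finitely_generated_bounded_torsion:
  assumes G: "comm_group G" and fg: "finitely_generated_group G"
  shows "bounded_exponent (torsion_subgroup G)"
proof -
  interpret comm_group G by (rule G)
  obtain S where S: "finite S" "S \<subseteq> carrier G" "generate G S = carrier G"
    using fg by (auto simp: finitely_generated_group_def)
  have a: "(\<lambda>s. s) \<in> S \<rightarrow> carrier G" using S by auto
  have "S \<subseteq> range (lincomb G S (\<lambda>s. s))"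
    using lincomb_single [OF a S(1)] by (metis rangeI subsetI)
  then have "carrier G \<subseteq> range (lincomb G S (\<lambda>s. s))"
    using generate_subgroup_incl [OF _ subgroup_lincomb [OF a]] S(3) by blast
  moreover obtain M :: nat where M: "0 < M"
    "\<forall>x\<in>range (lincomb G S (\<lambda>s. s)). (\<exists>k>0. x [^]\<^bsub>G\<^esub> (k::nat) = \<one>\<^bsub>G\<^esub>) \<longrightarrow> x [^]\<^bsub>G\<^esub> M = \<one>\<^bsub>G\<^esub>"
    using torsion_bounded [OF S(1) a] by auto
  ultimately have "x [^]\<^bsub>G\<^esub> M = \<one>\<^bsub>G\<^esub>" if "x \<in> carrier (torsion_subgroup G)" for x
    using that by (auto simp: torsion_subgroup_def)
  moreover have "\<one>\<^bsub>torsion_subgroup G\<^esub> = \<one>\<^bsub>G\<^esub>"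
    by (simp add: torsion_subgroup_def)
  ultimately show ?thesis
    using M(1) unfolding bounded_exponent_def pow_torsion_subgroup by auto
qed

lemma bounded_exponent_torsion_subgroupE:
  assumes "bounded_exponent (torsion_subgroup G)"
  obtains m :: nat where "0 < m"
    "\<And>x k. x \<in> carrier G \<Longrightarrow> 0 < k \<Longrightarrow> x [^]\<^bsub>G\<^esub> (k::nat) = \<one>\<^bsub>G\<^esub> \<Longrightarrow> x [^]\<^bsub>G\<^esub> m = \<one>\<^bsub>G\<^esub>"
proof -
  obtain m :: nat where "0 < m" "\<forall>x\<in>carrier (torsion_subgroup G). x [^]\<^bsub>torsion_subgroup G\<^esub> m = \<one>\<^bsub>torsion_subgroup G\<^esub>"
    using assms by (auto simp: bounded_exponent_def)
  then show thesis
    using that [of m] unfolding pow_torsion_subgroup by (auto simp: torsion_subgroup_def)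
qed

theorem theorem3:
  fixes A :: "nat \<Rightarrow> 'a monoid" and p :: "nat \<Rightarrow> 'a \<Rightarrow> 'a"
  assumes "abelian_tower A p"
    and "\<And>i. p i \<in> epi (A (Suc i)) (A i)"
  shows "cotorsion_group
           (cokernel (group_homology 2 (inv_limit A p)) (homology_limit 2 A p)
             (homology_limit_map 2 A)) \<and>
         ((\<forall>i. bounded_exponent (torsion_subgroup (A i))) \<longrightarrow>
         cotorsion_group
           (cokernel (group_homology 3 (inv_limit A p)) (homology_limit 3 A p)
             (homology_limit_map 3 A))) \<and>
         ((\<forall>i. finitely_generated_group (A i)) \<longrightarrow>
         cotorsion_group
           (cokernel (group_homology 3 (inv_limit A p)) (homology_limit 3 A p)
             (homology_limit_map 3 A)))"
proof -
  note A = abelian_towerD [OF assms(1)]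
  have L: "comm_group (inv_limit A p)"
    by (rule comm_group_inv_limit [OF assms(1)])
  have bar: "bar_comm_group (A i)" for i
    using A(1) by (simp add: bar_comm_group_def)
  have proj: "(\<lambda>x. x i) \<in> hom (inv_limit A p) (A i)" for i
    using proj_inv_limit_hom [OF assms(1), of i] by (simp add: group_hom_def group_hom_axioms_def)
  note surj = proj_inv_limit_surj [OF assms]
  have two: "cotorsion_group (cokernel (group_homology 2 (inv_limit A p)) (homology_limit 2 A p) (homology_limit_map 2 A))"
  proof (rule cotorsion_group_homology_cokernel [OF assms(1)])
    fix i
    \<comment> \<open>The map on second homology is onto at each level, so the multiple 1 will
      do.\<close>
    show "\<exists>k>0. \<forall>c\<in>carrier (bar_cycles 2 (A i)). frag_cmul (int k) c \<in> liftable_cycles 2 (inv_limit A p) (A i) (\<lambda>x. x i)"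
      using bar_comm_group.two_cycles_liftable [OF bar L proj surj] by (intro exI [of _ 1]) simp
  qed
  have three: "cotorsion_group (cokernel (group_homology 3 (inv_limit A p)) (homology_limit 3 A p) (homology_limit_map 3 A))"
    if bounded: "\<forall>i. bounded_exponent (torsion_subgroup (A i))"
  proof (rule cotorsion_group_homology_cokernel [OF assms(1)])
    fix i
    obtain m :: nat where m: "0 < m"
      "\<And>x k. x \<in> carrier (A i) \<Longrightarrow> 0 < k \<Longrightarrow> x [^]\<^bsub>A i\<^esub> (k::nat) = \<one>\<^bsub>A i\<^esub> \<Longrightarrow> x [^]\<^bsub>A i\<^esub> m = \<one>\<^bsub>A i\<^esub>"
      using bounded_exponent_torsion_subgroupE bounded by metis
    have "frag_cmul (int (m ^ (\<Sum>i\<le>3. i))) c \<in> liftable_cycles 3 (inv_limit A p) (A i) (\<lambda>x. x i)"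
      if "c \<in> carrier (bar_cycles 3 (A i))" for c
      by (rule bar_comm_group.bounded_torsion_liftable [OF bar L proj surj _ m(1) that]) (use m(2) in auto)
    then show "\<exists>k>0. \<forall>c\<in>carrier (bar_cycles 3 (A i)). frag_cmul (int k) c \<in> liftable_cycles 3 (inv_limit A p) (A i) (\<lambda>x. x i)"
      using m(1) by (intro exI [of _ "m ^ (\<Sum>i\<le>3. i)"]) simp
  qed
  show ?thesis
    using two three finitely_generated_bounded_torsion [OF A(1)] by blast
qed

end
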